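(* Assume Hypotheses (H), (Q), (H-ext), $\inf_sg_0(s)>-\infty$, $b_*:=\inf_sg_*(s)>-\infty$, $g_*'\in L^\infty(\mathbb R)$, and $\int_1^\infty\tilde h_{i,j,1}(s)s^{-(2n_*-1)}ds<\infty$ for all $i,j$. Let $n\ge\max\{n_0,n_*\}$ and $\varepsilon\in(0,\tilde\varepsilon_0)$. For $x\in\mathrm{dom}(A^n)\cap\mathbb X_\infty$ and $t\ge0$ define $\widehat{\mathcal E}^c_n(t)x\in\mathbb Y$ by $$C(t)x=\sum_{k=1}^m\mathrm{Res}\big(\lambda e^{\lambda t}R_A(\lambda)x,\mu_k\big)+\sum_{\ell=1}^p\mathrm{Res}\big(\lambda e^{\lambda t}R^\infty_A(\lambda)x,\nu_\ell\big)+\chi_{[0,\infty)}(g_*(0))\sum_{\alpha=0}^{n-1}\frac{t^{2\alpha}}{(2\alpha)!}A^\alpha x+\widehat{\mathcal E}^c_n(t)x.$$ Then for all $i,j\in\mathbb N$ there is $L^c(n,i,j,\varepsilon)>0$ such that for all $t\ge0$ and $x\in\mathrm{dom}(A^n)\cap\mathrm{Ker}(Q_j-I_{\mathbb Y})$, $$\|Q_i\widehat{\mathcal E}^c_n(t)x\|\le L^c(n,i,j,\varepsilon)e^{(\sup g_*+\varepsilon)t}(\|A^{n-1}x\|+\|A^nx\|).$$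
   Context: $\mathbb X$ complex Banach space; $A$ generates a strongly continuous cosine family $\{C(t)\}$ with $\|C(t)\|\le Me^{\omega|t|}$, $M\ge1,\omega>0$; $R_A(\lambda)=(\lambda^2-A)^{-1}$ for $\mathrm{Re}\lambda>\omega$. Finitely meromorphic point = finite Laurent principal part with finite-rank coefficients. Hypothesis (H): $g_0$ piecewise $C^1$, $\sup g_0<\omega$; (i) $R_A$ extends meromorphically to $\Omega_0=\{\mathrm{Re}\lambda>g_0(\mathrm{Im}\lambda)\}$; (ii) singularities in $\Omega_0\cap\{\mathrm{Re}\lambda\le\omega\}$: $\mathcal M=\{\mu_1,\dots,\mu_m\}$, finitely meromorphic; (iii) $\|R_A(\lambda)\|\le h_1(|\lambda|)h_2(\mathrm{Re}\lambda)$ on $\Omega_0\cap\{\mathrm{Re}\lambda\le\omega,|\mathrm{Im}\lambda|>\max|\mathrm{Im}\mu_k|\}$; (iv) $h_1(s)/s^{2n_0-1}\to0$, $h_2$ bounded on compacts. Hypothesis (Q): $\mathbb Y$ Fréchet, $\mathbb X\hookrightarrow\mathbb Y$, linear $Q_n:\mathbb Y\to\mathbb X$ with (Q1) $Q_n|_{\mathbb X}\in\mathcal B(\mathbb X)$; (Q2) $Q_nx\to x$; (Q3) $Q_nQ_k=Q_kQ_n=Q_n$ ($k\ge n+1$); (Q4) $Q_n(\mathrm{dom}A)\subseteq\mathrm{dom}A$, $(Q_n|_{\mathbb X})^*(\mathrm{dom}A^* )\subseteq\mathrm{dom}A^*$; (Q5) $A(\mathrm{dom}A\cap\mathrm{Ker}(Q_n-I))\subseteq\mathrm{Ker}(Q_n-I)$;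 (Q6) $Q_nAQ_kx=Q_nAx$ ($k\ge n+1$); (Q7) $(x,Ax)\mapsto(Q_nx,AQ_nx)$ continuous on $\mathrm{Graph}(A)$ in $\mathbb Y\times\mathbb Y$; (Q8) topology of $\mathbb Y$ given by seminorms $\|Q_ny\|_{\mathbb X}$. $\mathbb X_\infty=\bigcup_n\mathrm{Ker}(Q_n-I_{\mathbb Y})$; $\mathcal{CL}(\mathbb X_\infty,\mathbb Y)$ has seminorms $B\mapsto\|Q_nB\|$. Hypothesis (H-ext): $\delta_0>0$, piecewise $C^1$ $g_*$ with $g_*+\delta_0\le g_0$; (i) $R_A|_{\mathbb X_\infty}$ has a meromorphic $\mathcal{CL}(\mathbb X_\infty,\mathbb Y)$-valued extension $R^\infty_A$ to $\Omega_*=\{\mathrm{Re}\lambda>g_*(\mathrm{Im}\lambda)\}$; (ii) finitely many singularities $\nu_1,\dots,\nu_p$ in $\Omega_*\setminus\Omega_0$, finitely meromorphic; (iii) $\|Q_iR^\infty_A(\lambda)Q_j\|\le\tilde h_{i,j,1}(|\lambda|)\tilde h_{i,j,2}(\mathrm{Re}\lambda)$ for $\lambda\in\Omega_*\setminus\Omega_0$, $|\mathrm{Im}\lambda|>\max|\mathrm{Im}\nu_\ell|$, with piecewise continuous $\tilde h\ge0$; (iv) $\tilde h_{i,j,1}(s)/s^{2n_*-1}\to0$ for some $n_*$, and $\sup_{s\le\omega}e^{\beta_{i,j}s}\tilde h_{i,j,2}(s)<\infty$ for some $\beta_{i,j}>0$. $\varepsilon_0=\frac14\min\{\omega-\sup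 g_0,\mathrm{Re}\mu_k-g_0(\mathrm{Im}\mu_k)\}$, $\tilde\varepsilon_0=\frac14\min\{\varepsilon_0,\delta_0,\mathrm{Re}\nu_\ell-g_*(\mathrm{Im}\nu_\ell)\}$. *)

theory Defs
  imports "HOL-Analysis.Analysis"
begin

class cf_cvec = ab_group_add +
  fixes cscale :: "complex \<Rightarrow> 'a \<Rightarrow> 'a"
  assumes cscale_add_right: "cscale a (x + y) = cscale a x + cscale a y"
    and cscale_add_left: "cscale (a + b) x = cscale a x + cscale b x"
    and cscale_cscale: "cscale a (cscale b x) = cscale (a * b) x"
    and cscale_one: "cscale 1 x = x"

class cf_cbanach = banach + cf_cvec +
  assumes cscale_of_real: "cscale (complex_of_real r) x = scaleR r x"
    and norm_cscale: "norm (cscale c x) = cmod c * norm x"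

definition cf_clin :: "('a::cf_cvec \<Rightarrow> 'b::cf_cvec) \<Rightarrow> bool" where
  "cf_clin T \<longleftrightarrow> (\<forall>x y. T (x + y) = T x + T y) \<and> (\<forall>c x. T (cscale c x) = cscale c (T x))"

definition cf_bclin :: "('a::cf_cbanach \<Rightarrow> 'b::cf_cbanach) \<Rightarrow> bool" where
  "cf_bclin T \<longleftrightarrow> cf_clin T \<and> (\<exists>K. \<forall>x. norm (T x) \<le> K * norm x)"

definition cf_bfunc :: "('a::cf_cbanach \<Rightarrow> complex) \<Rightarrow> bool" where
  "cf_bfunc f \<longleftrightarrow> (\<forall>x y. f (x + y) = f x + f y) \<and> (\<forall>c x. f (cscale c x) = c * f x)
     \<and> (\<exists>K. \<forall>x. cmod (f x) \<le> K * norm x)"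

definition cf_cspan :: "'a::cf_cvec set \<Rightarrow> 'a set" where
  "cf_cspan F = {y. \<exists>G c. finite G \<and> G \<subseteq> F \<and> y = (\<Sum>v\<in>G. cscale (c v) v)}"

definition cf_finite_rank_on :: "'a set \<Rightarrow> ('a \<Rightarrow> 'b::cf_cvec) \<Rightarrow> bool" where
  "cf_finite_rank_on S T \<longleftrightarrow> (\<exists>F. finite F \<and> T ` S \<subseteq> cf_cspan F)"

definition cosine_family :: "(real \<Rightarrow> 'x::cf_cbanach \<Rightarrow> 'x) \<Rightarrow> bool" where
  "cosine_family C \<longleftrightarrow> (\<forall>t. cf_bclin (C t)) \<and> (\<forall>x. C 0 x = x)
     \<and> (\<forall>t s x. C (t + s) x + C (t - s) x = 2 *\<^sub>R C t (C s x))
     \<and> (\<forall>x. continuous_on UNIV (\<lambda>t. C t x))"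

definition cos_generator :: "(real \<Rightarrow> 'x::cf_cbanach \<Rightarrow> 'x) \<Rightarrow> 'x set \<Rightarrow> ('x \<Rightarrow> 'x) \<Rightarrow> bool" where
  "cos_generator C D A \<longleftrightarrow>
     D = {x. \<exists>y. ((\<lambda>t. (2 / t\<^sup>2) *\<^sub>R (C t x - x)) \<longlongrightarrow> y) (at 0)} \<and>
     (\<forall>x\<in>D. ((\<lambda>t. (2 / t\<^sup>2) *\<^sub>R (C t x - x)) \<longlongrightarrow> A x) (at 0))"

definition cf_res_inv :: "'x set \<Rightarrow> ('x \<Rightarrow> 'x) \<Rightarrow> complex \<Rightarrow> ('x::cf_cvec \<Rightarrow> 'x) \<Rightarrow> bool" where
  "cf_res_inv D A z T \<longleftrightarrow> (\<forall>x. T x \<in> D \<and> cscale z (T x) - A (T x) = x)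
     \<and> (\<forall>y\<in>D. T (cscale z y - A y) = y)"

definition cf_dom_adj :: "'x set \<Rightarrow> ('x \<Rightarrow> 'x) \<Rightarrow> ('x::cf_cbanach \<Rightarrow> complex) set" where
  "cf_dom_adj D A = {f. cf_bfunc f \<and> (\<exists>g. cf_bfunc g \<and> (\<forall>x\<in>D. f (A x) = g x))}"

definition cf_dom_pow :: "'x set \<Rightarrow> ('x \<Rightarrow> 'x) \<Rightarrow> nat \<Rightarrow> 'x set" where
  "cf_dom_pow D A n = {x. \<forall>k<n. (A ^^ k) x \<in> D}"

definition cf_ophol :: "complex set \<Rightarrow> (complex \<Rightarrow> 'x \<Rightarrow> 'x::cf_cbanach) \<Rightarrow> bool" where
  "cf_ophol S R \<longleftrightarrow> (\<forall>z\<in>S. cf_bclin (R z) \<and> (\<exists>F. cf_bclin F \<and>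
     (\<forall>e>0. \<exists>d>0. \<forall>w. 0 < cmod (w - z) \<and> cmod (w - z) < d \<longrightarrow>
        (\<forall>x. norm (R w x - R z x - cscale (w - z) (F x)) \<le> e * cmod (w - z) * norm x))))"

definition cf_op_fin_merom_at :: "(complex \<Rightarrow> 'x \<Rightarrow> 'x::cf_cbanach) \<Rightarrow> complex \<Rightarrow> bool" where
  "cf_op_fin_merom_at R p \<longleftrightarrow> (\<exists>r>0. \<exists>N::nat. \<exists>B h.
     (\<forall>k\<in>{1..N}. cf_bclin (B k) \<and> cf_finite_rank_on UNIV (B k)) \<and> cf_ophol (ball p r) h \<and>
     (\<forall>w\<in>ball p r - {p}. \<forall>x. R w x = (\<Sum>k=1..N. cscale (inverse ((w - p) ^ k)) (B k x)) + h w x))"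

definition cf_op_singular_at :: "(complex \<Rightarrow> 'x \<Rightarrow> 'x::cf_cbanach) \<Rightarrow> complex \<Rightarrow> bool" where
  "cf_op_singular_at R p \<longleftrightarrow> \<not> (\<exists>r>0. \<exists>h. cf_ophol (ball p r) h \<and> (\<forall>w\<in>ball p r - {p}. \<forall>x. R w x = h w x))"

text \<open>Y carries the topology of the seminorms y \<mapsto> norm (Q n y) (hypothesis (Q8));
  it is Frechet: Hausdorff and complete.\<close>
definition cf_frechet :: "(nat \<Rightarrow> 'y::cf_cvec \<Rightarrow> 'x::cf_cbanach) \<Rightarrow> bool" where
  "cf_frechet Q \<longleftrightarrow> (\<forall>y. (\<forall>n. Q n y = 0) \<longrightarrow> y = 0) \<and>
     (\<forall>s. (\<forall>n. Cauchy (\<lambda>k. Q n (s k))) \<longrightarrow> (\<exists>y. \<forall>n. (\<lambda>k. Q n (s k - y)) \<longlonglongrightarrow> 0))"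

definition cf_Xinf :: "('x \<Rightarrow> 'y) \<Rightarrow> (nat \<Rightarrow> 'y \<Rightarrow> 'x) \<Rightarrow> 'x set" where
  "cf_Xinf \<iota> Q = {x. \<exists>n. Q n (\<iota> x) = x}"

definition cf_CL :: "('x::cf_cbanach \<Rightarrow> 'y::cf_cvec) \<Rightarrow> (nat \<Rightarrow> 'y \<Rightarrow> 'x) \<Rightarrow> ('x \<Rightarrow> 'y) \<Rightarrow> bool" where
  "cf_CL \<iota> Q T \<longleftrightarrow> (\<forall>x\<in>cf_Xinf \<iota> Q. \<forall>y\<in>cf_Xinf \<iota> Q. T (x + y) = T x + T y)
     \<and> (\<forall>c. \<forall>x\<in>cf_Xinf \<iota> Q. T (cscale c x) = cscale c (T x))
     \<and> (\<forall>n. \<exists>K. \<forall>x\<in>cf_Xinf \<iota> Q. norm (Q n (T x)) \<le> K * norm x)"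

definition cf_clhol :: "('x::cf_cbanach \<Rightarrow> 'y::cf_cvec) \<Rightarrow> (nat \<Rightarrow> 'y \<Rightarrow> 'x) \<Rightarrow> complex set
     \<Rightarrow> (complex \<Rightarrow> 'x \<Rightarrow> 'y) \<Rightarrow> bool" where
  "cf_clhol \<iota> Q S R \<longleftrightarrow> (\<forall>z\<in>S. cf_CL \<iota> Q (R z) \<and> (\<exists>F. cf_CL \<iota> Q F \<and>
     (\<forall>n. \<forall>e>0. \<exists>d>0. \<forall>w. 0 < cmod (w - z) \<and> cmod (w - z) < d \<longrightarrow>
        (\<forall>x\<in>cf_Xinf \<iota> Q. norm (Q n (R w x - R z x - cscale (w - z) (F x))) \<le> e * cmod (w - z) * norm x))))"

definition cf_cl_fin_merom_at :: "('x::cf_cbanach \<Rightarrow> 'y::cf_cvec) \<Rightarrow> (nat \<Rightarrow> 'y \<Rightarrow> 'x)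
     \<Rightarrow> (complex \<Rightarrow> 'x \<Rightarrow> 'y) \<Rightarrow> complex \<Rightarrow> bool" where
  "cf_cl_fin_merom_at \<iota> Q R p \<longleftrightarrow> (\<exists>r>0. \<exists>N::nat. \<exists>B h.
     (\<forall>k\<in>{1..N}. cf_CL \<iota> Q (B k) \<and> cf_finite_rank_on (cf_Xinf \<iota> Q) (B k)) \<and> cf_clhol \<iota> Q (ball p r) h \<and>
     (\<forall>w\<in>ball p r - {p}. \<forall>x\<in>cf_Xinf \<iota> Q.
        R w x = (\<Sum>k=1..N. cscale (inverse ((w - p) ^ k)) (B k x)) + h w x))"

definition cf_cl_singular_at :: "('x::cf_cbanach \<Rightarrow> 'y::cf_cvec) \<Rightarrow> (nat \<Rightarrow> 'y \<Rightarrow> 'x)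
     \<Rightarrow> (complex \<Rightarrow> 'x \<Rightarrow> 'y) \<Rightarrow> complex \<Rightarrow> bool" where
  "cf_cl_singular_at \<iota> Q R p \<longleftrightarrow> \<not> (\<exists>r>0. \<exists>h. cf_clhol \<iota> Q (ball p r) h \<and>
      (\<forall>w\<in>ball p r - {p}. \<forall>x\<in>cf_Xinf \<iota> Q. R w x = h w x))"

text \<open>continuity of a linear map on Graph(A) \<subseteq> Y \<times> Y (hypothesis (Q7)), expressed via the
  defining seminorms (continuity of a linear map between locally convex spaces)\<close>
definition cf_Q7 :: "('x::cf_cbanach \<Rightarrow> 'y::cf_cvec) \<Rightarrow> (nat \<Rightarrow> 'y \<Rightarrow> 'x) \<Rightarrow> 'x set \<Rightarrow> ('x \<Rightarrow> 'x) \<Rightarrow> nat \<Rightarrow> bool" where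
  "cf_Q7 \<iota> Q D A n \<longleftrightarrow> (\<forall>k. \<exists>c N. \<forall>x\<in>D.
     norm (Q k (\<iota> (Q n (\<iota> x)))) + norm (Q k (\<iota> (A (Q n (\<iota> x)))))
       \<le> c * (\<Sum>j\<le>N. norm (Q j (\<iota> x)) + norm (Q j (\<iota> (A x)))))"

definition cf_xhol :: "complex set \<Rightarrow> (complex \<Rightarrow> 'x::cf_cbanach) \<Rightarrow> bool" where
  "cf_xhol S f \<longleftrightarrow> (\<forall>z\<in>S. \<exists>d. ((\<lambda>w. cscale (inverse (w - z)) (f w - f z)) \<longlongrightarrow> d) (at z))"

definition cf_yhol :: "(nat \<Rightarrow> 'y::cf_cvec \<Rightarrow> 'x::cf_cbanach) \<Rightarrow> complex set \<Rightarrow> (complex \<Rightarrow> 'y) \<Rightarrow> bool" where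
  "cf_yhol Q S f \<longleftrightarrow> (\<forall>z\<in>S. \<exists>d. \<forall>n.
     ((\<lambda>w. Q n (cscale (inverse (w - z)) (f w - f z) - d)) \<longlongrightarrow> 0) (at z))"

definition cf_xres :: "(complex \<Rightarrow> 'x::cf_cbanach) \<Rightarrow> complex \<Rightarrow> 'x" where
  "cf_xres f z = (THE c. \<exists>r>0. \<exists>N::nat. \<exists>a h. 1 \<le> N \<and> a 1 = c \<and> cf_xhol (ball z r) h \<and>
     (\<forall>w\<in>ball z r - {z}. f w = (\<Sum>k=1..N. cscale (inverse ((w - z) ^ k)) (a k)) + h w))"

definition cf_yres :: "(nat \<Rightarrow> 'y::cf_cvec \<Rightarrow> 'x::cf_cbanach) \<Rightarrow> (complex \<Rightarrow> 'y) \<Rightarrow> complex \<Rightarrow> 'y" where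
  "cf_yres Q f z = (THE c. \<exists>r>0. \<exists>N::nat. \<exists>a h. 1 \<le> N \<and> a 1 = c \<and> cf_yhol Q (ball z r) h \<and>
     (\<forall>w\<in>ball z r - {z}. f w = (\<Sum>k=1..N. cscale (inverse ((w - z) ^ k)) (a k)) + h w))"

definition pw_C1 :: "(real \<Rightarrow> real) \<Rightarrow> bool" where
  "pw_C1 g \<longleftrightarrow> (\<forall>a b. g piecewise_C1_differentiable_on {a..b})"

definition pw_cont :: "(real \<Rightarrow> real) \<Rightarrow> bool" where
  "pw_cont h \<longleftrightarrow> (\<forall>a b. \<exists>K. finite K \<and> continuous_on ({a..b} - K) h \<and>
     (\<forall>k\<in>K. (\<exists>l. (h \<longlongrightarrow> l) (at_left k)) \<and> (\<exists>l. (h \<longlongrightarrow> l) (at_right k))))"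

definition cf_eps0 :: "(real \<Rightarrow> real) \<Rightarrow> real \<Rightarrow> (nat \<Rightarrow> complex) \<Rightarrow> nat \<Rightarrow> real" where
  "cf_eps0 g0 \<omega> \<mu> m = (1/4) * Min ({\<omega> - Sup (range g0)} \<union> {Re (\<mu> k) - g0 (Im (\<mu> k)) | k. k < m})"

definition cf_epst0 :: "real \<Rightarrow> real \<Rightarrow> (real \<Rightarrow> real) \<Rightarrow> (nat \<Rightarrow> complex) \<Rightarrow> nat \<Rightarrow> real" where
  "cf_epst0 e0 \<delta>0 gs \<nu> p = (1/4) * Min ({e0, \<delta>0} \<union> {Re (\<nu> l) - gs (Im (\<nu> l)) | l. l < p})"

end

theory Submission
  imports Defs "HOL-Complex_Analysis.Complex_Analysis"
begin

text \<open>
  Everything is reduced to complex-valued functions by composing with a functional \<open>\<phi>\<close> that norms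
  the vector \<open>Q\<^sub>i E(t) x\<close>. With \<open>y = A\<^sup>n x\<close>, repeated use of \<open>z\<^sup>2 R(z) u = u + R(z) A u\<close> turns
  \<open>z R(z) x\<close> into a polynomial in \<open>1/z\<close> plus \<open>z\<^bsup>1 - 2n\<^esup> R(z) y\<close>, and the inverse Laplace integral of the
  latter over a vertical line to the right of \<open>\<omega>\<close> is \<open>C(t) x\<close> minus its Taylor polynomial. The line
  is shifted to the graph of \<open>g\<^sub>* + \<epsilon>'\<close>, picking up the residues at the poles and at \<open>0\<close>; the latter
  cancels the Taylor polynomial exactly when \<open>0\<close> lies to the right of the graph, so \<open>\<epsilon>' \<le> \<epsilon>\<close> is chosen
  such that \<open>g\<^sub>*(0) + \<epsilon>'\<close> is negative if and only if \<open>g\<^sub>*(0)\<close> is. The integral over the graph is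
  the remainder, and it converges absolutely because of the integrability of \<open>s \<mapsto> h\<^sub>1(s) s\<^bsup>1 - 2n\<^esup>\<close>.
\<close>

section \<open>Norming functionals\<close>

text \<open>The hypotheses bound the resolvent up to the line \<open>Re z = \<omega>\<close>, while
  the Laplace representation gives a bound to the right of it that blows up like
  \<open>1 / (Re z - \<omega>)\<close>. The horizontal sides of the contour cross this line, so a
  maximum principle on discs centred on it has to bridge the two regimes. The weight built from
  \<open>ht1\<close> is integrable as a function of the modulus, but the graph is parametrised by
  height; boundedness of the derivative of \<open>gs\<close> makes the two comparable and also
  bounds the arc length element. The generator is given by symmetric second difference quotients at
  0, so ordinary differentiability of the orbits under functionals rests on Schwarz's theorem about
  generalised second derivatives. Since the functional depends on \<open>t\<close> and
  \<open>x\<close>, every constant of the final bound is fixed before the functional is chosen.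
  Finally, \<open>Rinf\<close> acts on \<open>cf_Xinf\<close> only: the resolvent identity reaches
  it from the half-plane \<open>Re z > \<omega>\<close> by the identity theorem, and (Q5) keeps each
  \<open>A^k x\<close> in the same kernel as \<open>x\<close>.\<close>

definition sublinear :: "('a::real_vector \<Rightarrow> real) \<Rightarrow> bool" where
  "sublinear p \<longleftrightarrow> (\<forall>x y. p (x + y) \<le> p x + p y) \<and> (\<forall>r\<ge>0. \<forall>x. p (r *\<^sub>R x) = r * p x)"

lemma sublinear_zero: "sublinear p \<Longrightarrow> p 0 = 0"
  unfolding sublinear_def by (metis order_refl mult_zero_left scaleR_zero_left)

lemma sublinear_neg: "sublinear p \<Longrightarrow> - p (- x) \<le> p x"
  using sublinear_zero[of p] unfolding sublinear_def
  by (metis add.right_inverse add_le_cancel_left add.commute minus_add_cancel)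

text \<open>The norming functional is a minimal sublinear functional below \<open>descend norm z\<close>. A minimal
  \<open>q\<close> is linear, because \<open>descend q z\<close> is again sublinear and below \<open>q\<close>, which forces
  \<open>q (- z) = - q z\<close>.\<close>

definition descend :: "('a::real_vector \<Rightarrow> real) \<Rightarrow> 'a \<Rightarrow> 'a \<Rightarrow> real" where
  "descend p z y = (INF t\<in>{0..}. p (y + t *\<^sub>R z) - t * p z)"

lemma descend_bdd:
  assumes "sublinear p"
  shows "bdd_below ((\<lambda>t. p (y + t *\<^sub>R z) - t * p z) ` {0..})"
proof (rule bdd_belowI2)
  fix t :: real assume t: "t \<in> {0..}"
  have "t * p z = p ((y + t *\<^sub>R z) + (- y))"
    using assms t by (simp add: sublinear_def)
  also have "\<dots> \<le> p (y + t *\<^sub>R z) + p (- y)"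
    using assms unfolding sublinear_def by blast
  finally show "- p (- y) \<le> p (y + t *\<^sub>R z) - t * p z" by simp
qed

lemma descend_le:
  assumes "sublinear p" "t \<ge> 0"
  shows "descend p z y \<le> p (y + t *\<^sub>R z) - t * p z"
  unfolding descend_def by (rule cINF_lower[OF descend_bdd[OF assms(1)]]) (use assms in auto)

lemma descend_le_self: "sublinear p \<Longrightarrow> descend p z y \<le> p y"
  using descend_le[of p 0 z y] by simp

text \<open>The choice \<open>t = 1\<close> in the infimum. It is what makes a linear minorant of
  \<open>descend norm z\<close> attain the norm at \<open>z\<close>: the value of the minorant at
  \<open>- z\<close> is at most \<open>- norm z\<close>.\<close>

lemma descend_neg: "sublinear p \<Longrightarrow> descend p z (- z) \<le> - p z"
  using descend_le[of p 1 z "- z"] by (simp add: sublinear_zero)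

text \<open>Parameters \<open>s\<close> and \<open>t\<close> admissible for two vectors add up to
  one admissible for their sum, and \<open>t\<close> rescales to \<open>r * t\<close> under
  dilation, because the penalty \<open>t * p z\<close> is linear in \<open>t\<close>.\<close>

lemma sublinear_descend:
  assumes p: "sublinear p"
  shows "sublinear (descend p z)"
proof -
  have add: "descend p z (x + y) \<le> descend p z x + descend p z y" for x y
  proof -
    have "descend p z (x + y) - (p (y + t *\<^sub>R z) - t * p z) \<le> p (x + s *\<^sub>R z) - s * p z"
      if "s \<in> {0..}" "t \<in> {0..}" for s t :: real
    proof -
      have "descend p z (x + y) \<le> p ((x + y) + (s + t) *\<^sub>R z) - (s + t) * p z"
        using that by (intro descend_le p) auto
      also have "(x + y) + (s + t) *\<^sub>R z = (x + s *\<^sub>R z) + (y + t *\<^sub>R z)"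
        by (simp add: algebra_simps)
      also have "p \<dots> \<le> p (x + s *\<^sub>R z) + p (y + t *\<^sub>R z)"
        using p unfolding sublinear_def by blast
      finally show ?thesis by (simp add: algebra_simps)
    qed
    then have "descend p z (x + y) - (p (y + t *\<^sub>R z) - t * p z) \<le> descend p z x"
      if "t \<in> {0..}" for t
      using that unfolding descend_def[of p z x] by (intro cINF_greatest) auto
    then have "descend p z (x + y) - descend p z x \<le> p (y + t *\<^sub>R z) - t * p z"
      if "t \<in> {0..}" for t
      using that by (smt (verit))
    then have "descend p z (x + y) - descend p z x \<le> descend p z y"
      unfolding descend_def[of p z y] by (intro cINF_greatest) auto
    then show ?thesis by simp
  qed
  have le: "descend p z (r *\<^sub>R x) \<le> r * descend p z x" if r: "r > 0" for r x
  proof -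
    have "descend p z (r *\<^sub>R x) / r \<le> p (x + t *\<^sub>R z) - t * p z" if "t \<in> {0..}" for t
    proof -
      have "descend p z (r *\<^sub>R x) \<le> p (r *\<^sub>R x + (r * t) *\<^sub>R z) - (r * t) * p z"
        using that r by (intro descend_le p) auto
      also have "r *\<^sub>R x + (r * t) *\<^sub>R z = r *\<^sub>R (x + t *\<^sub>R z)" by (simp add: algebra_simps)
      also have "p \<dots> = r * p (x + t *\<^sub>R z)" using p r by (simp add: sublinear_def)
      finally show ?thesis using r by (simp add: field_simps)
    qed
    then have "descend p z (r *\<^sub>R x) / r \<le> descend p z x"
      unfolding descend_def[of p z x] by (intro cINF_greatest) auto
    then show ?thesis using r by (simp add: field_simps)
  qed
  have hom: "descend p z (r *\<^sub>R x) = r * descend p z x" if r: "r > 0" for r x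
  proof -
    \<comment> \<open>The one-sided inequality for \<open>1 / r\<close> in place of \<open>r\<close>
      is the reverse inequality.\<close>
    have "descend p z ((1 / r) *\<^sub>R (r *\<^sub>R x)) \<le> (1 / r) * descend p z (r *\<^sub>R x)"
      using r by (intro le) simp
    then show ?thesis using le[OF r, of x] r by (simp add: field_simps)
  qed
  have zero: "descend p z 0 = 0"
  proof -
    have "descend p z 0 = 2 * descend p z 0" using hom[of 2 0] by simp
    then show ?thesis by simp
  qed
  show ?thesis
    unfolding sublinear_def using add hom zero
    by (metis less_eq_real_def mult_zero_left scaleR_zero_left)
qed

lemma minimal_sublinear_linear:
  assumes q: "sublinear q" and min: "\<And>q'. sublinear q' \<Longrightarrow> (\<And>y. q' y \<le> q y) \<Longrightarrow> q' = q"
  shows "linear q"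
proof -
  have neg: "q (- z) = - q z" for z
  proof -
    have "descend q z = q" by (intro min sublinear_descend q descend_le_self)
    then have "q (- z) \<le> - q z" using descend_neg[OF q, of z] by simp
    then show ?thesis using sublinear_neg[OF q, of "z"] by simp
  qed
  have add: "q (x + y) = q x + q y" for x y
  proof -
    have "q (- (x + y)) \<le> q (- x) + q (- y)"
      using q unfolding sublinear_def by (metis minus_add_distrib)
    moreover have "q (x + y) \<le> q x + q y" using q unfolding sublinear_def by blast
    ultimately show ?thesis unfolding neg by simp
  qed
  show ?thesis
  proof (rule linearI)
    show "q (r *\<^sub>R x) = r *\<^sub>R q x" for r x
    proof (cases "r \<ge> 0")
      case False
      then have "q ((- r) *\<^sub>R x) = (- r) * q x" using q unfolding sublinear_def by (meson linear neg_0_le_iff_le)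
      then show ?thesis using neg[of "r *\<^sub>R x"] by simp
    qed (use q in \<open>simp add: sublinear_def\<close>)
  qed (rule add)
qed

text \<open>Zorn's lemma for the reversed order \<open>P\<close>, whose maximal elements are the
  minimal functionals. A chain is bounded below by its pointwise infimum, which is finite since
  every sublinear \<open>q\<close> below \<open>p\<close> satisfies
  \<open>q y \<ge> - p (- y)\<close>, and which is subadditive because the smaller of two members of
  a chain bounds both values at once.\<close>

lemma exists_minimal_sublinear:
  fixes p :: "'a::real_vector \<Rightarrow> real"
  assumes p: "sublinear p"
  shows "\<exists>q. sublinear q \<and> (\<forall>y. q y \<le> p y) \<and> (\<forall>q'. sublinear q' \<longrightarrow> (\<forall>y. q' y \<le> q y) \<longrightarrow> q' = q)"
proof -
  define S where "S = {q :: 'a \<Rightarrow> real. sublinear q \<and> q \<le> p}"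
  define P where "P = (\<lambda>a b :: 'a \<Rightarrow> real. b \<le> a)"
  have po: "partial_order_on S (relation_of P S)"
    by (rule partial_order_on_relation_ofI) (auto simp: P_def)
  have "\<exists>m\<in>S. \<forall>a\<in>S. P m a \<longrightarrow> a = m"
  proof (rule predicate_Zorn[OF po])
    fix Ch assume "Ch \<in> Chains (relation_of P S)"
    then have sub: "Ch \<subseteq> S" and tot: "\<And>a b. a \<in> Ch \<Longrightarrow> b \<in> Ch \<Longrightarrow> a \<le> b \<or> b \<le> a"
      by (auto simp: Chains_def relation_of_def P_def)
    show "\<exists>u\<in>S. \<forall>a\<in>Ch. P a u"
    proof (cases "Ch = {}")
      case True
      then show ?thesis using p by (auto simp: S_def)
    next
      case False
      define u where "u y = (INF q\<in>Ch. q y)" for y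
      have bdd: "bdd_below ((\<lambda>q. q y) ` Ch)" for y
      proof (rule bdd_belowI2)
        fix q assume "q \<in> Ch"
        then have "sublinear q" "q (- y) \<le> p (- y)" using sub by (auto simp: S_def le_fun_def)
        then show "- p (- y) \<le> q y" using sublinear_neg[of q y] by linarith
      qed
      have ule: "u y \<le> q y" if "q \<in> Ch" for q y
        unfolding u_def using cINF_lower[OF bdd that, of y] by simp
      have ugr: "c \<le> u y" if "\<And>q. q \<in> Ch \<Longrightarrow> c \<le> q y" for c y
        unfolding u_def using False that by (intro cINF_greatest) auto
      have add: "u (x + y) \<le> u x + u y" for x y
      proof -
        have *: "u (x + y) \<le> q x + q' y" if qq: "q \<in> Ch" "q' \<in> Ch" for q q'
        proof -
          obtain q0 where q0: "q0 \<in> Ch" "q0 \<le> q" "q0 \<le> q'" using tot[OF qq] qq by blast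
          have "u (x + y) \<le> q0 (x + y)" by (rule ule[OF q0(1)])
          also have "\<dots> \<le> q0 x + q0 y" using q0 sub by (auto simp: S_def sublinear_def)
          also have "\<dots> \<le> q x + q' y" using q0 by (auto simp: le_fun_def intro: add_mono)
          finally show ?thesis .
        qed
        have "u (x + y) - q' y \<le> u x" if "q' \<in> Ch" for q'
          by (rule ugr) (use *[OF _ that] in \<open>simp add: algebra_simps\<close>)
        then have "u (x + y) - u x \<le> u y"
          by (intro ugr) (simp add: algebra_simps)
        then show ?thesis by simp
      qed
      have hom: "u (r *\<^sub>R x) = r * u x" if r: "r > 0" for r x
      proof (rule antisym)
        have "u (r *\<^sub>R x) / r \<le> u x"
        proof (rule ugr)
          fix q assume q: "q \<in> Ch"
          then have "q (r *\<^sub>R x) = r * q x" using sub r by (auto simp: S_def sublinear_def)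
          then show "u (r *\<^sub>R x) / r \<le> q x" using ule[OF q, of "r *\<^sub>R x"] r by (simp add: field_simps)
        qed
        then show "u (r *\<^sub>R x) \<le> r * u x" using r by (simp add: field_simps)
        show "r * u x \<le> u (r *\<^sub>R x)"
        proof (rule ugr)
          fix q assume q: "q \<in> Ch"
          then have "q (r *\<^sub>R x) = r * q x" using sub r by (auto simp: S_def sublinear_def)
          then show "r * u x \<le> q (r *\<^sub>R x)" using ule[OF q, of x] r by simp
        qed
      qed
      have "u 0 = 2 * u 0" using hom[of 2 0] by simp
      then have "u 0 = 0" by simp
      then have "sublinear u" unfolding sublinear_def using add hom
        by (metis less_eq_real_def mult_zero_left scaleR_zero_left)
      moreover have "u \<le> p"
      proof -
        obtain q where "q \<in> Ch" using False by blast
        then show ?thesis using ule sub by (force simp: le_fun_def S_def intro: order_trans)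
      qed
      ultimately show ?thesis using ule by (intro bexI[of _ u]) (auto simp: S_def P_def le_fun_def)
    qed
  qed
  then obtain m where m: "m \<in> S" "\<And>a. a \<in> S \<Longrightarrow> a \<le> m \<Longrightarrow> a = m" by (auto simp: P_def)
  have "q' = m" if "sublinear q'" "\<forall>y. q' y \<le> m y" for q'
    using m that by (intro m(2)) (auto simp: S_def le_fun_def intro: order_trans)
  then show ?thesis using m(1) by (intro exI[of _ m]) (auto simp: S_def le_fun_def)
qed

text \<open>The Hahn-Banach theorem in the form needed here. A minimal \<open>q\<close> below
  \<open>descend norm z\<close> is linear and lies below the norm, and
  \<open>q (- z) \<le> - norm z\<close> forces equality at \<open>z\<close>.\<close>

theorem norming_real_functional:
  fixes z :: "'a::real_normed_vector"
  shows "\<exists>f. linear f \<and> (\<forall>x. f x \<le> norm x) \<and> f z = norm z"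
proof -
  have sn: "sublinear (norm :: 'a \<Rightarrow> real)"
    by (auto simp: sublinear_def norm_triangle_ineq)
  obtain q where q: "sublinear q" "\<And>y. q y \<le> descend norm z y"
      "\<And>q'. sublinear q' \<Longrightarrow> (\<And>y. q' y \<le> q y) \<Longrightarrow> q' = q"
    using exists_minimal_sublinear[OF sublinear_descend[OF sn, of z]] by blast
  have lin: "linear q" by (rule minimal_sublinear_linear[OF q(1,3)])
  have le: "q y \<le> norm y" for y
    using q(2)[of y] descend_le_self[OF sn, of z y] by linarith
  have "q (- z) \<le> - norm z" using q(2)[of "- z"] descend_neg[OF sn, of z] by linarith
  then have "q z = norm z" using linear_neg[OF lin, of z] le[of z] by simp
  then show ?thesis using lin le by blast
qed

section \<open>Complex scalars and complex norming functionals\<close>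

lemma cscale_zero_right [simp]: "cscale c (0 :: 'a::cf_cvec) = 0"
  using cscale_add_right[of c 0 "0 :: 'a"] by simp

lemma cscale_zero_left [simp]: "cscale 0 (x :: 'a::cf_cvec) = 0"
  using cscale_add_left[of 0 0 x] by simp

lemma cscale_minus_right: "cscale c (- (x :: 'a::cf_cvec)) = - cscale c x"
  using cscale_add_right[of c x "- x"] by (simp add: eq_neg_iff_add_eq_0 add.commute)

lemma cscale_minus_left: "cscale (- c) (x :: 'a::cf_cvec) = - cscale c x"
  using cscale_add_left[of c "- c" x] by (simp add: eq_neg_iff_add_eq_0 add.commute)

lemma cscale_diff_right: "cscale c (x - (y :: 'a::cf_cvec)) = cscale c x - cscale c y"
  using cscale_add_right[of c x "- y"] by (simp add: cscale_minus_right)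

lemma cscale_diff_left: "cscale (c - d) (x :: 'a::cf_cvec) = cscale c x - cscale d x"
  using cscale_add_left[of c "- d" x] by (simp add: cscale_minus_left)

text \<open>A real functional \<open>f\<close> is the real part of the complex one
  \<open>x \<mapsto> f x - \<i> f (\<i> x)\<close>. Rotating \<open>x\<close> by a unimodular scalar
  makes the value real, so the bound on \<open>f\<close> carries over to the modulus. At
  \<open>z\<close> the real part already exhausts the modulus, so the imaginary part
  vanishes.\<close>

theorem norming_functional:
  fixes z :: "'a::cf_cbanach"
  obtains \<phi> where "cf_bfunc \<phi>" "\<And>x. cmod (\<phi> x) \<le> norm x" "\<phi> z = complex_of_real (norm z)"
proof -
  obtain f where f: "linear f" "\<And>x. f x \<le> norm x" "f z = norm z"
    using norming_real_functional[of z] by blast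
  define \<phi> where "\<phi> x = Complex (f x) (- f (cscale \<i> x))" for x
  have add: "\<phi> (x + y) = \<phi> x + \<phi> y" for x y
    by (simp add: \<phi>_def complex_eq_iff linear_add[OF f(1)] cscale_add_right)
  have scale: "cscale c x = Re c *\<^sub>R x + Im c *\<^sub>R cscale \<i> x" for c and x :: 'a
  proof -
    have "cscale c x = cscale (complex_of_real (Re c) + complex_of_real (Im c) * \<i>) x"
      by (rule arg_cong2[where f = cscale]) (simp_all add: complex_eq_iff)
    then show ?thesis by (simp only: cscale_add_left cscale_cscale[symmetric] cscale_of_real)
  qed
  have ii: "cscale \<i> (cscale \<i> x) = - x" for x :: 'a
    by (simp add: cscale_cscale cscale_minus_left cscale_one)
  have re: "cscale \<i> (r *\<^sub>R x) = r *\<^sub>R cscale \<i> x" for r and x :: 'a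
    by (simp add: cscale_of_real[symmetric] cscale_cscale mult.commute)
  have hom: "\<phi> (cscale c x) = c * \<phi> x" for c x
    unfolding scale[of c x]
    by (simp add: \<phi>_def complex_eq_iff cscale_add_right re ii linear_add[OF f(1)] linear_neg[OF f(1)]
        linear_diff[OF f(1)] linear_cmul[OF f(1)])
  have le: "cmod (\<phi> x) \<le> norm x" for x
  proof (cases "\<phi> x = 0")
    case False
    define u where "u = cnj (\<phi> x) / cmod (\<phi> x)"
    have u: "cmod u = 1" "u * \<phi> x = cmod (\<phi> x)"
      using False by (auto simp: u_def norm_divide complex_norm_square[symmetric] power2_eq_square mult.commute)
    have "cmod (\<phi> x) = Re (\<phi> (cscale u x))" unfolding hom u by simp
    also have "\<dots> \<le> norm x" using f(2)[of "cscale u x"] u by (simp add: \<phi>_def norm_cscale)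
    finally show ?thesis .
  qed simp
  have "\<phi> z = norm z"
  proof -
    have "(Re (\<phi> z))\<^sup>2 + (Im (\<phi> z))\<^sup>2 \<le> (norm z)\<^sup>2"
      using le[of z] by (metis cmod_power2 norm_ge_zero power_mono)
    then have "Im (\<phi> z) = 0" using f(3) by (simp add: \<phi>_def)
    then show ?thesis using f(3) by (simp add: \<phi>_def complex_eq_iff)
  qed
  moreover have "cf_bfunc \<phi>" unfolding cf_bfunc_def using add hom le by (metis mult_1)
  ultimately show ?thesis using le that by blast
qed

section \<open>Residues of vector-valued functions\<close>

lemma cf_clin_diff: "cf_clin T \<Longrightarrow> T (x - y) = T x - T y"
  unfolding cf_clin_def by (metis add_diff_cancel_right' diff_add_cancel)

lemma cf_clin_zero: "cf_clin T \<Longrightarrow> T 0 = 0"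
  using cf_clin_diff[of T 0 0] by simp

lemma cf_clin_sum: "cf_clin T \<Longrightarrow> T (sum f S) = (\<Sum>k\<in>S. T (f k))"
  by (induction S rule: infinite_finite_induct) (auto simp: cf_clin_zero cf_clin_def)

lemma cf_clin_cscale: "cf_clin T \<Longrightarrow> T (cscale c x) = cscale c (T x)"
  by (simp add: cf_clin_def)

lemma cf_bfunc_diff: "cf_bfunc f \<Longrightarrow> f (x - y) = f x - f y"
  unfolding cf_bfunc_def by (metis add_diff_cancel_right' diff_add_cancel)

lemma cf_bfunc_zero: "cf_bfunc f \<Longrightarrow> f 0 = 0"
  using cf_bfunc_diff[of f 0 0] by simp

lemma cf_bfunc_sum: "cf_bfunc f \<Longrightarrow> f (sum g S) = (\<Sum>k\<in>S. f (g k))"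
  by (induction S rule: infinite_finite_induct) (auto simp: cf_bfunc_zero, simp add: cf_bfunc_def)

lemma cf_bfunc_cscale: "cf_bfunc f \<Longrightarrow> f (cscale c x) = c * f x"
  by (simp add: cf_bfunc_def)

lemma cf_bfunc_scaleR: "cf_bfunc f \<Longrightarrow> f (r *\<^sub>R x) = of_real r * f x"
  by (simp add: cf_bfunc_cscale flip: cscale_of_real)

lemma cf_bfunc_bounded_linear:
  assumes "cf_bfunc f"
  shows "bounded_linear f"
proof -
  obtain K where K: "\<And>x. cmod (f x) \<le> K * norm x" using assms by (auto simp: cf_bfunc_def)
  show ?thesis
  proof (rule bounded_linear_intro)
    show "f (r *\<^sub>R x) = r *\<^sub>R f x" for r x
      using cf_bfunc_scaleR[OF assms] by (simp add: scaleR_conv_of_real)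
    show "cmod (f x) \<le> norm x * K" for x using K[of x] by (simp add: mult.commute)
  qed (use assms in \<open>simp add: cf_bfunc_def\<close>)
qed

lemma cscale_sum_right: "cscale c (sum f S) = (\<Sum>k\<in>S. cscale c (f k))"
  by (induction S rule: infinite_finite_induct) (auto simp: cscale_add_right)

lemma cscale_sum_left: "cscale (sum f S) x = (\<Sum>k\<in>S. cscale (f k) x)"
  by (induction S rule: infinite_finite_induct) (auto simp: cscale_add_left)

lemma bounded_bilinear_cscale: "bounded_bilinear (cscale :: complex \<Rightarrow> 'a::cf_cbanach \<Rightarrow> 'a)"
proof (rule bounded_bilinear.intro)
  show "cscale (r *\<^sub>R a) b = r *\<^sub>R cscale a b" for r a and b :: 'a
    by (simp add: cscale_cscale scaleR_conv_of_real flip: cscale_of_real)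
  show "cscale a (r *\<^sub>R b) = r *\<^sub>R cscale a b" for r a and b :: 'a
    by (simp add: cscale_cscale mult.commute flip: cscale_of_real)
  show "\<exists>K. \<forall>a (b :: 'a). norm (cscale a b) \<le> norm a * norm b * K"
    by (intro exI[of _ 1]) (simp add: norm_cscale)
qed (simp_all add: cscale_add_left cscale_add_right)

lemmas tendsto_cscale = bounded_bilinear.tendsto[OF bounded_bilinear_cscale]

lemma functional_separates:
  fixes x y :: "'a::cf_cbanach"
  assumes "\<And>\<phi>. cf_bfunc \<phi> \<Longrightarrow> \<phi> x = \<phi> y"
  shows "x = y"
proof -
  obtain \<phi> where "cf_bfunc \<phi>" "\<phi> (x - y) = of_real (norm (x - y))"
    using norming_functional by blast
  then show ?thesis using assms[of \<phi>] by (simp add: cf_bfunc_diff)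
qed

section \<open>Laurent expansions of scalar functions\<close>

text \<open>Splitting \<open>q p\<close> off the numerator leaves \<open>w - p\<close> times the
  holomorphic difference quotient \<open>q1\<close>, which lowers the order of the pole by one. It
  serves to expand the product of an entire factor with the principal part of a resolvent.\<close>

lemma laurent_mult_pole:
  fixes q :: "complex \<Rightarrow> complex"
  assumes "q holomorphic_on ball p r" "r > 0"
  shows "\<exists>a h. h holomorphic_on ball p r \<and> (\<forall>w\<in>ball p r - {p}.
           q w * inverse ((w - p) ^ k) = (\<Sum>j=1..k. a j * inverse ((w - p) ^ j)) + h w)"
  using assms(1)
proof (induction k arbitrary: q)
  case 0
  then show ?case by auto
next
  case (Suc k)
  define q1 where "q1 w = (if w = p then deriv q p else (q w - q p) / (w - p))" for w
  have "q1 holomorphic_on ball p r"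
    unfolding q1_def using Suc.prems assms(2) by (intro pole_lemma) auto
  from Suc.IH[OF this] obtain a h where h: "h holomorphic_on ball p r"
    and e: "\<And>w. w \<in> ball p r - {p} \<Longrightarrow> q1 w * inverse ((w - p) ^ k) = (\<Sum>j=1..k. a j * inverse ((w - p) ^ j)) + h w"
    by blast
  have "q w * inverse ((w - p) ^ Suc k) = (\<Sum>j=1..Suc k. (if j = Suc k then q p else a j) * inverse ((w - p) ^ j)) + h w"
    if w: "w \<in> ball p r - {p}" for w
  proof -
    have "q w * inverse ((w - p) ^ Suc k) = q p * inverse ((w - p) ^ Suc k) + q1 w * inverse ((w - p) ^ k)"
      proof -
      have "q w = q p + (w - p) * q1 w" using w by (simp add: q1_def)
      then have "q w * inverse ((w - p) ^ Suc k)
          = (q p + (w - p) * q1 w) * (inverse (w - p) * inverse ((w - p) ^ k))"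
        by (simp only: power_Suc inverse_mult_distrib)
      also have "\<dots> = q p * (inverse (w - p) * inverse ((w - p) ^ k))
          + q1 w * ((w - p) * inverse (w - p)) * inverse ((w - p) ^ k)"
        by (simp only: distrib_right mult.assoc mult.left_commute[of "q1 w"])
      finally show ?thesis using w by simp
    qed
    also have "\<dots> = q p * inverse ((w - p) ^ Suc k) + ((\<Sum>j=1..k. a j * inverse ((w - p) ^ j)) + h w)"
      using e[OF w] by simp
    finally show ?thesis by simp
  qed
  then show ?case
    by (intro exI[of _ "\<lambda>j. if j = Suc k then q p else a j"] exI[of _ h] conjI ballI h)
qed

lemma residue_pole_power:
  "residue (\<lambda>w. a * inverse ((w - p) ^ k)) p = (if k = 1 then a else 0)"
proof (cases k)
  case 0
  have "residue (\<lambda>w. a) p = 0" by (rule residue_holo[of UNIV]) auto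
  then show ?thesis using 0 by simp
next
  case (Suc m)
  have "residue (\<lambda>w. a / (w - p) ^ Suc m) p = (deriv ^^ m) (\<lambda>_. a) p / fact m"
    by (rule residue_holomorphic_over_power[of UNIV]) auto
  moreover have "(deriv ^^ m) (\<lambda>_. a) p = (if m = 0 then a else 0)"
    by simp
  ultimately show ?thesis using Suc by (simp add: divide_inverse)
qed

text \<open>Links the algebraic description of a residue in \<open>cf_yres\<close>, the coefficient
  of order one in some Laurent expansion, with the analytic \<open>residue\<close>.\<close>

lemma residue_laurent:
  fixes f h :: "complex \<Rightarrow> complex" and a :: "nat \<Rightarrow> complex"
  assumes r: "r > 0" and N: "1 \<le> N" and h: "h holomorphic_on ball p r"
    and e: "\<And>w. w \<in> ball p r - {p} \<Longrightarrow> f w = (\<Sum>k=1..N. a k * inverse ((w - p) ^ k)) + h w"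
  shows "residue f p = a 1"
proof -
  define P where "P M w = (\<Sum>k=1..M. a k * inverse ((w - p) ^ k))" for M w
  have Phol: "P M holomorphic_on ball p r - {p}" for M
    unfolding P_def by (intro holomorphic_intros) auto
  have Pres: "residue (P M) p = (if M \<ge> 1 then a 1 else 0)" for M
  proof (induction M)
    case 0
    have "residue (\<lambda>w. 0) p = 0" by (rule residue_holo[of UNIV]) auto
    then show ?case by (simp add: P_def)
  next
    case (Suc M)
    have "residue (\<lambda>w. P M w + a (Suc M) * inverse ((w - p) ^ Suc M)) p
        = residue (P M) p + residue (\<lambda>w. a (Suc M) * inverse ((w - p) ^ Suc M)) p"
      using r by (intro residue_add[of "ball p r"] Phol holomorphic_intros) auto
    then show ?case using Suc residue_pole_power[of "a (Suc M)" p "Suc M"] by (auto simp: P_def)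
  qed
  have "residue f p = residue (\<lambda>w. P N w + h w) p"
  proof (rule residue_cong)
    have "\<forall>\<^sub>F w in at p. w \<in> ball p r - {p}"
      using r by (auto simp: eventually_at intro!: exI[of _ r] simp: dist_commute)
    then show "\<forall>\<^sub>F w in at p. f w = P N w + h w"
      by eventually_elim (use e in \<open>auto simp: P_def\<close>)
  qed simp
  also have "\<dots> = residue (P N) p + residue h p"
    using r h by (intro residue_add[of "ball p r"] Phol) (auto intro: holomorphic_on_subset)
  also have "residue h p = 0" using r h by (intro residue_holo[of "ball p r"]) auto
  finally show ?thesis using Pres N by simp
qed

section \<open>Holomorphy and residues with respect to the seminorms\<close>

text \<open>Limits are taken seminorm by seminorm, but one derivative \<open>d\<close> in the
  Frechet space has to serve all of them; linearity of \<open>Q n\<close> moves every quotient into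
  the Banach space.\<close>

lemma cf_yhol_iff:
  assumes Q: "\<And>n. cf_clin (Q n)"
  shows "cf_yhol Q S f \<longleftrightarrow> (\<forall>z\<in>S. \<exists>d. \<forall>n.
     ((\<lambda>w. cscale (inverse (w - z)) (Q n (f w) - Q n (f z))) \<longlongrightarrow> Q n d) (at z))"
proof -
  have "Q n (cscale (inverse (w - z)) (f w - f z) - d)
      = cscale (inverse (w - z)) (Q n (f w) - Q n (f z)) - Q n d" for n w z d
    by (simp add: cf_clin_diff[OF Q] cf_clin_cscale[OF Q])
  then show ?thesis unfolding cf_yhol_def by (simp add: LIM_zero_iff)
qed

lemma cf_yhol_const:
  assumes Q: "\<And>n. cf_clin (Q n)"
  shows "cf_yhol Q S (\<lambda>w. c)"
  unfolding cf_yhol_iff[OF Q] by (intro ballI exI[of _ 0]) (simp add: cf_clin_zero[OF Q])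

lemma cf_yhol_add:
  assumes Q: "\<And>n. cf_clin (Q n)" and "cf_yhol Q S f" "cf_yhol Q S g"
  shows "cf_yhol Q S (\<lambda>w. f w + g w)"
  unfolding cf_yhol_iff[OF Q]
proof
  fix z assume z: "z \<in> S"
  obtain d1 d2 where
    "\<And>n. ((\<lambda>w. cscale (inverse (w - z)) (Q n (f w) - Q n (f z))) \<longlongrightarrow> Q n d1) (at z)"
    "\<And>n. ((\<lambda>w. cscale (inverse (w - z)) (Q n (g w) - Q n (g z))) \<longlongrightarrow> Q n d2) (at z)"
    using assms(2,3) z unfolding cf_yhol_iff[OF Q] by meson
  then have "((\<lambda>w. cscale (inverse (w - z)) (Q n (f w) - Q n (f z))
      + cscale (inverse (w - z)) (Q n (g w) - Q n (g z))) \<longlongrightarrow> Q n d1 + Q n d2) (at z)" for n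
    by (intro tendsto_add)
  moreover have "Q n (x + y) = Q n x + Q n y" for n x y using Q[of n] by (simp add: cf_clin_def)
  ultimately show "\<exists>d. \<forall>n. ((\<lambda>w. cscale (inverse (w - z)) (Q n (f w + g w) - Q n (f z + g z)))
      \<longlongrightarrow> Q n d) (at z)"
    by (intro exI[of _ "d1 + d2"]) (simp add: add_diff_add cscale_add_right)
qed

lemma cf_yhol_sum:
  assumes Q: "\<And>n. cf_clin (Q n)" and "\<And>k. k \<in> I \<Longrightarrow> cf_yhol Q S (f k)"
  shows "cf_yhol Q S (\<lambda>w. \<Sum>k\<in>I. f k w)"
  using assms(2)
  by (induction I rule: infinite_finite_induct) (auto intro: cf_yhol_const[OF Q] cf_yhol_add[OF Q])

lemma cf_yhol_cscale:
  assumes Q: "\<And>n. cf_clin (Q n)" and f: "cf_yhol Q S f" and q: "q holomorphic_on S" and S: "open S"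
  shows "cf_yhol Q S (\<lambda>w. cscale (q w) (f w))"
  unfolding cf_yhol_iff[OF Q]
proof
  fix z assume z: "z \<in> S"
  obtain d where d: "\<And>n. ((\<lambda>w. cscale (inverse (w - z)) (Q n (f w) - Q n (f z))) \<longlongrightarrow> Q n d) (at z)"
    using f z unfolding cf_yhol_iff[OF Q] by meson
  have qd: "((\<lambda>w. (q w - q z) / (w - z)) \<longlongrightarrow> deriv q z) (at z)"
    using holomorphic_derivI[OF q S z] by (simp add: has_field_derivative_iff)
  have qc: "(q \<longlongrightarrow> q z) (at z)"
    using holomorphic_on_imp_continuous_on[OF q] z S by (simp add: continuous_on_eq_continuous_at isCont_def)
  have lim: "((\<lambda>w. cscale (q w) (cscale (inverse (w - z)) (Q n (f w) - Q n (f z)))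
      + cscale ((q w - q z) / (w - z)) (Q n (f z)))
      \<longlongrightarrow> cscale (q z) (Q n d) + cscale (deriv q z) (Q n (f z))) (at z)" for n
    by (intro tendsto_add tendsto_cscale qc d qd tendsto_const)
  have "cscale (q w) (cscale (inverse (w - z)) (Q n (f w) - Q n (f z)))
      + cscale ((q w - q z) / (w - z)) (Q n (f z))
    = cscale (inverse (w - z)) (Q n (cscale (q w) (f w)) - Q n (cscale (q z) (f z)))" for w n
    by (simp add: cf_clin_cscale[OF Q] cscale_diff_right cscale_diff_left cscale_cscale
        divide_inverse right_diff_distrib mult.commute)
  moreover have "Q n (x + y) = Q n x + Q n y" for n x y using Q[of n] by (simp add: cf_clin_def)
  ultimately show "\<exists>d. \<forall>n. ((\<lambda>w. cscale (inverse (w - z)) (Q n (cscale (q w) (f w)) - Q n (cscale (q z) (f z))))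
      \<longlongrightarrow> Q n d) (at z)"
    using lim by (intro exI[of _ "cscale (q z) d + cscale (deriv q z) (f z)"])
      (simp add: cf_clin_cscale[OF Q])
qed

lemma cf_yhol_functional_holomorphic:
  assumes Q: "\<And>n. cf_clin (Q n)" and f: "cf_yhol Q S f" and \<phi>: "cf_bfunc \<phi>" and S: "open S"
  shows "(\<lambda>w. \<phi> (Q n (f w))) holomorphic_on S"
  unfolding holomorphic_on_open[OF S]
proof
  fix z assume z: "z \<in> S"
  obtain d where "((\<lambda>w. cscale (inverse (w - z)) (Q n (f w) - Q n (f z))) \<longlongrightarrow> Q n d) (at z)"
    using f z unfolding cf_yhol_iff[OF Q] by meson
  then have "((\<lambda>w. \<phi> (cscale (inverse (w - z)) (Q n (f w) - Q n (f z)))) \<longlongrightarrow> \<phi> (Q n d)) (at z)"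
    by (rule bounded_linear.tendsto[OF cf_bfunc_bounded_linear[OF \<phi>]])
  then have "((\<lambda>w. (\<phi> (Q n (f w)) - \<phi> (Q n (f z))) / (w - z)) \<longlongrightarrow> \<phi> (Q n d)) (at z)"
    by (simp add: cf_bfunc_cscale[OF \<phi>] cf_bfunc_diff[OF \<phi>] divide_inverse mult.commute)
  then show "\<exists>f'. ((\<lambda>w. \<phi> (Q n (f w))) has_field_derivative f') (at z)"
    by (auto simp: has_field_derivative_iff)
qed

lemma cf_clhol_imp_yhol:
  assumes Q: "\<And>n. cf_clin (Q n)" and R: "cf_clhol \<iota> Q S R" and x: "x \<in> cf_Xinf \<iota> Q"
  shows "cf_yhol Q S (\<lambda>w. R w x)"
  unfolding cf_yhol_iff[OF Q]
proof
  fix z assume z: "z \<in> S"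
  obtain F where F: "\<forall>n. \<forall>e>0. \<exists>d>0. \<forall>w. 0 < cmod (w - z) \<and> cmod (w - z) < d \<longrightarrow>
        (\<forall>x\<in>cf_Xinf \<iota> Q. norm (Q n (R w x - R z x - cscale (w - z) (F x))) \<le> e * cmod (w - z) * norm x)"
    using bspec[OF R[unfolded cf_clhol_def] z] by (elim conjE exE)
  have "((\<lambda>w. cscale (inverse (w - z)) (Q n (R w x) - Q n (R z x))) \<longlongrightarrow> Q n (F x)) (at z)" for n
    unfolding LIM_def
  proof (intro allI impI)
    fix e :: real assume e: "e > 0"
    \<comment> \<open>The operator estimate carries a factor \<open>norm x\<close>; the summand 1
      admits \<open>x = 0\<close> and makes the resulting inequality strict.\<close>
    then have "e / (norm x + 1) > 0" by (simp add: add_nonneg_pos)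
    then obtain d where d: "d > 0" "\<And>w. 0 < cmod (w - z) \<Longrightarrow> cmod (w - z) < d \<Longrightarrow>
        norm (Q n (R w x - R z x - cscale (w - z) (F x))) \<le> e / (norm x + 1) * cmod (w - z) * norm x"
      using F[rule_format, of "e / (norm x + 1)" n] x by blast
    have "dist (cscale (inverse (w - z)) (Q n (R w x) - Q n (R z x))) (Q n (F x)) < e"
      if w: "w \<noteq> z" "dist w z < d" for w
    proof -
      have "cscale (inverse (w - z)) (Q n (R w x) - Q n (R z x)) - Q n (F x)
          = cscale (inverse (w - z)) (Q n (R w x - R z x - cscale (w - z) (F x)))"
        using w by (simp add: cf_clin_diff[OF Q] cf_clin_cscale[OF Q] cscale_diff_right cscale_cscale cscale_one)
      then have "dist (cscale (inverse (w - z)) (Q n (R w x) - Q n (R z x))) (Q n (F x))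
          = inverse (cmod (w - z)) * norm (Q n (R w x - R z x - cscale (w - z) (F x)))"
        by (simp add: dist_norm norm_cscale norm_inverse)
      also have "\<dots> \<le> inverse (cmod (w - z)) * (e / (norm x + 1) * cmod (w - z) * norm x)"
        using w d(2)[of w] by (intro mult_left_mono) (auto simp: dist_norm)
      also have "\<dots> = e * (norm x / (norm x + 1))" using w by (simp add: field_simps)
      also have "\<dots> < e * 1"
        using e by (intro mult_strict_left_mono) (auto simp: divide_less_eq_1 add_nonneg_pos)
      finally show ?thesis by simp
    qed
    then show "\<exists>s>0. \<forall>w. w \<noteq> z \<and> dist w z < s \<longrightarrow>
        dist (cscale (inverse (w - z)) (Q n (R w x) - Q n (R z x))) (Q n (F x)) < e"
      using d(1) by blast
  qed
  then show "\<exists>d. \<forall>n. ((\<lambda>w. cscale (inverse (w - z)) (Q n (R w x) - Q n (R z x))) \<longlongrightarrow> Q n d) (at z)"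
    by blast
qed

text \<open>The definite description calls for existence and uniqueness. Uniqueness: every
  functional of every \<open>Q n c\<close> is a scalar residue, functionals separate the points of
  the Banach space, and the \<open>Q n\<close> separate the points of the Frechet space. Existence:
  the product of \<open>q\<close> with the principal part of \<open>R\<close> is regrouped by the
  order of the pole.\<close>

lemma functional_yres:
  fixes Q :: "nat \<Rightarrow> 'y::cf_cvec \<Rightarrow> 'x::cf_cbanach"
  assumes Q: "\<And>n. cf_clin (Q n)" and hausdorff: "\<And>y. (\<And>n. Q n y = 0) \<Longrightarrow> y = 0"
    and R: "cf_cl_fin_merom_at \<iota> Q R p" and x: "x \<in> cf_Xinf \<iota> Q"
    and q: "q holomorphic_on UNIV" and \<phi>: "cf_bfunc \<phi>"
  shows "\<phi> (Q n (cf_yres Q (\<lambda>w. cscale (q w) (R w x)) p)) = residue (\<lambda>w. q w * \<phi> (Q n (R w x))) p"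
proof -
  let ?f = "\<lambda>w. cscale (q w) (R w x)"
  define P where "P c \<longleftrightarrow> (\<exists>r>0. \<exists>N::nat. \<exists>a h. 1 \<le> N \<and> a 1 = c \<and> cf_yhol Q (ball p r) h \<and>
     (\<forall>w\<in>ball p r - {p}. ?f w = (\<Sum>k=1..N. cscale (inverse ((w - p) ^ k)) (a k)) + h w))" for c
  \<comment> \<open>\<open>\<phi>\<close> is rebound here: uniqueness uses the identity for all
    functionals, not only for the given one.\<close>
  have res: "\<phi> (Q n c) = residue (\<lambda>w. q w * \<phi> (Q n (R w x))) p" if "P c" "cf_bfunc \<phi>" for c n \<phi>
  proof -
    obtain r N a h where *: "r > 0" "1 \<le> N" "a 1 = c" "cf_yhol Q (ball p r) h"
      "\<And>w. w \<in> ball p r - {p} \<Longrightarrow> ?f w = (\<Sum>k=1..N. cscale (inverse ((w - p) ^ k)) (a k)) + h w"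
      using \<open>P c\<close> unfolding P_def by blast
    have "residue (\<lambda>w. q w * \<phi> (Q n (R w x))) p = \<phi> (Q n (a 1))"
    proof (rule residue_laurent[OF *(1,2)])
      show "(\<lambda>w. \<phi> (Q n (h w))) holomorphic_on ball p r"
        by (rule cf_yhol_functional_holomorphic[OF Q *(4) that(2)]) simp
      fix w assume w: "w \<in> ball p r - {p}"
      have "q w * \<phi> (Q n (R w x)) = \<phi> (Q n (?f w))"
        by (simp add: cf_clin_cscale[OF Q] cf_bfunc_cscale[OF that(2)])
      also have "\<dots> = \<phi> (Q n (\<Sum>k=1..N. cscale (inverse ((w - p) ^ k)) (a k)) + Q n (h w))"
        unfolding *(5)[OF w] using Q[of n] by (simp add: cf_clin_def)
      also have "\<dots> = \<phi> (Q n (\<Sum>k=1..N. cscale (inverse ((w - p) ^ k)) (a k))) + \<phi> (Q n (h w))"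
        using that(2) by (simp add: cf_bfunc_def)
      also have "\<phi> (Q n (\<Sum>k=1..N. cscale (inverse ((w - p) ^ k)) (a k)))
          = (\<Sum>k=1..N. \<phi> (Q n (a k)) * inverse ((w - p) ^ k))"
        by (simp add: cf_clin_sum[OF Q] cf_clin_cscale[OF Q] cf_bfunc_sum[OF that(2)]
            cf_bfunc_cscale[OF that(2)] mult.commute)
      finally show "q w * \<phi> (Q n (R w x)) = (\<Sum>k=1..N. \<phi> (Q n (a k)) * inverse ((w - p) ^ k)) + \<phi> (Q n (h w))" .
    qed
    then show ?thesis using *(3) by simp
  qed
  have uniq: "c = c'" if "P c" "P c'" for c c'
  proof -
    have "Q n c = Q n c'" for n
      by (rule functional_separates) (simp add: res[OF that(1)] res[OF that(2)])
    then have "c - c' = 0" by (intro hausdorff) (simp add: cf_clin_diff[OF Q])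
    then show ?thesis by simp
  qed
  have "\<exists>c. P c"
  proof -
    obtain r N B h where r: "r > 0" and h: "cf_clhol \<iota> Q (ball p r) h"
      and e: "\<And>w x. w \<in> ball p r - {p} \<Longrightarrow> x \<in> cf_Xinf \<iota> Q \<Longrightarrow>
        R w x = (\<Sum>k=1..N. cscale (inverse ((w - p) ^ k)) (B k x)) + h w x"
      using R unfolding cf_cl_fin_merom_at_def by blast
    have qb: "q holomorphic_on ball p r" using q by (rule holomorphic_on_subset) simp
    have "\<forall>k. \<exists>a g. g holomorphic_on ball p r \<and> (\<forall>w\<in>ball p r - {p}.
        q w * inverse ((w - p) ^ k) = (\<Sum>j=1..k. a j * inverse ((w - p) ^ j)) + g w)"
      using laurent_mult_pole[OF qb r] by blast
    then obtain a g where g: "\<And>k. g k holomorphic_on ball p r"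
      and ag: "\<And>k w. w \<in> ball p r - {p} \<Longrightarrow>
        q w * inverse ((w - p) ^ k) = (\<Sum>j=1..k. a k j * inverse ((w - p) ^ j)) + g k w"
      by metis
    define b where "b j = (\<Sum>k=1..N. cscale (if j \<le> k then a k j else 0) (B k x))" for j
    define H where "H w = (\<Sum>k=1..N. cscale (g k w) (B k x)) + cscale (q w) (h w x)" for w
    have "cf_yhol Q (ball p r) H"
      unfolding H_def
      by (intro cf_yhol_add[OF Q] cf_yhol_sum[OF Q] cf_yhol_cscale[OF Q] cf_yhol_const[OF Q]
          cf_clhol_imp_yhol[OF Q h x] g qb) auto
    \<comment> \<open>The upper limit \<open>N + 1\<close> meets the condition
      \<open>1 \<le> N\<close> of the definition also when the principal part is empty; the
      additional coefficient \<open>b (N + 1)\<close> is 0.\<close>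
    moreover have "?f w = (\<Sum>j=1..N+1. cscale (inverse ((w - p) ^ j)) (b j)) + H w"
      if w: "w \<in> ball p r - {p}" for w
    proof -
      have "(\<Sum>j=1..N+1. cscale (inverse ((w - p) ^ j)) (b j))
          = (\<Sum>j=1..N+1. \<Sum>k=1..N. cscale ((if j \<le> k then a k j else 0) * inverse ((w - p) ^ j)) (B k x))"
        by (simp add: b_def cscale_sum_right cscale_cscale mult.commute)
      also have "\<dots> = (\<Sum>k=1..N. \<Sum>j=1..N+1. cscale ((if j \<le> k then a k j else 0) * inverse ((w - p) ^ j)) (B k x))"
        by (rule sum.swap)
      also have "\<dots> = (\<Sum>k=1..N. cscale (\<Sum>j=1..k. a k j * inverse ((w - p) ^ j)) (B k x))"
      proof (rule sum.cong[OF refl])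
        fix k assume k: "k \<in> {1..N}"
        have "(\<Sum>j=1..N+1. cscale ((if j \<le> k then a k j else 0) * inverse ((w - p) ^ j)) (B k x))
            = cscale (\<Sum>j=1..N+1. (if j \<le> k then a k j else 0) * inverse ((w - p) ^ j)) (B k x)"
          by (simp only: cscale_sum_left)
        also have "(\<Sum>j=1..N+1. (if j \<le> k then a k j else 0) * inverse ((w - p) ^ j))
            = (\<Sum>j=1..k. a k j * inverse ((w - p) ^ j))"
          using k by (intro sum.mono_neutral_cong_right) auto
        finally show "(\<Sum>j=1..N+1. cscale ((if j \<le> k then a k j else 0) * inverse ((w - p) ^ j)) (B k x))
            = cscale (\<Sum>j=1..k. a k j * inverse ((w - p) ^ j)) (B k x)" .
      qed
      finally have 1: "(\<Sum>j=1..N+1. cscale (inverse ((w - p) ^ j)) (b j))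
          = (\<Sum>k=1..N. cscale (\<Sum>j=1..k. a k j * inverse ((w - p) ^ j)) (B k x))" .
      have "?f w = (\<Sum>k=1..N. cscale (q w * inverse ((w - p) ^ k)) (B k x)) + cscale (q w) (h w x)"
        unfolding e[OF w x] by (simp add: cscale_add_right cscale_sum_right cscale_cscale)
      also have "\<dots> = (\<Sum>k=1..N. cscale (\<Sum>j=1..k. a k j * inverse ((w - p) ^ j)) (B k x)) + H w"
        unfolding H_def ag[OF w] by (simp add: cscale_add_left sum.distrib add.assoc)
      finally show ?thesis unfolding 1 .
    qed
    ultimately have "P (b 1)"
      unfolding P_def by (intro exI[of _ r] exI[of _ "N + 1"] exI[of _ b] exI[of _ H] conjI ballI r) simp_all
    then show ?thesis ..
  qed
  then obtain c where c: "P c" by blast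
  have "cf_yres Q ?f p = (THE c. P c)" unfolding cf_yres_def P_def ..
  also have "\<dots> = c" using c uniq by blast
  finally show ?thesis using res[OF c \<phi>] by simp
qed

text \<open>A Banach-space-valued residue is the special case in which the seminorm family is constantly
  the norm.\<close>

lemma cf_xres_eq_yres: "cf_xres f z = cf_yres (\<lambda>_ x. x) f z"
  unfolding cf_xres_def cf_yres_def cf_xhol_def cf_yhol_def by (simp add: LIM_zero_iff)

lemma cf_op_fin_merom_imp_cl:
  fixes R :: "complex \<Rightarrow> 'a::cf_cbanach \<Rightarrow> 'a"
  assumes "cf_op_fin_merom_at R p"
  shows "cf_cl_fin_merom_at (\<lambda>x. x) (\<lambda>_ x. x) R p"
proof -
  have X: "cf_Xinf (\<lambda>x. x) (\<lambda>_ x. x) = (UNIV :: 'a set)" by (auto simp: cf_Xinf_def)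
  have CL: "cf_CL (\<lambda>x. x) (\<lambda>_ x. x) T" if "cf_bclin T" for T :: "'a \<Rightarrow> 'a"
    using that by (auto simp: cf_CL_def cf_bclin_def cf_clin_def cf_Xinf_def)
  have hol: "cf_clhol (\<lambda>x. x) (\<lambda>_ x. x) S h" if "cf_ophol S h" for S and h :: "complex \<Rightarrow> 'a \<Rightarrow> 'a"
  proof -
    have CLt: "cf_CL (\<lambda>x. x) (\<lambda>_ x. x) T = cf_bclin T" for T :: "'a \<Rightarrow> 'a"
      by (auto simp: cf_CL_def cf_bclin_def cf_clin_def cf_Xinf_def)
    show ?thesis
      using that unfolding cf_ophol_def cf_clhol_def CLt X by simp
  qed
  obtain r N B h where *: "r > 0" "\<And>k. k \<in> {1..N} \<Longrightarrow> cf_bclin (B k) \<and> cf_finite_rank_on UNIV (B k)"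
    "cf_ophol (ball p r) h"
    "\<And>w x. w \<in> ball p r - {p} \<Longrightarrow> R w x = (\<Sum>k=1..N. cscale (inverse ((w - p) ^ k)) (B k x)) + h w x"
    using assms unfolding cf_op_fin_merom_at_def by blast
  show ?thesis unfolding cf_cl_fin_merom_at_def X
    by (rule exI[of _ r], rule conjI[OF *(1)], rule exI[of _ N], rule exI[of _ B], rule exI[of _ h])
      (intro conjI ballI CL hol *(3) *(2)[THEN conjunct1] *(2)[THEN conjunct2] *(4), assumption+)
qed

lemma functional_xres:
  assumes "cf_op_fin_merom_at R p" "q holomorphic_on UNIV" "cf_bfunc \<phi>"
  shows "\<phi> (cf_xres (\<lambda>w. cscale (q w) (R w x)) p) = residue (\<lambda>w. q w * \<phi> (R w x)) p"
  unfolding cf_xres_eq_yres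
  using functional_yres[of "\<lambda>_ x. x" "\<lambda>x. x" R p x q \<phi>] assms cf_op_fin_merom_imp_cl[OF assms(1)]
  by (simp add: cf_clin_def cf_Xinf_def)

section \<open>Cosine families and truncated Laplace transforms\<close>

text \<open>A positive value would survive the subtraction of a small concave parabola. The
  difference \<open>u\<close> then has an interior maximum, where second differences are
  nonpositive, although its symmetric second derivative is \<open>2 * \<eta> > 0\<close>.\<close>

lemma zero_schwarz_derivative_nonpos:
  fixes v :: "real \<Rightarrow> real"
  assumes cont: "continuous_on {a..b} v" and ends: "v a = 0" "v b = 0"
    and schwarz: "\<And>t. a < t \<Longrightarrow> t < b \<Longrightarrow> ((\<lambda>h. (v (t + h) + v (t - h) - 2 * v t) / h\<^sup>2) \<longlongrightarrow> 0) (at 0)"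
    and x: "x \<in> {a..b}"
  shows "v x \<le> 0"
proof (rule ccontr)
  assume "\<not> v x \<le> 0"
  then have vx: "v x > 0" and ab: "a < x" "x < b" using ends x by (auto simp: less_eq_real_def)
  \<comment> \<open>With this \<open>\<eta>\<close> the parabola at \<open>x\<close> equals half of
    \<open>v x\<close>, so \<open>u x = v x / 2\<close> stays positive.\<close>
  define \<eta> where "\<eta> = v x / (2 * ((x - a) * (b - x)))"
  have "(x - a) * (b - x) > 0" using ab by simp
  then have \<eta>: "\<eta> > 0" and \<eta>2: "\<eta> * ((x - a) * (b - x)) = v x / 2"
    using vx unfolding \<eta>_def by (simp_all only: zero_less_divide_iff zero_less_mult_iff) (auto simp only: times_divide_eq_left, auto)
  define u where "u s = v s - \<eta> * ((s - a) * (b - s))" for s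
  have "continuous_on {a..b} u" unfolding u_def by (intro continuous_intros cont)
  then obtain t where t: "t \<in> {a..b}" "\<And>s. s \<in> {a..b} \<Longrightarrow> u s \<le> u t"
    using continuous_attains_sup[of "{a..b}" u] x by auto
  have "u x > 0" using \<eta>2 vx by (simp add: u_def)
  then have "u t > 0" using t(2)[OF x] by simp
  moreover have "u a = 0" "u b = 0" using ends by (simp_all add: u_def)
  ultimately have tab: "a < t" "t < b" using t(1) by (auto simp: less_eq_real_def)
  have "(u (t + h) + u (t - h) - 2 * u t) / h\<^sup>2 = (v (t + h) + v (t - h) - 2 * v t) / h\<^sup>2 + 2 * \<eta>"
    if "h \<noteq> 0" for h
  proof -
    have "u (t + h) + u (t - h) - 2 * u t = (v (t + h) + v (t - h) - 2 * v t) + 2 * \<eta> * h\<^sup>2"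
      by (simp add: u_def power2_eq_square algebra_simps)
    then show ?thesis using that by (simp add: add_divide_distrib)
  qed
  then have ev: "\<forall>\<^sub>F h in at 0. (v (t + h) + v (t - h) - 2 * v t) / h\<^sup>2 + 2 * \<eta>
      = (u (t + h) + u (t - h) - 2 * u t) / h\<^sup>2"
    by (auto simp: eventually_at_filter)
  have "((\<lambda>h. (v (t + h) + v (t - h) - 2 * v t) / h\<^sup>2 + 2 * \<eta>) \<longlongrightarrow> 0 + 2 * \<eta>) (at 0)"
    by (intro tendsto_add schwarz tab tendsto_const)
  then have lim: "((\<lambda>h. (u (t + h) + u (t - h) - 2 * u t) / h\<^sup>2) \<longlongrightarrow> 2 * \<eta>) (at 0)"
    using Lim_transform_eventually[OF _ ev] by simp
  have "\<forall>\<^sub>F h in at 0. (u (t + h) + u (t - h) - 2 * u t) / h\<^sup>2 \<le> 0"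
  proof -
    have "\<forall>\<^sub>F h in at (0::real). \<bar>h\<bar> < min (t - a) (b - t)"
      using tab by (auto simp: eventually_at intro!: exI[of _ "min (t - a) (b - t)"])
    then show ?thesis
    proof eventually_elim
      case (elim h)
      then have "u (t + h) \<le> u t" "u (t - h) \<le> u t" by (auto intro!: t(2))
      then show ?case by (intro divide_nonpos_nonneg) auto
    qed
  qed
  then have "2 * \<eta> \<le> 0" by (intro tendsto_upperbound[OF lim]) auto
  with \<eta> show False by simp
qed

text \<open>Subtracting the chord over \<open>[-b, b]\<close> gives boundary values 0 and keeps the
  symmetric second derivative, so the difference and its negative are both nonpositive.\<close>

lemma zero_schwarz_derivative_affine:
  fixes v :: "real \<Rightarrow> real"
  assumes cont: "continuous_on UNIV v"
    and schwarz: "\<And>t. ((\<lambda>h. (v (t + h) + v (t - h) - 2 * v t) / h\<^sup>2) \<longlongrightarrow> 0) (at 0)"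
  shows "v x = v 0 + x * (v 1 - v 0)"
proof -
  \<comment> \<open>The points \<open>x\<close>, \<open>0\<close> and \<open>1\<close> of the
    conclusion all have to lie in \<open>[-b, b]\<close>.\<close>
  define b where "b = \<bar>x\<bar> + 1"
  have b: "b \<ge> 1" by (simp add: b_def)
  define k where "k = (v b - v (- b)) / (2 * b)"
  define l where "l s = v (- b) + (s + b) * k" for s
  have k: "2 * b * k = v b - v (- b)" using b by (simp add: k_def)
  have l: "l (t + h) + l (t - h) - 2 * l t = 0" for t h
    by (simp add: l_def ring_distribs)
  have vl: "v s = l s" if s: "s \<in> {-b..b}" for s
  proof -
    have le: "\<sigma> * (v s - l s) \<le> 0" if "\<sigma> = 1 \<or> \<sigma> = -1" for \<sigma> :: real
    proof (rule zero_schwarz_derivative_nonpos[OF _ _ _ _ s])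
      show "continuous_on {-b..b} (\<lambda>s. \<sigma> * (v s - l s))"
        unfolding l_def by (intro continuous_intros continuous_on_subset[OF cont]) (use b in auto)
      show "\<sigma> * (v (- b) - l (- b)) = 0" "\<sigma> * (v b - l b) = 0"
        using k by (simp_all add: l_def)
      fix t
      have "((\<lambda>h. \<sigma> * ((v (t + h) + v (t - h) - 2 * v t) / h\<^sup>2)) \<longlongrightarrow> \<sigma> * 0) (at 0)"
        by (intro tendsto_mult tendsto_const schwarz)
      moreover have "\<sigma> * (v (t + h) - l (t + h)) + \<sigma> * (v (t - h) - l (t - h)) - 2 * (\<sigma> * (v t - l t))
          = \<sigma> * (v (t + h) + v (t - h) - 2 * v t)" for h
      proof -
        have "\<sigma> * (v (t + h) - l (t + h)) + \<sigma> * (v (t - h) - l (t - h)) - 2 * (\<sigma> * (v t - l t))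
          = \<sigma> * (v (t + h) + v (t - h) - 2 * v t) - \<sigma> * (l (t + h) + l (t - h) - 2 * l t)"
          by (simp add: algebra_simps)
        then show ?thesis unfolding l by simp
      qed
      ultimately show "((\<lambda>h. (\<sigma> * (v (t + h) - l (t + h)) + \<sigma> * (v (t - h) - l (t - h)) - 2 * (\<sigma> * (v t - l t))) / h\<^sup>2)
          \<longlongrightarrow> 0) (at 0)" by simp
    qed
    show ?thesis using le[of 1] le[of "-1"] by simp
  qed
  have "x \<in> {-b..b}" by (auto simp: b_def)
  then have "v x = l x" "v 0 = l 0" "v 1 = l 1" using b by (auto intro!: vl)
  then show ?thesis by (simp add: l_def algebra_simps)
qed

text \<open>After one use of l'Hopital's rule in \<open>h\<close> the quotient is the mean of two
  difference quotients of \<open>G\<close> at \<open>t\<close>.\<close>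

lemma second_difference_tendsto:
  fixes F G g :: "real \<Rightarrow> real"
  assumes F: "\<And>s. (F has_real_derivative G s) (at s)" and G: "\<And>s. (G has_real_derivative g s) (at s)"
  shows "((\<lambda>h. (F (t + h) + F (t - h) - 2 * F t) / h\<^sup>2) \<longlongrightarrow> g t) (at 0)"
proof (rule lhopital)
  have c: "isCont F s" for s using F DERIV_isCont by blast
  have "((\<lambda>h. F (t + h) + F (t - h) - 2 * F t) \<longlongrightarrow> F (t + 0) + F (t - 0) - 2 * F t) (at 0)"
    by (intro tendsto_intros isCont_tendsto_compose[OF c])
  then show "((\<lambda>h. F (t + h) + F (t - h) - 2 * F t) \<longlongrightarrow> 0) (at 0)" by simp
  have "((\<lambda>h::real. h\<^sup>2) \<longlongrightarrow> 0\<^sup>2) (at 0)" by (intro tendsto_intros)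
  then show "((\<lambda>h::real. h\<^sup>2) \<longlongrightarrow> 0) (at 0)" by simp
  show "\<forall>\<^sub>F h in at (0::real). h\<^sup>2 \<noteq> 0" "\<forall>\<^sub>F h in at (0::real). 2 * h \<noteq> 0"
    by (auto simp: eventually_at_filter)
  show "\<forall>\<^sub>F h in at 0. ((\<lambda>h. F (t + h) + F (t - h) - 2 * F t) has_real_derivative G (t + h) - G (t - h)) (at h)"
    by (intro always_eventually allI)
      (auto intro!: derivative_eq_intros DERIV_chain'[OF _ F])
  show "\<forall>\<^sub>F h in at 0. ((\<lambda>h::real. h\<^sup>2) has_real_derivative 2 * h) (at h)"
    by (intro always_eventually allI) (auto intro!: derivative_eq_intros)
  have d: "((\<lambda>h. (G (t + h) - G t) / h) \<longlongrightarrow> g t) (at 0)"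
    using G[of t] by (simp add: DERIV_def)
  have "filterlim uminus (at 0) (at (0::real))"
  proof (rule filterlim_atI)
    show "((\<lambda>h::real. - h) \<longlongrightarrow> 0) (at 0)" using tendsto_minus[OF tendsto_ident_at, of "0::real" UNIV] by simp
  qed (auto simp: eventually_at_filter)
  from filterlim_compose[OF d this] have d': "((\<lambda>h. (G (t - h) - G t) / - h) \<longlongrightarrow> g t) (at 0)"
    by simp
  have lim: "((\<lambda>h. ((G (t + h) - G t) / h + (G (t - h) - G t) / - h) / 2) \<longlongrightarrow> (g t + g t) / 2) (at 0)"
    by (intro tendsto_intros d d') simp
  have eq: "((G (t + h) - G t) / h + (G (t - h) - G t) / - h) / 2 = (G (t + h) - G (t - h)) / (2 * h)" for h
    by (cases "h = 0") (auto simp: field_simps)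
  have "(g t + g t) / 2 = g t" by simp
  with lim show "((\<lambda>h. (G (t + h) - G (t - h)) / (2 * h)) \<longlongrightarrow> g t) (at 0)" by (simp only: eq)
qed

text \<open>A twofold antiderivative \<open>F\<close> of \<open>w\<close> has symmetric second
  derivative \<open>w\<close> as well, so \<open>u - F\<close> is affine. This upgrades the
  symmetric limit that defines a generator to ordinary differentiability.\<close>

lemma schwarz_derivative_imp_C2:
  fixes u w :: "real \<Rightarrow> real"
  assumes u: "continuous_on UNIV u" and w: "continuous_on UNIV w"
    and schwarz: "\<And>t. ((\<lambda>h. (u (t + h) + u (t - h) - 2 * u t) / h\<^sup>2) \<longlongrightarrow> w t) (at 0)"
  shows "\<exists>u'. \<forall>t. (u has_real_derivative u' t) (at t) \<and> (u' has_real_derivative w t) (at t)"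
proof -
  have anti: "\<exists>F. \<forall>x. (F has_real_derivative f x) (at x)" if "continuous_on UNIV f" for f :: "real \<Rightarrow> real"
    using einterval_antiderivative[of "-\<infinity>" "\<infinity>" f] that
    by (auto simp: continuous_on_eq_continuous_at has_real_derivative_iff_has_vector_derivative)
  obtain G where G: "\<And>x. (G has_real_derivative w x) (at x)" using anti[OF w] by blast
  have "continuous_on UNIV G" by (meson G DERIV_isCont continuous_at_imp_continuous_on)
  then obtain F where F: "\<And>x. (F has_real_derivative G x) (at x)" using anti by blast
  define v where "v t = u t - F t" for t
  define c where "c = v 1 - v 0"
  have vc: "v x = v 0 + x * c" for x
    unfolding c_def
  proof (rule zero_schwarz_derivative_affine)
    have "continuous_on UNIV F" by (meson F DERIV_isCont continuous_at_imp_continuous_on)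
    then show "continuous_on UNIV v" unfolding v_def by (intro continuous_intros u)
    fix t
    have "((\<lambda>h. (u (t + h) + u (t - h) - 2 * u t) / h\<^sup>2 - (F (t + h) + F (t - h) - 2 * F t) / h\<^sup>2) \<longlongrightarrow> w t - w t) (at 0)"
      by (intro tendsto_diff schwarz second_difference_tendsto[OF F G])
    moreover have "(u (t + h) + u (t - h) - 2 * u t) / h\<^sup>2 - (F (t + h) + F (t - h) - 2 * F t) / h\<^sup>2
        = (v (t + h) + v (t - h) - 2 * v t) / h\<^sup>2" for h
      by (simp add: v_def algebra_simps flip: diff_divide_distrib)
    ultimately show "((\<lambda>h. (v (t + h) + v (t - h) - 2 * v t) / h\<^sup>2) \<longlongrightarrow> 0) (at 0)" by simp
  qed
  have "u = (\<lambda>t. v 0 + t * c + F t)" using vc by (auto simp: v_def algebra_simps fun_eq_iff)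
  moreover have "((\<lambda>t. v 0 + t * c + F t) has_real_derivative c + G t) (at t)"
      "((\<lambda>t. c + G t) has_real_derivative w t) (at t)" for t
    by (auto intro!: derivative_eq_intros F G)
  ultimately show ?thesis by (intro exI[of _ "\<lambda>t. c + G t"]) auto
qed

lemma schwarz_derivative_imp_C2_complex:
  fixes u w :: "real \<Rightarrow> complex"
  assumes u: "continuous_on UNIV u" and w: "continuous_on UNIV w"
    and schwarz: "\<And>t. ((\<lambda>h. (u (t + h) + u (t - h) - 2 * u t) / of_real (h\<^sup>2)) \<longlongrightarrow> w t) (at 0)"
  shows "\<exists>u'. \<forall>t. (u has_vector_derivative u' t) (at t) \<and> (u' has_vector_derivative w t) (at t)"
proof -
  have re: "((\<lambda>h. (Re (u (t + h)) + Re (u (t - h)) - 2 * Re (u t)) / h\<^sup>2) \<longlongrightarrow> Re (w t)) (at 0)" for t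
    using tendsto_Re[OF schwarz[of t]] by (simp only: Re_divide_of_real) simp
  have im: "((\<lambda>h. (Im (u (t + h)) + Im (u (t - h)) - 2 * Im (u t)) / h\<^sup>2) \<longlongrightarrow> Im (w t)) (at 0)" for t
    using tendsto_Im[OF schwarz[of t]] by (simp only: Im_divide_of_real) simp
  obtain p q where
    "\<And>t. ((\<lambda>t. Re (u t)) has_real_derivative p t) (at t)" "\<And>t. (p has_real_derivative Re (w t)) (at t)"
    "\<And>t. ((\<lambda>t. Im (u t)) has_real_derivative q t) (at t)" "\<And>t. (q has_real_derivative Im (w t)) (at t)"
    using schwarz_derivative_imp_C2[OF _ _ re] schwarz_derivative_imp_C2[OF _ _ im] u w
    by (metis continuous_on_Re continuous_on_Im)
  then show ?thesis
    by (intro exI[of _ "\<lambda>t. Complex (p t) (q t)"]) (simp add: has_vector_derivative_complex_iff)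
qed

section \<open>Truncated Laplace transforms\<close>

definition fin_laplace :: "(real \<Rightarrow> complex) \<Rightarrow> real \<Rightarrow> complex \<Rightarrow> complex" where
  "fin_laplace c t z = integral {0..t} (\<lambda>s. exp (- (z * of_real s)) * c s)"

lemma fin_laplace_integrable:
  fixes c :: "real \<Rightarrow> complex"
  assumes "continuous_on UNIV c"
  shows "(\<lambda>s. exp (- (z * of_real s)) * c s) integrable_on {a..b}"
  by (intro integrable_continuous_real continuous_intros continuous_on_subset[OF assms]) auto

lemma fin_laplace_holomorphic:
  assumes c: "continuous_on UNIV c"
  shows "fin_laplace c t holomorphic_on UNIV"
proof -
  have "(\<lambda>z. integral (cbox 0 t) (\<lambda>s. exp (- (z * of_real s)) * c s)) holomorphic_on UNIV"
  proof (rule leibniz_rule_holomorphic)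
    show "((\<lambda>z. exp (- (z * of_real s)) * c s) has_field_derivative - of_real s * exp (- (z * of_real s)) * c s) (at z within UNIV)" for z s
      by (auto intro!: derivative_eq_intros)
    show "(\<lambda>s. exp (- (z * of_real s)) * c s) integrable_on cbox 0 t" for z
      using fin_laplace_integrable[OF c] by simp
    show "continuous_on (UNIV \<times> cbox 0 t) (\<lambda>(z, s). - of_real s * exp (- (z * of_real s)) * c s)"
      unfolding case_prod_unfold
      by (intro continuous_intros continuous_on_compose2[OF c continuous_on_snd]) auto
  qed simp
  then show ?thesis by (simp add: fin_laplace_def[abs_def])
qed

text \<open>Two integrations by parts at once: \<open>exp (- z s) (c' s + z c s)\<close> is an
  antiderivative of the difference of the two integrands. The condition \<open>c' 0 = 0\<close> is
  met by even functions such as the orbits of a cosine family.\<close>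

lemma fin_laplace_second_derivative:
  assumes c: "\<And>s. (c has_vector_derivative c' s) (at s)" and c': "\<And>s. (c' has_vector_derivative c'' s) (at s)"
    and cont: "continuous_on UNIV c''" and zero: "c' 0 = 0" and t: "t \<ge> 0"
  shows "fin_laplace c'' t z = exp (- (z * of_real t)) * (c' t + z * c t) - z * c 0 + z\<^sup>2 * fin_laplace c t z"
proof -
  have cc: "continuous_on UNIV c"
    by (meson c continuous_at_imp_continuous_on has_vector_derivative_continuous)
  have "((\<lambda>s. exp (- (z * of_real s)) * c'' s - z\<^sup>2 * (exp (- (z * of_real s)) * c s)) has_integral
      exp (- (z * of_real t)) * (c' t + z * c t) - exp (- (z * of_real 0)) * (c' 0 + z * c 0)) {0..t}"
  proof (rule fundamental_theorem_of_calculus[OF t])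
    fix s
    have e: "((\<lambda>s. exp (- (z * of_real s))) has_vector_derivative - z * exp (- (z * of_real s))) (at s)"
      by (rule has_vector_derivative_real_field) (auto intro!: derivative_eq_intros)
    have f: "((\<lambda>s. c' s + z * c s) has_vector_derivative c'' s + z * c' s) (at s)"
      by (intro has_vector_derivative_add c' has_vector_derivative_mult_right c)
    show "((\<lambda>s. exp (- (z * of_real s)) * (c' s + z * c s)) has_vector_derivative
        exp (- (z * of_real s)) * c'' s - z\<^sup>2 * (exp (- (z * of_real s)) * c s)) (at s within {0..t})"
      by (rule has_vector_derivative_at_within, rule has_vector_derivative_eq_rhs[OF has_vector_derivative_mult[OF e f]])
        (simp add: algebra_simps power2_eq_square)
  qed
  moreover have "((\<lambda>s. exp (- (z * of_real s)) * c'' s - z\<^sup>2 * (exp (- (z * of_real s)) * c s)) has_integral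
      fin_laplace c'' t z - z\<^sup>2 * fin_laplace c t z) {0..t}"
    unfolding fin_laplace_def
    by (intro has_integral_diff has_integral_mult_right integrable_integral fin_laplace_integrable cont cc)
  ultimately have "fin_laplace c'' t z - z\<^sup>2 * fin_laplace c t z
      = exp (- (z * of_real t)) * (c' t + z * c t) - z * c 0"
    using zero by (auto dest: has_integral_unique)
  then show ?thesis by (simp add: algebra_simps)
qed

lemma cf_bfunc_compose:
  assumes "cf_bfunc \<psi>" "cf_bclin T"
  shows "cf_bfunc (\<lambda>x. \<psi> (T x))"
proof -
  obtain K where K: "\<And>x. cmod (\<psi> x) \<le> K * norm x" using assms(1) by (auto simp: cf_bfunc_def)
  obtain L where L: "\<And>x. norm (T x) \<le> L * norm x" using assms(2) by (auto simp: cf_bclin_def)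
  have "cmod (\<psi> (T x)) \<le> (\<bar>K\<bar> * L) * norm x" for x
  proof -
    have "cmod (\<psi> (T x)) \<le> \<bar>K\<bar> * norm (T x)"
      using K[of "T x"] by (rule order_trans) (simp add: mult_right_mono)
    also have "\<dots> \<le> \<bar>K\<bar> * (L * norm x)" by (intro mult_left_mono L) simp
    finally show ?thesis by (simp add: mult.assoc)
  qed
  then show ?thesis using assms unfolding cf_bfunc_def cf_bclin_def cf_clin_def by metis
qed

lemma residue_sum:
  assumes "open S" "z \<in> S" "\<And>i. i \<in> I \<Longrightarrow> f i holomorphic_on S - {z}"
  shows "residue (\<lambda>w. \<Sum>i\<in>I. f i w) z = (\<Sum>i\<in>I. residue (f i) z)"
  using assms(3)
proof (induction I rule: infinite_finite_induct)
  case (insert i I)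
  then show ?case
    using assms(1,2) by (simp add: residue_add[of S] holomorphic_on_sum)
qed (simp_all add: residue_const)

lemma deriv_exp_scaled: "(deriv ^^ k) (\<lambda>w::complex. exp (w * c)) = (\<lambda>w. c ^ k * exp (w * c))"
proof (induction k)
  case (Suc k)
  have "deriv (\<lambda>w. c ^ k * exp (w * c)) w = c ^ Suc k * exp (w * c)" for w
    by (rule DERIV_imp_deriv) (auto intro!: derivative_eq_intros)
  then show ?case using Suc by auto
qed simp

text \<open>The residue is a Taylor coefficient of the exponential; with \<open>c = t\<close> and
  \<open>k = 2 \<alpha>\<close> it produces the factors
  \<open>t^(2 \<alpha>) / (2 \<alpha>)!\<close> of the cosine expansion.\<close>

lemma residue_exp_over_power:
  "residue (\<lambda>w. exp (w * c) * (b * inverse (w ^ Suc k))) 0 = b * c ^ k / fact k"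
proof -
  have "residue (\<lambda>w. (b * exp (w * c)) / w ^ Suc k) 0 = (deriv ^^ k) (\<lambda>w. b * exp (w * c)) 0 / fact k"
    by (rule residue_holomorphic_over_power'[of UNIV]) (auto intro!: holomorphic_intros)
  also have "(deriv ^^ k) (\<lambda>w. b * exp (w * c)) 0 = b * (deriv ^^ k) (\<lambda>w. exp (w * c)) 0"
    by (rule higher_deriv_cmult[of _ UNIV]) (auto intro!: holomorphic_intros)
  finally show ?thesis by (simp add: deriv_exp_scaled divide_inverse mult_ac)
qed

section \<open>The resolvent as Laplace transform of the cosine family\<close>

locale cosine_resolvent =
  fixes C :: "real \<Rightarrow> 'x::cf_cbanach \<Rightarrow> 'x" and D :: "'x set" and A :: "'x \<Rightarrow> 'x"
    and M \<omega> :: real and R0 :: "complex \<Rightarrow> 'x \<Rightarrow> 'x"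
  assumes cos: "cosine_family C" and gen: "cos_generator C D A"
    and M_ge: "M \<ge> 1" and \<omega>_pos: "\<omega> > 0"
    and C_bound: "norm (C t x) \<le> M * exp (\<omega> * \<bar>t\<bar>) * norm x"
    and R0_res: "Re z > \<omega> \<Longrightarrow> cf_res_inv D A (z\<^sup>2) (R0 z)"
begin

lemma cosine_functional_continuous: "cf_bfunc \<psi> \<Longrightarrow> continuous_on UNIV (\<lambda>t. \<psi> (C t x))"
  using cos unfolding cosine_family_def
  by (intro bounded_linear.continuous_on[OF cf_bfunc_bounded_linear]) auto

text \<open>D'Alembert's equation turns the second difference of the family at \<open>t\<close> into
  \<open>2 C(t) (C(h) - I)\<close>, so the limit at 0 that defines \<open>A\<close> passes to every
  \<open>t\<close> under the bounded functional. Evenness of the orbit makes its derivative vanish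
  at 0.\<close>

lemma cosine_functional_C2:
  assumes \<psi>: "cf_bfunc \<psi>" and x: "x \<in> D"
  obtains c' where "\<And>t. ((\<lambda>t. \<psi> (C t x)) has_vector_derivative c' t) (at t)"
    "\<And>t. (c' has_vector_derivative \<psi> (C t (A x))) (at t)" "c' 0 = 0"
proof -
  have Cb: "cf_bclin (C t)" for t using cos by (simp add: cosine_family_def)
  have C0: "C 0 y = y" for y using cos by (simp add: cosine_family_def)
  have dal: "C (t + s) y + C (t - s) y = 2 *\<^sub>R C t (C s y)" for t s y
    using cos by (simp add: cosine_family_def)
  have lim: "((\<lambda>h. (\<psi> (C (t + h) x) + \<psi> (C (t - h) x) - 2 * \<psi> (C t x)) / of_real (h\<^sup>2))
      \<longlongrightarrow> \<psi> (C t (A x))) (at 0)" for t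
  proof -
    let ?L = "\<lambda>y. \<psi> (C t y)"
    have L: "cf_bfunc ?L" by (rule cf_bfunc_compose[OF \<psi> Cb])
    have "((\<lambda>h. (2 / h\<^sup>2) *\<^sub>R (C h x - x)) \<longlongrightarrow> A x) (at 0)"
      using gen x by (simp add: cos_generator_def)
    then have "((\<lambda>h. ?L ((2 / h\<^sup>2) *\<^sub>R (C h x - x))) \<longlongrightarrow> ?L (A x)) (at 0)"
      by (rule bounded_linear.tendsto[OF cf_bfunc_bounded_linear[OF L]])
    moreover have "?L ((2 / h\<^sup>2) *\<^sub>R (C h x - x))
        = (\<psi> (C (t + h) x) + \<psi> (C (t - h) x) - 2 * \<psi> (C t x)) / of_real (h\<^sup>2)" for h
    proof -
      have "\<psi> (C (t + h) x) + \<psi> (C (t - h) x) = \<psi> (2 *\<^sub>R C t (C h x))"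
        using \<psi> by (simp add: cf_bfunc_def flip: dal)
      also have "\<dots> = 2 * ?L (C h x)" by (simp add: cf_bfunc_scaleR[OF \<psi>])
      finally show ?thesis
        by (simp add: cf_bfunc_scaleR[OF L] cf_bfunc_diff[OF L] right_diff_distrib diff_divide_distrib)
    qed
    ultimately show ?thesis by simp
  qed
  obtain c' where c': "\<And>t. ((\<lambda>t. \<psi> (C t x)) has_vector_derivative c' t) (at t)"
    "\<And>t. (c' has_vector_derivative \<psi> (C t (A x))) (at t)"
    using schwarz_derivative_imp_C2_complex[OF cosine_functional_continuous[OF \<psi>]
        cosine_functional_continuous[OF \<psi>] lim] by blast
  have even: "C (- s) y = C s y" for s y
    using dal[of 0 s y] by (simp add: C0 scaleR_2)
  have "((\<lambda>t. \<psi> (C t x)) \<circ> uminus has_vector_derivative (-1) *\<^sub>R c' (- 0)) (at 0)"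
    by (rule vector_diff_chain_at[OF _ c'(1)]) (auto intro!: derivative_eq_intros)
  then have "((\<lambda>t. \<psi> (C t x)) has_vector_derivative - c' 0) (at 0)"
    by (simp add: o_def even)
  then have "- c' 0 = c' 0" using c'(1)[of 0] by (rule vector_derivative_unique_at)
  then have "c' 0 = 0" by (simp add: neg_equal_zero)
  then show ?thesis using c' that by blast
qed

lemma res_in_D: "Re z > \<omega> \<Longrightarrow> R0 z y \<in> D"
  and res_eq: "Re z > \<omega> \<Longrightarrow> cscale (z\<^sup>2) (R0 z y) - A (R0 z y) = y"
  and res_eq': "Re z > \<omega> \<Longrightarrow> x \<in> D \<Longrightarrow> R0 z (cscale (z\<^sup>2) x - A x) = x"
  using R0_res unfolding cf_res_inv_def by blast+

context
  fixes \<psi> :: "'x \<Rightarrow> complex" and K :: real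
  assumes \<psi>: "cf_bfunc \<psi>" and K: "cmod (\<psi> x) \<le> K * norm x" and K_nonneg: "K \<ge> 0"
begin

lemma cosine_functional_bound:
  assumes "t \<ge> 0"
  shows "cmod (\<psi> (C t y)) \<le> K * M * exp (\<omega> * t) * norm y"
proof -
  have "cmod (\<psi> (C t y)) \<le> K * norm (C t y)" by (rule K)
  also have "\<dots> \<le> K * (M * exp (\<omega> * \<bar>t\<bar>) * norm y)" by (intro mult_left_mono C_bound K_nonneg)
  finally show ?thesis using assms by (simp add: mult.assoc)
qed

lemma fin_laplace_Cauchy_bound:
  assumes z: "Re z > \<omega>" and t: "0 \<le> t" "t \<le> t'"
  shows "cmod (fin_laplace (\<lambda>s. \<psi> (C s y)) t' z - fin_laplace (\<lambda>s. \<psi> (C s y)) t z)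
    \<le> K * M * norm y * exp (- ((Re z - \<omega>) * t)) / (Re z - \<omega>)"
proof -
  let ?f = "\<lambda>s. exp (- (z * of_real s)) * \<psi> (C s y)"
  let ?b = "Re z - \<omega>"
  let ?G = "\<lambda>s. - (K * M * norm y / ?b) * exp (- (?b * s))"
  let ?g = "\<lambda>s. K * M * norm y * exp (- (?b * s))"
  have b: "?b > 0" using z by simp
  note int = fin_laplace_integrable[OF cosine_functional_continuous[OF \<psi>]]
  have "fin_laplace (\<lambda>s. \<psi> (C s y)) t z + integral {t..t'} ?f = fin_laplace (\<lambda>s. \<psi> (C s y)) t' z"
    unfolding fin_laplace_def using t by (intro Henstock_Kurzweil_Integration.integral_combine int)
  then have d1: "fin_laplace (\<lambda>s. \<psi> (C s y)) t' z - fin_laplace (\<lambda>s. \<psi> (C s y)) t z = integral {t..t'} ?f"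
    by (simp add: algebra_simps)
  have g: "(?g has_integral ?G t' - ?G t) {t..t'}"
  proof (rule fundamental_theorem_of_calculus[OF t(2)])
    fix s
    have "(?G has_real_derivative - (K * M * norm y / ?b) * (exp (- (?b * s)) * (- ?b))) (at s within {t..t'})"
      using z by (auto intro!: derivative_eq_intros)
    moreover have "- (p / b) * (e * (- b)) = p * e" if "b > 0" for p b e :: real
      using that by simp
    from this[OF b] have "- (K * M * norm y / ?b) * (exp (- (?b * s)) * (- ?b)) = ?g s" .
    ultimately show "(?G has_vector_derivative ?g s) (at s within {t..t'})"
      by (simp only: has_real_derivative_iff_has_vector_derivative)
  qed
  have n1: "norm (integral {t..t'} ?f) \<le> integral {t..t'} ?g"
  proof (rule integral_norm_bound_integral[OF int])
    show "?g integrable_on {t..t'}" using g by blast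
    fix s assume s: "s \<in> {t..t'}"
    have "norm (?f s) = exp (- (Re z * s)) * cmod (\<psi> (C s y))" by (simp add: norm_mult)
    also have "\<dots> \<le> exp (- (Re z * s)) * (K * M * exp (\<omega> * s) * norm y)"
      using s t by (intro mult_left_mono cosine_functional_bound) auto
    also have "\<dots> = ?g s" by (simp add: left_diff_distrib exp_diff exp_minus field_simps)
    finally show "norm (?f s) \<le> ?g s" .
  qed
  have n2: "?G t' - ?G t \<le> K * M * norm y * exp (- (?b * t)) / ?b"
  proof -
    have "0 \<le> K * M * norm y / ?b * exp (- (?b * t'))"
      using K_nonneg M_ge b by (intro mult_nonneg_nonneg divide_nonneg_nonneg) auto
    then show ?thesis by simp
  qed
  show ?thesis unfolding d1 using n1 n2 integral_unique[OF g] by linarith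
qed

text \<open>With \<open>x = R0 z y\<close> the datum is \<open>y = z^2 x - A x\<close>, and two
  integrations by parts in the transform of \<open>A x\<close> cancel the transform of
  \<open>x\<close>. What remains is \<open>z * \<psi> x\<close> and a boundary term at
  \<open>t\<close>, which dies out because \<open>Re z > \<omega>\<close>.\<close>

lemma fin_laplace_tendsto_resolvent:
  assumes z: "Re z > \<omega>"
  shows "((\<lambda>t. fin_laplace (\<lambda>s. \<psi> (C s y)) t z) \<longlongrightarrow> z * \<psi> (R0 z y)) at_top"
proof -
  define x where "x = R0 z y"
  have xD: "x \<in> D" and y: "y = cscale (z\<^sup>2) x - A x"
    using res_in_D[OF z] res_eq[OF z] by (simp_all add: x_def)
  obtain c' where c': "\<And>t. ((\<lambda>t. \<psi> (C t x)) has_vector_derivative c' t) (at t)"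
    "\<And>t. (c' has_vector_derivative \<psi> (C t (A x))) (at t)" "c' 0 = 0"
    using cosine_functional_C2[OF \<psi> xD] by blast
  note cont = cosine_functional_continuous[OF \<psi>]
  have C0: "C 0 y = y" for y using cos by (simp add: cosine_family_def)
  have Cb: "cf_bclin (C t)" for t using cos by (simp add: cosine_family_def)
  have lap: "fin_laplace (\<lambda>s. \<psi> (C s y)) t z = z * \<psi> x - exp (- (z * of_real t)) * (c' t + z * \<psi> (C t x))"
    if t: "t \<ge> 0" for t
  proof -
    have "\<psi> (C s y) = z\<^sup>2 * \<psi> (C s x) - \<psi> (C s (A x))" for s
      unfolding y cf_bfunc_diff[OF cf_bfunc_compose[OF \<psi> Cb[of s]]]
        cf_bfunc_cscale[OF cf_bfunc_compose[OF \<psi> Cb[of s]]] ..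
    then have "exp (- (z * of_real s)) * \<psi> (C s y)
        = z\<^sup>2 * (exp (- (z * of_real s)) * \<psi> (C s x)) - exp (- (z * of_real s)) * \<psi> (C s (A x))" for s
      by (simp only: right_diff_distrib mult.left_commute)
    then have "fin_laplace (\<lambda>s. \<psi> (C s y)) t z
        = integral {0..t} (\<lambda>s. z\<^sup>2 * (exp (- (z * of_real s)) * \<psi> (C s x)) - exp (- (z * of_real s)) * \<psi> (C s (A x)))"
      unfolding fin_laplace_def by (simp only:)
    also have "\<dots> = z\<^sup>2 * fin_laplace (\<lambda>s. \<psi> (C s x)) t z - fin_laplace (\<lambda>s. \<psi> (C s (A x))) t z"
      unfolding fin_laplace_def
      by (rule integral_unique) (intro has_integral_diff has_integral_mult_right integrable_integral fin_laplace_integrable cont)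
    also have "fin_laplace (\<lambda>s. \<psi> (C s (A x))) t z
        = exp (- (z * of_real t)) * (c' t + z * \<psi> (C t x)) - z * \<psi> (C 0 x) + z\<^sup>2 * fin_laplace (\<lambda>s. \<psi> (C s x)) t z"
      by (rule fin_laplace_second_derivative[OF c'(1,2) cont c'(3) t])
    finally show ?thesis by (simp add: C0 algebra_simps)
  qed
  \<comment> \<open>The derivative comes without a growth bound; it is recovered by integrating the
    second derivative from 0, at the price of the factor \<open>t\<close>.\<close>
  have c'_bound: "cmod (c' t) \<le> K * M * exp (\<omega> * t) * norm (A x) * t" if t: "t \<ge> 0" for t
  proof -
    have i: "((\<lambda>s. \<psi> (C s (A x))) has_integral c' t - c' 0) {0..t}"
      by (rule fundamental_theorem_of_calculus[OF t]) (rule has_vector_derivative_at_within[OF c'(2)])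
    have "cmod (\<psi> (C s (A x))) \<le> K * M * exp (\<omega> * t) * norm (A x)" if "s \<in> {0..t}" for s
    proof -
      have "cmod (\<psi> (C s (A x))) \<le> K * M * exp (\<omega> * s) * norm (A x)"
        using that by (intro cosine_functional_bound) auto
      also have "\<dots> \<le> K * M * exp (\<omega> * t) * norm (A x)"
        using that K_nonneg M_ge \<omega>_pos by (intro mult_right_mono mult_left_mono) auto
      finally show ?thesis .
    qed
    then have "cmod (integral {0..t} (\<lambda>s. \<psi> (C s (A x)))) \<le> K * M * exp (\<omega> * t) * norm (A x) * (t - 0)"
      by (intro integral_bound t continuous_on_subset[OF cont]) auto
    then show ?thesis using integral_unique[OF i] c'(3) by simp
  qed
  have "((\<lambda>t. exp (- (z * of_real t)) * (c' t + z * \<psi> (C t x))) \<longlongrightarrow> 0) at_top"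
  proof (rule Lim_null_comparison)
    let ?b = "Re z - \<omega>" and ?P = "K * M * norm (A x)" and ?Q = "cmod z * (K * M * norm x)"
    have b: "?b > 0" using z by simp
    show "\<forall>\<^sub>F t in at_top. norm (exp (- (z * of_real t)) * (c' t + z * \<psi> (C t x)))
        \<le> ?P * (t * exp (- (?b * t))) + ?Q * exp (- (?b * t))"
      using eventually_ge_at_top[of 0]
    proof eventually_elim
      case (elim t)
      have "norm (exp (- (z * of_real t)) * (c' t + z * \<psi> (C t x)))
          = exp (- (Re z * t)) * cmod (c' t + z * \<psi> (C t x))" by (simp add: norm_mult)
      also have "\<dots> \<le> exp (- (Re z * t)) * (?P * exp (\<omega> * t) * t + ?Q * exp (\<omega> * t))"
      proof (intro mult_left_mono)
        have "cmod (c' t + z * \<psi> (C t x)) \<le> cmod (c' t) + cmod z * cmod (\<psi> (C t x))"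
          by (metis norm_mult norm_triangle_ineq)
        also have "\<dots> \<le> K * M * exp (\<omega> * t) * norm (A x) * t + cmod z * (K * M * exp (\<omega> * t) * norm x)"
          using elim by (intro add_mono mult_left_mono c'_bound cosine_functional_bound) auto
        finally show "cmod (c' t + z * \<psi> (C t x)) \<le> ?P * exp (\<omega> * t) * t + ?Q * exp (\<omega> * t)"
          by (simp add: mult_ac)
      qed simp
      also have "\<dots> = ?P * (t * exp (- (?b * t))) + ?Q * exp (- (?b * t))"
        by (simp add: left_diff_distrib exp_diff exp_minus field_simps)
      finally show ?case .
    qed
    have "((\<lambda>t. t * exp (- (?b * t))) \<longlongrightarrow> 0) at_top" "((\<lambda>t. exp (- (?b * t))) \<longlongrightarrow> 0) at_top"
      using b by real_asymp+
    then have "((\<lambda>t. ?P * (t * exp (- (?b * t))) + ?Q * exp (- (?b * t))) \<longlongrightarrow> ?P * 0 + ?Q * 0) at_top"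
      by (intro tendsto_intros)
    then show "((\<lambda>t. ?P * (t * exp (- (?b * t))) + ?Q * exp (- (?b * t))) \<longlongrightarrow> 0) at_top" by simp
  qed
  then have "((\<lambda>t. z * \<psi> x - exp (- (z * of_real t)) * (c' t + z * \<psi> (C t x))) \<longlongrightarrow> z * \<psi> x - 0) at_top"
    by (intro tendsto_intros)
  moreover have "\<forall>\<^sub>F t in at_top. z * \<psi> x - exp (- (z * of_real t)) * (c' t + z * \<psi> (C t x))
      = fin_laplace (\<lambda>s. \<psi> (C s y)) t z"
    using eventually_ge_at_top[of "0::real"] by eventually_elim (simp add: lap)
  ultimately have "((\<lambda>t. fin_laplace (\<lambda>s. \<psi> (C s y)) t z) \<longlongrightarrow> z * \<psi> x - 0) at_top"
    by (rule Lim_transform_eventually)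
  then show ?thesis by (simp add: x_def)
qed

text \<open>The upper end of the Cauchy estimate tends to infinity. The factor
  \<open>exp (- (Re z - \<omega>) t)\<close> is what offsets \<open>exp (z t)\<close> when a contour
  is closed far to the right.\<close>

lemma resolvent_minus_fin_laplace_bound:
  assumes z: "Re z > \<omega>" and t: "0 \<le> t"
  shows "cmod (z * \<psi> (R0 z y) - fin_laplace (\<lambda>s. \<psi> (C s y)) t z)
    \<le> K * M * norm y * exp (- ((Re z - \<omega>) * t)) / (Re z - \<omega>)"
proof (rule tendsto_upperbound)
  show "((\<lambda>t'. cmod (fin_laplace (\<lambda>s. \<psi> (C s y)) t' z - fin_laplace (\<lambda>s. \<psi> (C s y)) t z))
     \<longlongrightarrow> cmod (z * \<psi> (R0 z y) - fin_laplace (\<lambda>s. \<psi> (C s y)) t z)) at_top"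
    by (intro tendsto_intros fin_laplace_tendsto_resolvent z)
  show "\<forall>\<^sub>F t' in at_top. cmod (fin_laplace (\<lambda>s. \<psi> (C s y)) t' z - fin_laplace (\<lambda>s. \<psi> (C s y)) t z)
      \<le> K * M * norm y * exp (- ((Re z - \<omega>) * t)) / (Re z - \<omega>)"
    using eventually_ge_at_top[of t] by eventually_elim (rule fin_laplace_Cauchy_bound[OF z t])
qed simp

lemma resolvent_functional_bound:
  assumes z: "Re z > \<omega>"
  shows "cmod (z * \<psi> (R0 z y)) \<le> K * M * norm y / (Re z - \<omega>)"
  using resolvent_minus_fin_laplace_bound[OF z order_refl, of y] by (simp add: fin_laplace_def)

text \<open>Each use of the second derivative formula trades \<open>z^(-2)\<close> times the
  transform of \<open>A^(k+1) x\<close> for the transform of \<open>A^k x\<close> plus explicit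
  poles at 0. After \<open>n\<close> steps the transform of \<open>x\<close> is left, which is
  entire. Of the boundary terms at \<open>t\<close> only the simple pole, at
  \<open>\<alpha> = 0\<close>, has a residue, namely \<open>\<psi> (C t x)\<close>; the initial
  values give the Taylor polynomial.\<close>

lemma residue_fin_laplace:
  assumes x: "x \<in> cf_dom_pow D A n" and n: "n \<ge> 1" and t: "t \<ge> 0"
  shows "residue (\<lambda>z. exp (z * of_real t) * inverse (z ^ (2 * n)) * fin_laplace (\<lambda>s. \<psi> (C s ((A ^^ n) x))) t z) 0
    = \<psi> (C t x) - (\<Sum>\<alpha><n. of_real (t ^ (2 * \<alpha>) / fact (2 * \<alpha>)) * \<psi> ((A ^^ \<alpha>) x))"
proof -
  define c where "c \<alpha> s = \<psi> (C s ((A ^^ \<alpha>) x))" for \<alpha> s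
  have xk: "(A ^^ \<alpha>) x \<in> D" if "\<alpha> < n" for \<alpha> using x that by (simp add: cf_dom_pow_def)
  have "\<forall>\<alpha>. \<exists>c'. \<alpha> < n \<longrightarrow> (\<forall>t. (c \<alpha> has_vector_derivative c' t) (at t)) \<and>
      (\<forall>t. (c' has_vector_derivative c (Suc \<alpha>) t) (at t)) \<and> c' 0 = 0"
  proof
    fix \<alpha>
    show "\<exists>c'. \<alpha> < n \<longrightarrow> (\<forall>t. (c \<alpha> has_vector_derivative c' t) (at t)) \<and>
      (\<forall>t. (c' has_vector_derivative c (Suc \<alpha>) t) (at t)) \<and> c' 0 = 0"
    proof (cases "\<alpha> < n")
      case True
      have "\<psi> (C t (A ((A ^^ \<alpha>) x))) = c (Suc \<alpha>) t" "\<psi> (C t ((A ^^ \<alpha>) x)) = c \<alpha> t" for t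
        by (simp_all add: c_def)
      then obtain d where "\<And>t. (c \<alpha> has_vector_derivative d t) (at t)"
        "\<And>t. (d has_vector_derivative c (Suc \<alpha>) t) (at t)" "d 0 = 0"
        using cosine_functional_C2[OF \<psi> xk[OF True]] by auto
      then show ?thesis by blast
    qed auto
  qed
  then obtain c' where c': "\<And>\<alpha> t. \<alpha> < n \<Longrightarrow> (c \<alpha> has_vector_derivative c' \<alpha> t) (at t)"
    "\<And>\<alpha> t. \<alpha> < n \<Longrightarrow> (c' \<alpha> has_vector_derivative c (Suc \<alpha>) t) (at t)"
    "\<And>\<alpha>. \<alpha> < n \<Longrightarrow> c' \<alpha> 0 = 0"
    by metis
  have cont: "continuous_on UNIV (c \<alpha>)" for \<alpha>
    unfolding c_def[abs_def] by (rule cosine_functional_continuous[OF \<psi>])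
  have C0: "C 0 y = y" for y using cos by (simp add: cosine_family_def)
  let ?e = "\<lambda>z::complex. exp (z * of_real t)"
  \<comment> \<open>The boundary terms at \<open>t\<close> carry no exponential, since
    \<open>exp (z t)\<close> cancels \<open>exp (- z t)\<close>; the one at 0 keeps it.\<close>
  define T where "T \<alpha> z = c' \<alpha> t * inverse ((z - 0) ^ (2 * \<alpha> + 2)) + c \<alpha> t * inverse ((z - 0) ^ (2 * \<alpha> + 1))
      - ?e z * (\<psi> ((A ^^ \<alpha>) x) * inverse (z ^ Suc (2 * \<alpha>)))" for \<alpha> z
  have main: "?e z * inverse (z ^ (2 * k)) * fin_laplace (c k) t z = ?e z * fin_laplace (c 0) t z + (\<Sum>\<alpha><k. T \<alpha> z)"
    if "k \<le> n" "z \<noteq> 0" for k z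
    using that(1)
  proof (induction k)
    case (Suc k)
    have "fin_laplace (c (Suc k)) t z
        = exp (- (z * of_real t)) * (c' k t + z * c k t) - z * c k 0 + z\<^sup>2 * fin_laplace (c k) t z"
      using Suc.prems by (intro fin_laplace_second_derivative c' cont t) auto
    moreover have "e * i * (u * v - z * w + q * l) = i * (e * u) * v - e * (i * z * w) + e * (i * q) * l"
      for e i u v w q l :: complex by (simp add: algebra_simps)
    ultimately have "?e z * inverse (z ^ (2 * Suc k)) * fin_laplace (c (Suc k)) t z
       = inverse (z ^ (2 * Suc k)) * (?e z * exp (- (z * of_real t))) * (c' k t + z * c k t)
         - ?e z * (inverse (z ^ (2 * Suc k)) * z * c k 0) + ?e z * (inverse (z ^ (2 * Suc k)) * z\<^sup>2) * fin_laplace (c k) t z"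
      by (simp only:)
    also have "?e z * exp (- (z * of_real t)) = 1" by (simp add: exp_minus)
    also have "inverse (z ^ (2 * Suc k)) * z\<^sup>2 = inverse (z ^ (2 * k))"
      using \<open>z \<noteq> 0\<close> by (simp add: field_simps power2_eq_square)
    also have "inverse (z ^ (2 * Suc k)) * 1 * (c' k t + z * c k t)
        = c' k t * inverse ((z - 0) ^ (2 * k + 2)) + c k t * inverse ((z - 0) ^ (2 * k + 1))"
      using \<open>z \<noteq> 0\<close> by (simp add: field_simps power2_eq_square)
    also have "inverse (z ^ (2 * Suc k)) * z * c k 0 = \<psi> ((A ^^ k) x) * inverse (z ^ Suc (2 * k))"
      using \<open>z \<noteq> 0\<close> by (simp add: c_def C0 field_simps power2_eq_square)
    also have "?e z * inverse (z ^ (2 * k)) * fin_laplace (c k) t z = ?e z * fin_laplace (c 0) t z + (\<Sum>\<alpha><k. T \<alpha> z)"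
      using Suc by simp
    finally show ?case by (simp add: T_def)
  qed simp
  have Tres: "residue (T \<alpha>) 0 = (if \<alpha> = 0 then \<psi> (C t x) else 0) - of_real (t ^ (2 * \<alpha>) / fact (2 * \<alpha>)) * \<psi> ((A ^^ \<alpha>) x)" for \<alpha>
  proof -
    have "residue (T \<alpha>) 0 = residue (\<lambda>z. c' \<alpha> t * inverse ((z - 0) ^ (2 * \<alpha> + 2)) + c \<alpha> t * inverse ((z - 0) ^ (2 * \<alpha> + 1))) 0
      - residue (\<lambda>z. ?e z * (\<psi> ((A ^^ \<alpha>) x) * inverse (z ^ Suc (2 * \<alpha>)))) 0"
      unfolding T_def[abs_def] by (rule residue_diff[of UNIV]) (auto intro!: holomorphic_intros)
    also have "residue (\<lambda>z. c' \<alpha> t * inverse ((z - 0) ^ (2 * \<alpha> + 2)) + c \<alpha> t * inverse ((z - 0) ^ (2 * \<alpha> + 1))) 0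
      = residue (\<lambda>z. c' \<alpha> t * inverse ((z - 0) ^ (2 * \<alpha> + 2))) 0 + residue (\<lambda>z. c \<alpha> t * inverse ((z - 0) ^ (2 * \<alpha> + 1))) 0"
      by (rule residue_add[of UNIV]) (auto intro!: holomorphic_intros)
    finally show ?thesis
      unfolding residue_pole_power residue_exp_over_power by (simp add: c_def)
  qed
  have Thol: "T \<alpha> holomorphic_on UNIV - {0}" for \<alpha>
    unfolding T_def[abs_def] by (intro holomorphic_intros) auto
  have "residue (\<lambda>z. ?e z * inverse (z ^ (2 * n)) * fin_laplace (c n) t z) 0
      = residue (\<lambda>z. ?e z * fin_laplace (c 0) t z + (\<Sum>\<alpha><n. T \<alpha> z)) 0"
    by (rule residue_cong) (auto simp: eventually_at_filter main)
  also have "\<dots> = residue (\<lambda>z. ?e z * fin_laplace (c 0) t z) 0 + residue (\<lambda>z. \<Sum>\<alpha><n. T \<alpha> z) 0"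
    using fin_laplace_holomorphic[OF cont]
    by (intro residue_add[of UNIV] holomorphic_intros Thol) (auto intro: holomorphic_on_subset)
  also have "residue (\<lambda>z. ?e z * fin_laplace (c 0) t z) 0 = 0"
    using fin_laplace_holomorphic[OF cont] by (intro residue_holo[of UNIV] holomorphic_intros) auto
  also have "residue (\<lambda>z. \<Sum>\<alpha><n. T \<alpha> z) 0 = (\<Sum>\<alpha><n. residue (T \<alpha>) 0)"
    by (rule residue_sum[of UNIV]) (auto intro: Thol)
  also have "\<dots> = (\<Sum>\<alpha><n. (if \<alpha> = 0 then \<psi> (C t x) else 0)) - (\<Sum>\<alpha><n. of_real (t ^ (2 * \<alpha>) / fact (2 * \<alpha>)) * \<psi> ((A ^^ \<alpha>) x))"
    unfolding Tres by (simp add: sum_subtractf)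
  also have "(\<Sum>\<alpha><n. (if \<alpha> = 0 then \<psi> (C t x) else 0)) = \<psi> (C t x)"
    using n by (simp add: sum.delta')
  finally show ?thesis by (simp add: c_def[abs_def])
qed

end
end

section \<open>Contours bounded by the graph of a function\<close>

definition graph_path :: "(real \<Rightarrow> real) \<Rightarrow> real \<Rightarrow> real \<Rightarrow> complex" where
  "graph_path h T u = Complex (h (2 * T * u - T)) (2 * T * u - T)"

lemma piecewise_C1_real_obtains:
  assumes "h piecewise_C1_differentiable_on {a..b}"
  obtains S h' where "finite S" "continuous_on {a..b} h" "continuous_on ({a..b} - S) h'"
    "\<And>s. s \<in> {a..b} - S \<Longrightarrow> (h has_real_derivative h' s) (at s)"
  using assms unfolding piecewise_C1_differentiable_on_def C1_differentiable_on_def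
    has_real_derivative_iff_has_vector_derivative by blast

lemma graph_path_param: "T > 0 \<Longrightarrow> u \<in> {0..1} \<Longrightarrow> 2 * T * u - T \<in> {-T..T}" for T u :: real
  by (auto simp: mult_left_le)

lemma graph_path_has_vector_derivative:
  assumes "(h has_real_derivative d) (at (2 * T * u - T))"
  shows "(graph_path h T has_vector_derivative (2 * T) *\<^sub>R Complex d 1) (at u)"
proof -
  have "((\<lambda>u. 2 * T * u - T) has_real_derivative 2 * T) (at u)"
    by (auto intro!: derivative_eq_intros)
  from DERIV_chain2[OF assms this]
  have "((\<lambda>u. h (2 * T * u - T)) has_real_derivative d * (2 * T)) (at u)" .
  then show ?thesis unfolding graph_path_def[abs_def] has_vector_derivative_complex_iff
    by (auto intro!: derivative_eq_intros simp: mult.commute)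
qed

lemma valid_path_graph_path:
  assumes h: "h piecewise_C1_differentiable_on {-T..T}" and T: "T > 0"
  shows "valid_path (graph_path h T)"
proof -
  obtain S h' where S: "finite S" and hc: "continuous_on {-T..T} h" "continuous_on ({-T..T} - S) h'"
    and hd: "\<And>s. s \<in> {-T..T} - S \<Longrightarrow> (h has_real_derivative h' s) (at s)"
    using piecewise_C1_real_obtains[OF h] by metis
  let ?s = "\<lambda>u::real. 2 * T * u - T"
  let ?S = "?s -` S"
  have "inj ?s" using T by (auto intro!: injI)
  then have "finite ?S" using S by (rule finite_vimageI[rotated])
  moreover have "continuous_on {0..1} (graph_path h T)"
  proof -
    have "continuous_on {0..1} (\<lambda>u. h (?s u))"
      using T by (intro continuous_on_compose2[OF hc(1)]) (auto intro!: continuous_intros simp: mult_left_le)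
    then show ?thesis
      unfolding graph_path_def[abs_def] Complex_eq by (intro continuous_intros)
  qed
  moreover have "graph_path h T C1_differentiable_on {0..1} - ?S"
  proof -
    have "continuous_on ({0..1} - ?S) (\<lambda>u. h' (?s u))"
      using T by (intro continuous_on_compose2[OF hc(2)]) (auto intro!: continuous_intros simp: mult_left_le)
    then have "continuous_on ({0..1} - ?S) (\<lambda>u. (2 * T) *\<^sub>R Complex (h' (?s u)) 1)"
      unfolding Complex_eq by (intro continuous_intros)
    moreover have "(graph_path h T has_vector_derivative (2 * T) *\<^sub>R Complex (h' (?s u)) 1) (at u)"
      if "u \<in> {0..1} - ?S" for u
      using that graph_path_param[OF T, of u] by (intro graph_path_has_vector_derivative hd) auto
    ultimately show ?thesis unfolding C1_differentiable_on_def
      by (intro exI[of _ "\<lambda>u. (2 * T) *\<^sub>R Complex (h' (?s u)) 1"] conjI ballI)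
  qed
  ultimately show ?thesis unfolding valid_path_def piecewise_C1_differentiable_on_def
    by (intro conjI exI[of _ ?S])
qed

lemma path_image_graph_path:
  assumes "T > 0"
  shows "path_image (graph_path h T) \<subseteq> {Complex (h s) s | s. s \<in> {-T..T}}"
  using graph_path_param[OF assms] by (fastforce simp: path_image_def graph_path_def)

lemma pathstart_graph_path [simp]: "pathstart (graph_path h T) = Complex (h (- T)) (- T)"
  and pathfinish_graph_path [simp]: "pathfinish (graph_path h T) = Complex (h T) T"
  by (simp_all add: pathstart_def pathfinish_def graph_path_def)

text \<open>The contour integral is an integral over the height \<open>s\<close>, with path
  derivative \<open>h' + \<i>\<close>. Finitely many heights are exempt from the majorant
  \<open>B\<close>, and no bound is demanded at the kinks of \<open>h\<close>.\<close>

lemma graph_path_integral_bound: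
  assumes h: "h piecewise_C1_differentiable_on {-T..T}" and T: "T > 0"
    and f: "f contour_integrable_on graph_path h T"
    and B: "(B has_integral J) {-T..T}" and N: "finite N"
    and le: "\<And>s d. s \<in> {-T..T} - N \<Longrightarrow> (h has_real_derivative d) (at s) \<Longrightarrow>
      cmod (f (Complex (h s) s)) * cmod (Complex d 1) \<le> B s"
  shows "cmod (contour_integral (graph_path h T) f) \<le> J"
proof -
  obtain S h' where S: "finite S"
    and hd: "\<And>s. s \<in> {-T..T} - S \<Longrightarrow> (h has_real_derivative h' s) (at s)"
    using piecewise_C1_real_obtains[OF h] by metis
  let ?s = "\<lambda>u::real. 2 * T * u - T"
  let ?S = "?s -` (S \<union> N)"
  have "inj ?s" using T by (auto intro!: injI)
  then have fin: "finite ?S" using S N by (intro finite_vimageI) auto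
  let ?F = "\<lambda>u. f (graph_path h T u) * vector_derivative (graph_path h T) (at u)"
  \<comment> \<open>Both integrands are set to 0 at the exceptional parameters, so that the
    pointwise comparison holds on all of \<open>[0, 1]\<close>.\<close>
  define F where "F u = (if u \<in> ?S then 0 else ?F u)" for u
  define G where "G u = (if u \<in> ?S then 0 else 2 * T * B (?s u))" for u
  have "(?F has_integral contour_integral (graph_path h T) f) {0..1}"
    using has_contour_integral_integral[OF f] by (simp add: has_contour_integral)
  then have F: "(F has_integral contour_integral (graph_path h T) f) {0..1}"
    by (rule has_integral_spike_finite[OF fin, rotated]) (simp add: F_def)
  have "((\<lambda>u. B (2 * T * u - T)) has_integral J / (2 * T)) {0..1}"
  proof -
    have "((\<lambda>u. B ((2 * T) *\<^sub>R u + (- T))) has_integral J /\<^sub>R (2 * T) ^ DIM(real))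
        (cbox ((- T - (- T)) /\<^sub>R (2 * T)) ((T - (- T)) /\<^sub>R (2 * T)))"
      by (rule has_integral_affinity') (use B T in auto)
    moreover have "(T - (- T)) /\<^sub>R (2 * T) = 1" "(- T - (- T)) /\<^sub>R (2 * T) = 0"
      "J /\<^sub>R (2 * T) ^ DIM(real) = J / (2 * T)"
      using T by (simp_all add: field_simps)
    ultimately show ?thesis by (simp only: box_real real_scaleR_def diff_conv_add_uminus)
  qed
  from has_integral_mult_right[OF this, of "2 * T"]
  have "((\<lambda>u. 2 * T * B (?s u)) has_integral 2 * T * (J / (2 * T))) {0..1}" .
  then have "((\<lambda>u. 2 * T * B (?s u)) has_integral J) {0..1}" using T by simp
  then have G: "(G has_integral J) {0..1}"
    by (rule has_integral_spike_finite[OF fin, rotated]) (simp add: G_def)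
  have "norm (F u) \<le> G u" if u: "u \<in> {0..1}" for u
  proof (cases "u \<in> ?S")
    case False
    have su: "?s u \<in> {-T..T} - S" "?s u \<in> {-T..T} - N" using graph_path_param[OF T u] False by auto
    have "vector_derivative (graph_path h T) (at u) = (2 * T) *\<^sub>R Complex (h' (?s u)) 1"
      by (intro vector_derivative_at graph_path_has_vector_derivative hd su)
    then have "norm (F u) = 2 * T * (cmod (f (Complex (h (?s u)) (?s u))) * cmod (Complex (h' (?s u)) 1))"
      using False T by (simp add: F_def norm_mult graph_path_def)
    also have "\<dots> \<le> 2 * T * B (?s u)" using T by (intro mult_left_mono le su hd) auto
    finally show ?thesis using False by (simp add: G_def)
  qed (simp add: F_def G_def)
  then show ?thesis using has_integral_norm_bound_integral_component F G
    by (metis integral_norm_bound_integral has_integral_integrable integral_unique)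
qed

text \<open>The shear \<open>z \<mapsto> z - g (Im z)\<close> straightens the region to a
  half-plane.\<close>

lemma simply_connected_right_of_graph:
  fixes g :: "real \<Rightarrow> real"
  assumes g: "continuous_on UNIV g"
  shows "simply_connected {z. g (Im z) < Re z}"
proof -
  let ?f = "\<lambda>z. z - of_real (g (Im z))" and ?i = "\<lambda>z. z + of_real (g (Im z))"
  have c: "continuous_on S (\<lambda>z. of_real (g (Im z)) :: complex)" for S
    by (intro continuous_intros continuous_on_compose2[OF g]) auto
  have "homeomorphism {z. g (Im z) < Re z} {z. Re z > 0} ?f ?i"
  proof (rule homeomorphismI)
    show "continuous_on {z. g (Im z) < Re z} ?f" "continuous_on {z. Re z > 0} ?i"
      by (intro continuous_intros c)+
  qed auto
  then have "{z. g (Im z) < Re z} homeomorphic {z. Re z > 0}"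
    by (auto simp: homeomorphic_def)
  then show ?thesis
    by (simp add: homeomorphic_simply_connected_eq convex_imp_simply_connected convex_halfspace_Re_gt)
qed

lemma open_right_of_graph:
  fixes g :: "real \<Rightarrow> real"
  assumes g: "continuous_on UNIV g"
  shows "open {z. g (Im z) < Re z}"
  by (intro open_Collect_less continuous_intros continuous_on_compose2[OF g]) auto

text \<open>Three segments and the reversed graph form a closed curve in a simply connected region,
  so only its winding numbers around the points of \<open>S\<close> are at issue. They are computed
  from two branches of the logarithm instead of from the shape of the curve.\<close>

lemma graph_rectangle_residues:
  fixes g h :: "real \<Rightarrow> real" and f :: "complex \<Rightarrow> complex"
  assumes g: "continuous_on UNIV g" and T: "T > 0"
    and h: "h piecewise_C1_differentiable_on {-T..T}"
    and gh: "\<And>s. s \<in> {-T..T} \<Longrightarrow> g s < h s" and ha: "\<And>s. s \<in> {-T..T} \<Longrightarrow> h s < a"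
    and S: "finite S" and f: "f holomorphic_on {z. g (Im z) < Re z} - S"
    and SI: "\<And>p. p \<in> S \<Longrightarrow> \<bar>Im p\<bar> < T \<and> h (Im p) < Re p \<and> Re p < a"
  shows "contour_integral (linepath (Complex (h (- T)) (- T)) (Complex a (- T))) f
       + contour_integral (linepath (Complex a (- T)) (Complex a T)) f
       + contour_integral (linepath (Complex a T) (Complex (h T) T)) f
       - contour_integral (graph_path h T) f = 2 * pi * \<i> * (\<Sum>p\<in>S. residue f p)"
    and "f contour_integrable_on (graph_path h T)"
proof -
  let ?\<Omega> = "{z. g (Im z) < Re z}"
  let ?BL = "Complex (h (- T)) (- T)" and ?BR = "Complex a (- T)" and ?TR = "Complex a T"
    and ?TL = "Complex (h T) T"
  let ?\<delta> = "linepath ?BL ?BR +++ (linepath ?BR ?TR +++ linepath ?TR ?TL)"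
  let ?\<Gamma> = "graph_path h T"
  let ?c = "?\<delta> +++ reversepath ?\<Gamma>"
  have b: "closed_segment ?BL ?BR \<subseteq> {z. Im z = - T \<and> Re z \<in> {h (- T)..a}}"
    using ha[of "-T"] T by (auto simp: closed_segment_same_Im closed_segment_eq_real_ivl)
  have r: "closed_segment ?BR ?TR \<subseteq> {z. Re z = a \<and> Im z \<in> {-T..T}}"
    using T by (auto simp: closed_segment_same_Re closed_segment_eq_real_ivl)
  have t: "closed_segment ?TR ?TL \<subseteq> {z. Im z = T \<and> Re z \<in> {h T..a}}"
    using ha[of T] T by (auto simp: closed_segment_same_Im closed_segment_eq_real_ivl)
  have vp: "valid_path ?\<Gamma>" by (rule valid_path_graph_path[OF h T])
  have pi\<Gamma>: "path_image ?\<Gamma> \<subseteq> {Complex (h s) s | s. s \<in> {-T..T}}" by (rule path_image_graph_path[OF T])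
  have pi\<delta>: "path_image ?\<delta> = closed_segment ?BL ?BR \<union> (closed_segment ?BR ?TR \<union> closed_segment ?TR ?TL)"
    by (simp add: path_image_join)
  have vpc: "valid_path ?c" using vp by (simp add: valid_path_join)
  have b': "closed_segment ?BL ?BR \<subseteq> ?\<Omega> - S"
    using b SI gh[of "-T"] T by force
  have t': "closed_segment ?TR ?TL \<subseteq> ?\<Omega> - S"
    using t SI gh[of T] T by force
  have r': "closed_segment ?BR ?TR \<subseteq> ?\<Omega> - S"
  proof
    fix z assume "z \<in> closed_segment ?BR ?TR"
    then have z: "Re z = a" "Im z \<in> {-T..T}" using r by auto
    then have "g (Im z) < Re z" using gh[of "Im z"] ha[of "Im z"] by simp
    then show "z \<in> ?\<Omega> - S" using SI z by auto
  qed
  have \<Gamma>': "path_image ?\<Gamma> \<subseteq> ?\<Omega> - S"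
    using pi\<Gamma> gh SI by fastforce
  have op: "open (?\<Omega> - S)" using open_right_of_graph[OF g] S by (intro open_Diff finite_imp_closed) auto
  have line: "f contour_integrable_on linepath u v" if "closed_segment u v \<subseteq> ?\<Omega> - S" for u v
    using that holomorphic_on_imp_continuous_on[OF f]
    by (intro contour_integrable_continuous_linepath) (blast intro: continuous_on_subset)
  show \<Gamma>int: "f contour_integrable_on ?\<Gamma>"
    by (rule contour_integrable_holomorphic_simple[OF f op vp \<Gamma>'])
  \<comment> \<open>On the segments \<open>w - p\<close> avoids the nonpositive reals; on the graph,
    which passes to the left of \<open>p\<close>, so does \<open>p - w\<close>. The two logarithms
    differ by \<open>\<i> pi\<close> with opposite signs at the upper and the lower end, which adds
    up to \<open>2 pi \<i>\<close>.\<close>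
  have wind: "winding_number ?c p = 1" if p: "p \<in> S" for p
  proof -
    have pT: "\<bar>Im p\<bar> < T" "h (Im p) < Re p" "Re p < a" using SI[OF p] by auto
    have "((\<lambda>w. 1 / (w - p)) has_contour_integral Ln (pathfinish ?\<delta> - p) - Ln (pathstart ?\<delta> - p)) ?\<delta>"
    proof (rule contour_integral_primitive)
      fix x assume "x \<in> path_image ?\<delta>"
      then have "Im x \<noteq> Im p \<or> Re x > Re p" using b r t pT unfolding pi\<delta> by auto
      then have "x - p \<notin> \<real>\<^sub>\<le>\<^sub>0" by (auto simp: complex_nonpos_Reals_iff)
      then show "((\<lambda>w. Ln (w - p)) has_field_derivative 1 / (x - p)) (at x within path_image ?\<delta>)"
        by (auto intro!: derivative_eq_intros simp: inverse_eq_divide)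
    qed auto
    moreover have "((\<lambda>w. 1 / (w - p)) has_contour_integral Ln (p - pathfinish ?\<Gamma>) - Ln (p - pathstart ?\<Gamma>)) ?\<Gamma>"
    proof (rule contour_integral_primitive)
      fix x assume "x \<in> path_image ?\<Gamma>"
      then have "Im x \<noteq> Im p \<or> Re x < Re p" using pi\<Gamma> pT by auto
      then have "p - x \<notin> \<real>\<^sub>\<le>\<^sub>0" "x \<noteq> p" by (auto simp: complex_nonpos_Reals_iff)
      then show "((\<lambda>w. Ln (p - w)) has_field_derivative 1 / (x - p)) (at x within path_image ?\<Gamma>)"
        by (auto intro!: derivative_eq_intros simp: field_simps)
    qed (use vp in auto)
    ultimately have "((\<lambda>w. 1 / (w - p)) has_contour_integral
        (Ln (?TL - p) - Ln (?BL - p)) + - (Ln (p - ?TL) - Ln (p - ?BL))) ?c"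
      using vp by (intro has_contour_integral_join has_contour_integral_reversepath) auto
    moreover have "Ln (- (?TL - p)) = Ln (?TL - p) - \<i> * pi"
      using pT by (subst Ln_minus) (auto simp: complex_eq_iff[of _ p])
    moreover have "Ln (- (?BL - p)) = Ln (?BL - p) + \<i> * pi"
      using pT by (subst Ln_minus) (auto simp: complex_eq_iff[of _ p])
    ultimately have "contour_integral ?c (\<lambda>w. 1 / (w - p)) = 2 * pi * \<i>"
      by (simp add: contour_integral_unique)
    moreover have "p \<notin> path_image ?c"
      using b' r' t' \<Gamma>' p by (auto simp: path_image_join pi\<delta>)
    ultimately show ?thesis using winding_number_valid_path[OF vpc] by simp
  qed
  have "contour_integral ?c f = 2 * pi * \<i> * (\<Sum>p\<in>S. winding_number ?c p * residue f p)"
  proof (rule Residue_theorem[OF open_right_of_graph[OF g] _ S f vpc])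
    show "connected ?\<Omega>" using simply_connected_right_of_graph[OF g] by (rule simply_connected_imp_connected)
    show "path_image ?c \<subseteq> ?\<Omega> - S" using b' r' t' \<Gamma>' by (simp add: path_image_join)
    then have "path_image ?c \<subseteq> ?\<Omega>" by blast
    then show "\<forall>z. z \<notin> ?\<Omega> \<longrightarrow> winding_number ?c z = 0"
      using simply_connected_imp_winding_number_zero[OF simply_connected_right_of_graph[OF g] valid_path_imp_path[OF vpc]]
      by simp
  qed simp
  also have "(\<Sum>p\<in>S. winding_number ?c p * residue f p) = (\<Sum>p\<in>S. residue f p)"
    by (simp add: wind)
  finally have "contour_integral ?c f = 2 * pi * \<i> * (\<Sum>p\<in>S. residue f p)" .
  moreover have "contour_integral ?c f = contour_integral (linepath ?BL ?BR) f
       + (contour_integral (linepath ?BR ?TR) f + contour_integral (linepath ?TR ?TL) f)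
       - contour_integral ?\<Gamma> f"
    using vp \<Gamma>int line[OF b'] line[OF r'] line[OF t']
    by (simp add: contour_integral_join contour_integral_reversepath contour_integrable_reversepath valid_path_join)
  ultimately show "contour_integral (linepath ?BL ?BR) f + contour_integral (linepath ?BR ?TR) f
       + contour_integral (linepath ?TR ?TL) f - contour_integral ?\<Gamma> f = 2 * pi * \<i> * (\<Sum>p\<in>S. residue f p)"
    by (simp add: add.assoc)
qed

lemma graph_path_const: "graph_path (\<lambda>_. c) T = linepath (Complex c (- T)) (Complex c T)"
  by (auto simp: graph_path_def linepath_def fun_eq_iff complex_eq_iff algebra_simps)

lemma const_piecewise_C1: "(\<lambda>_. c) piecewise_C1_differentiable_on S"
  by (intro C1_differentiable_imp_piecewise) simp

section \<open>The inverse Laplace integral over a vertical line\<close>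

context cosine_resolvent
begin

context
  fixes \<psi> :: "'x \<Rightarrow> complex" and K :: real
  assumes \<psi>: "cf_bfunc \<psi>" and K: "cmod (\<psi> x) \<le> K * norm x" and K_nonneg: "K \<ge> 0"
begin

text \<open>Under the integral \<open>exp (z t)\<close> becomes \<open>exp (z (t - s))\<close> with
  \<open>t - s \<ge> 0\<close>, which stays bounded however far \<open>z\<close> moves to the
  left.\<close>

lemma fin_laplace_exp_bound:
  assumes z: "Re z \<le> a" and a: "a \<ge> 0" and t: "t \<ge> 0"
  shows "cmod (exp (z * of_real t) * fin_laplace (\<lambda>s. \<psi> (C s y)) t z)
    \<le> exp (a * t) * (K * M * exp (\<omega> * t) * norm y) * t"
proof -
  have "exp (z * of_real t) * fin_laplace (\<lambda>s. \<psi> (C s y)) t z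
      = integral {0..t} (\<lambda>s. exp (z * of_real (t - s)) * \<psi> (C s y))"
    unfolding fin_laplace_def integral_mult_right[symmetric]
    by (intro integral_cong) (simp add: right_diff_distrib exp_diff exp_minus divide_inverse)
  also have "cmod \<dots> \<le> (exp (a * t) * (K * M * exp (\<omega> * t) * norm y)) * (t - 0)"
  proof (rule integral_bound[OF t])
    show "continuous_on {0..t} (\<lambda>s. exp (z * of_real (t - s)) * \<psi> (C s y))"
      by (intro continuous_intros continuous_on_subset[OF cosine_functional_continuous[OF \<psi>]]) auto
    fix s assume s: "s \<in> {0..t}"
    have "cmod (exp (z * of_real (t - s))) \<le> exp (a * t)"
    proof -
      have "Re z * (t - s) \<le> a * (t - s)" using z s by (intro mult_right_mono) auto
      also have "\<dots> \<le> a * t" using a s by (intro mult_left_mono) auto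
      finally show ?thesis by simp
    qed
    moreover have "cmod (\<psi> (C s y)) \<le> K * M * exp (\<omega> * t) * norm y"
    proof -
      have "cmod (\<psi> (C s y)) \<le> K * M * exp (\<omega> * s) * norm y"
        using s by (intro cosine_functional_bound[OF \<psi> K K_nonneg]) auto
      also have "\<dots> \<le> K * M * exp (\<omega> * t) * norm y"
        using s K_nonneg M_ge \<omega>_pos by (intro mult_right_mono mult_left_mono) auto
      finally show ?thesis .
    qed
    ultimately show "norm (exp (z * of_real (t - s)) * \<psi> (C s y)) \<le> exp (a * t) * (K * M * exp (\<omega> * t) * norm y)"
      unfolding norm_mult by (intro mult_mono) auto
  qed
  finally show ?thesis by simp
qed

text \<open>On the vertical line the integrand is split, as in Newman's proof of the prime number theorem,
  into a part built from the Laplace integral over \<open>[0, t]\<close>, for which the contour is closed far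
  to the left, and a remainder, for which it is closed far to the right.\<close>

lemma vertical_integral_tendsto:
  assumes x: "x \<in> cf_dom_pow D A n" and n: "n \<ge> 1" and t: "t \<ge> 0" and a: "a > \<omega>"
    and hol: "(\<lambda>z. \<psi> (R0 z ((A ^^ n) x))) holomorphic_on {z. \<omega> < Re z}"
  shows "((\<lambda>T. contour_integral (linepath (Complex a (- T)) (Complex a T))
      (\<lambda>z. exp (z * of_real t) * inverse (z ^ (2 * n)) * (z * \<psi> (R0 z ((A ^^ n) x)))))
     \<longlongrightarrow> 2 * pi * \<i> * (\<psi> (C t x) - (\<Sum>\<alpha><n. of_real (t ^ (2 * \<alpha>) / fact (2 * \<alpha>)) * \<psi> ((A ^^ \<alpha>) x)))) at_top"
proof -
  define y where "y = (A ^^ n) x"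
  define r where "r = \<psi> (C t x) - (\<Sum>\<alpha><n. of_real (t ^ (2 * \<alpha>) / fact (2 * \<alpha>)) * \<psi> ((A ^^ \<alpha>) x))"
  define L where "L = fin_laplace (\<lambda>s. \<psi> (C s y)) t"
  define F where "F z = exp (z * of_real t) * inverse (z ^ (2 * n)) * (z * \<psi> (R0 z y))" for z
  define W where "W z = exp (z * of_real t) * inverse (z ^ (2 * n)) * L z" for z
  define V where "V z = exp (z * of_real t) * inverse (z ^ (2 * n)) * (z * \<psi> (R0 z y) - L z)" for z
  have apos: "a > 0" using a \<omega>_pos by simp
  have Lhol: "L holomorphic_on S" for S
    unfolding L_def using fin_laplace_holomorphic[OF cosine_functional_continuous[OF \<psi>]]
    by (rule holomorphic_on_subset) simp
  have Whol: "W holomorphic_on UNIV - {0}"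
    unfolding W_def by (intro holomorphic_intros Lhol) auto
  have Vhol: "V holomorphic_on {z. \<omega> < Re z}"
    unfolding V_def using \<omega>_pos
    by (intro holomorphic_intros Lhol hol[folded y_def]) auto
  define B1 where "B1 = exp (a * t) * (K * M * exp (\<omega> * t) * norm y) * t"
  define B2 where "B2 = K * M * norm y * exp (\<omega> * t) / (a - \<omega>)"
  have B1: "B1 \<ge> 0" and B2: "B2 \<ge> 0"
    using K_nonneg M_ge a t by (auto simp: B1_def B2_def)
  have inv: "inverse (cmod z ^ (2 * n)) \<le> inverse (T\<^sup>2)" if "cmod z \<ge> T" "T \<ge> 1" for z T
  proof -
    have "T\<^sup>2 \<le> cmod z ^ 2" using that by (intro power_mono) auto
    also have "\<dots> \<le> cmod z ^ (2 * n)" using that n by (intro power_increasing) auto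
    finally show ?thesis using that by (intro le_imp_inverse_le) auto
  qed
  have Wb: "cmod (W z) \<le> B1 / T\<^sup>2" if "cmod z \<ge> T" "T \<ge> 1" "Re z \<le> a" for z T
  proof -
    have "cmod (W z) = inverse (cmod z ^ (2 * n)) * cmod (exp (z * of_real t) * L z)"
      by (simp add: W_def norm_mult norm_inverse norm_power)
    also have "\<dots> \<le> inverse (T\<^sup>2) * B1"
      unfolding B1_def L_def using that t apos
      by (intro mult_mono inv fin_laplace_exp_bound) auto
    finally show ?thesis by (simp add: divide_inverse mult.commute)
  qed
  have Vb: "cmod (V z) \<le> B2 / T\<^sup>2" if "cmod z \<ge> T" "T \<ge> 1" "a \<le> Re z" for z T
  proof -
    have z: "\<omega> < Re z" using a that by simp
    have "cmod (exp (z * of_real t) * (z * \<psi> (R0 z y) - L z))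
        = exp (Re z * t) * cmod (z * \<psi> (R0 z y) - L z)" by (simp add: norm_mult)
    also have "\<dots> \<le> exp (Re z * t) * (K * M * norm y * exp (- ((Re z - \<omega>) * t)) / (Re z - \<omega>))"
      unfolding L_def by (intro mult_left_mono resolvent_minus_fin_laplace_bound[OF \<psi> K K_nonneg z t]) auto
    also have "\<dots> = K * M * norm y * (exp (Re z * t) * exp (- ((Re z - \<omega>) * t))) / (Re z - \<omega>)"
      by simp
    also have "\<dots> = K * M * norm y * exp (\<omega> * t) / (Re z - \<omega>)"
      unfolding exp_add[symmetric] by (simp add: algebra_simps)
    also have "\<dots> \<le> B2"
      unfolding B2_def using K_nonneg M_ge that a by (intro divide_left_mono) auto
    finally have "cmod (exp (z * of_real t) * (z * \<psi> (R0 z y) - L z)) \<le> B2" .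
    moreover have "cmod (V z) = inverse (cmod z ^ (2 * n)) * cmod (exp (z * of_real t) * (z * \<psi> (R0 z y) - L z))"
      by (simp add: V_def norm_mult norm_inverse norm_power)
    ultimately have "cmod (V z) \<le> inverse (T\<^sup>2) * B2"
      using that B2 by (auto intro!: mult_mono inv)
    then show ?thesis by (simp add: divide_inverse mult.commute)
  qed
  \<comment> \<open>A closing side has length of order \<open>T\<close> and the integrand on it is
    of order \<open>1 / T^2\<close>, so its contribution is of order \<open>1 / T\<close>.\<close>
  have side: "cmod (contour_integral (linepath u v) f) \<le> B / T\<^sup>2 * (m * T)"
    if f: "f holomorphic_on S" and seg: "closed_segment u v \<subseteq> S" and B: "B \<ge> 0" and T: "T \<ge> 1"
      and le: "\<And>z. z \<in> closed_segment u v \<Longrightarrow> cmod (f z) \<le> B / T\<^sup>2" and d: "cmod (v - u) \<le> m * T"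
    for u v f S B T m
  proof -
    have "f contour_integrable_on linepath u v"
      using f seg by (intro contour_integrable_continuous_linepath holomorphic_on_imp_continuous_on)
        (rule holomorphic_on_subset)
    then have "cmod (contour_integral (linepath u v) f) \<le> B / T\<^sup>2 * cmod (v - u)"
      using B le by (intro contour_integral_bound_linepath) auto
    also have "\<dots> \<le> B / T\<^sup>2 * (m * T)" using d B by (intro mult_left_mono) auto
    finally show ?thesis .
  qed
  have main: "cmod (contour_integral (linepath (Complex a (- T)) (Complex a T)) F - 2 * pi * \<i> * r) \<le> (6 * B1 + 4 * B2) / T"
    if T: "T \<ge> 1" "T > a" for T
  proof -
    let ?line = "linepath (Complex a (- T)) (Complex a T)"
    have cmodge: "cmod z \<ge> T" if "\<bar>Re z\<bar> \<ge> T \<or> \<bar>Im z\<bar> \<ge> T" for z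
      using that abs_Re_le_cmod[of z] abs_Im_le_cmod[of z] by linarith
    have segs: "closed_segment (Complex u T') (Complex v T') = {z. Im z = T' \<and> Re z \<in> closed_segment u v}"
      "closed_segment (Complex T' u) (Complex T' v) = {z. Re z = T' \<and> Im z \<in> closed_segment u v}" for u v T'
      by (auto simp: closed_segment_same_Im closed_segment_same_Re)
    note sg = segs closed_segment_eq_real_ivl
    \<comment> \<open>The left edge lies at \<open>Re z = - T\<close>, and the auxiliary boundary
      \<open>- T - 1\<close> just beyond it. The only pole inside is 0.\<close>
    have "contour_integral (linepath (Complex (- T) (- T)) (Complex a (- T))) W + contour_integral ?line W
       + contour_integral (linepath (Complex a T) (Complex (- T) T)) W
       - contour_integral (graph_path (\<lambda>_. - T) T) W = 2 * pi * \<i> * (\<Sum>p\<in>{0}. residue W p)"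
      by (rule graph_rectangle_residues(1)[where g = "\<lambda>_. - T - 1"])
        (use T apos in \<open>auto intro!: const_piecewise_C1 holomorphic_on_subset[OF Whol]\<close>)
    moreover have resW: "residue W 0 = r"
      unfolding W_def[abs_def] L_def r_def y_def
      by (rule residue_fin_laplace[OF \<psi> K K_nonneg x n t])
    moreover have "cmod (contour_integral (linepath (Complex (- T) (- T)) (Complex a (- T))) W) \<le> B1 / T\<^sup>2 * (2 * T)"
      using T apos by (intro side[OF Whol] B1 Wb cmodge) (auto simp: sg cmod_def real_sqrt_mult)
    moreover have "cmod (contour_integral (linepath (Complex a T) (Complex (- T) T)) W) \<le> B1 / T\<^sup>2 * (2 * T)"
      using T apos by (intro side[OF Whol] B1 Wb cmodge) (auto simp: sg cmod_def real_sqrt_mult)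
    moreover have "cmod (contour_integral (graph_path (\<lambda>_. - T) T) W) \<le> B1 / T\<^sup>2 * (2 * T)"
      unfolding graph_path_const
      using T apos by (intro side[OF Whol] B1 Wb cmodge) (auto simp: sg cmod_def real_sqrt_mult)
    moreover have "cmod (b - R) \<le> 3 * e" if "a + b + c - d = R" "cmod a \<le> e" "cmod c \<le> e" "cmod d \<le> e"
      for a b c d R :: complex and e
    proof -
      have "b - R = d - a - c" unfolding that(1)[symmetric] by simp
      then have "cmod (b - R) \<le> cmod (d - a) + cmod c" by (simp only: norm_triangle_ineq4)
      then show ?thesis using norm_triangle_ineq4[of d a] that by linarith
    qed
    ultimately have "cmod (contour_integral ?line W - 2 * pi * \<i> * (\<Sum>p\<in>{0}. residue W p)) \<le> 3 * (B1 / T\<^sup>2 * (2 * T))"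
      by blast
    moreover have "(\<Sum>p\<in>{0}. residue W p) = r" using resW by simp
    ultimately have 1: "cmod (contour_integral ?line W - 2 * pi * \<i> * r) \<le> 3 * (B1 / T\<^sup>2 * (2 * T))"
      by (simp only:)
    \<comment> \<open>\<open>V\<close> is holomorphic between \<open>a\<close> and
      \<open>a + T\<close>, so the set of poles is empty; here the vertical line itself is the
      graph, of the constant \<open>a\<close>.\<close>
    have "contour_integral (linepath (Complex a (- T)) (Complex (a + T) (- T))) V
       + contour_integral (linepath (Complex (a + T) (- T)) (Complex (a + T) T)) V
       + contour_integral (linepath (Complex (a + T) T) (Complex a T)) V
       - contour_integral (graph_path (\<lambda>_. a) T) V = 2 * pi * \<i> * (\<Sum>p\<in>{}. residue V p)"
      by (rule graph_rectangle_residues(1)[where g = "\<lambda>_. \<omega>"])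
        (use T a in \<open>auto intro!: const_piecewise_C1 holomorphic_on_subset[OF Vhol]\<close>)
    moreover have "cmod (contour_integral (linepath (Complex a (- T)) (Complex (a + T) (- T))) V) \<le> B2 / T\<^sup>2 * (1 * T)"
      using T a apos by (intro side[OF Vhol] B2 Vb cmodge) (auto simp: sg cmod_def real_sqrt_mult)
    moreover have "cmod (contour_integral (linepath (Complex (a + T) (- T)) (Complex (a + T) T)) V) \<le> B2 / T\<^sup>2 * (2 * T)"
      using T a apos by (intro side[OF Vhol] B2 Vb cmodge) (auto simp: sg cmod_def real_sqrt_mult)
    moreover have "cmod (contour_integral (linepath (Complex (a + T) T) (Complex a T)) V) \<le> B2 / T\<^sup>2 * (1 * T)"
      using T a apos by (intro side[OF Vhol] B2 Vb cmodge) (auto simp: sg cmod_def real_sqrt_mult)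
    moreover have "cmod d \<le> ea + eb + ec" if "a + b + c - d = 2 * pi * \<i> * (\<Sum>p\<in>{}. residue V p)"
      "cmod a \<le> ea" "cmod b \<le> eb" "cmod c \<le> ec" for a b c d :: complex and ea eb ec
    proof -
      have "d = a + b + c" using that(1) by simp
      then show ?thesis using norm_triangle_ineq[of "a + b" c] norm_triangle_ineq[of a b] that by simp
    qed
    ultimately have 2: "cmod (contour_integral ?line V) \<le> B2 / T\<^sup>2 * (1 * T) + B2 / T\<^sup>2 * (2 * T) + B2 / T\<^sup>2 * (1 * T)"
      unfolding graph_path_const by blast
    have "contour_integral ?line F = contour_integral ?line (\<lambda>z. W z + V z)"
      by (rule arg_cong[where f = "contour_integral ?line"]) (simp add: F_def W_def V_def fun_eq_iff algebra_simps)
    also have "\<dots> = contour_integral ?line W + contour_integral ?line V"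
    proof (rule contour_integral_add)
      have "closed_segment (Complex a (- T)) (Complex a T) \<subseteq> {z. \<omega> < Re z}" using a by (auto simp: sg)
      moreover have "{z. \<omega> < Re z} \<subseteq> UNIV - {0}" using \<omega>_pos by auto
      ultimately show "W contour_integrable_on ?line" "V contour_integrable_on ?line"
        by (intro contour_integrable_continuous_linepath holomorphic_on_imp_continuous_on
            holomorphic_on_subset[OF Whol] holomorphic_on_subset[OF Vhol]; blast)+
    qed
    finally have "cmod (contour_integral ?line F - 2 * pi * \<i> * r)
       = cmod ((contour_integral ?line W - 2 * pi * \<i> * r) + contour_integral ?line V)"
      by (simp add: algebra_simps)
    also have "\<dots> \<le> 3 * (B1 / T\<^sup>2 * (2 * T)) + (B2 / T\<^sup>2 * (1 * T) + B2 / T\<^sup>2 * (2 * T) + B2 / T\<^sup>2 * (1 * T))"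
      using 1 2 by (rule norm_triangle_mono)
    also have "\<dots> = (6 * B1 + 4 * B2) / T" using T by (simp add: field_simps power2_eq_square)
    finally show ?thesis .
  qed
  have "((\<lambda>T. contour_integral (linepath (Complex a (- T)) (Complex a T)) F - 2 * pi * \<i> * r) \<longlongrightarrow> 0) at_top"
  proof (rule Lim_null_comparison)
    show "\<forall>\<^sub>F T in at_top. norm (contour_integral (linepath (Complex a (- T)) (Complex a T)) F - 2 * pi * \<i> * r)
        \<le> (6 * B1 + 4 * B2) / T"
      using eventually_ge_at_top[of 1] eventually_gt_at_top[of a] by eventually_elim (rule main)
    show "((\<lambda>T. (6 * B1 + 4 * B2) / T) \<longlongrightarrow> 0) at_top" by real_asymp
  qed
  then show ?thesis
    unfolding F_def[abs_def] y_def r_def[symmetric] by (rule Lim_null[THEN iffD2])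
qed

end
end

section \<open>Bounds on the shifted contour\<close>

text \<open>The weight \<open>(z - c)\<^sup>2 + r\<^sup>2\<close> vanishes at the two points of the circle above and below \<open>c\<close>,
  which compensates the blow-up of the bound in the right half.\<close>

lemma disc_half_bound:
  fixes G :: "complex \<Rightarrow> complex"
  assumes G: "G holomorphic_on S" and S: "cball c r \<subseteq> S" and r: "r > 0"
    and left: "\<And>w. cmod (w - c) = r \<Longrightarrow> Re w \<le> Re c \<Longrightarrow> cmod (G w) \<le> B1"
    and right: "\<And>w. cmod (w - c) = r \<Longrightarrow> Re w > Re c \<Longrightarrow> cmod (G w) \<le> B2 / (Re w - Re c)"
    and B: "B1 \<ge> 0" "B2 \<ge> 0" and x: "0 \<le> x" "x < r"
  shows "cmod (G (c + of_real x)) \<le> 2 * B1 + 2 * B2 / r"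
proof -
  let ?f = "\<lambda>w. ((w - c)\<^sup>2 + (of_real r)\<^sup>2) * G w"
  have f: "?f holomorphic_on cball c r"
    using holomorphic_on_subset[OF G S] by (intro holomorphic_intros)
  have "cmod (?f (c + of_real x)) \<le> 2 * r * r * B1 + 2 * r * B2"
  proof (rule maximum_modulus_frontier[of ?f "ball c r"])
    show "?f holomorphic_on interior (ball c r)" using f by (rule holomorphic_on_subset) auto
    show "continuous_on (closure (ball c r)) ?f"
      using r holomorphic_on_imp_continuous_on[OF f] by simp
    show "c + of_real x \<in> ball c r" using x by (simp add: dist_norm)
    fix w assume "w \<in> frontier (ball c r)"
    then have w: "cmod (w - c) = r" using r by (simp add: dist_norm norm_minus_commute)
    \<comment> \<open>On the circle \<open>r^2\<close> is \<open>w - c\<close> times its conjugate,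
      so the weight factors as \<open>(w - c) * 2 Re (w - c)\<close>: its modulus is
      \<open>2 r\<close> times the distance from the vertical line through \<open>c\<close>.\<close>
    have "(of_real r)\<^sup>2 = (w - c) * cnj (w - c)"
      unfolding w[symmetric] complex_norm_square[symmetric] by simp
    then have "(w - c)\<^sup>2 + (of_real r)\<^sup>2 = (w - c) * ((w - c) + cnj (w - c))"
      by (simp only: power2_eq_square distrib_left)
    also have "(w - c) + cnj (w - c) = of_real (2 * Re (w - c))" by (rule complex_add_cnj)
    finally have "cmod ((w - c)\<^sup>2 + (of_real r)\<^sup>2) = r * \<bar>2 * Re (w - c)\<bar>"
      by (simp only: norm_mult w norm_of_real)
    moreover have "\<bar>2 * Re (w - c)\<bar> = 2 * \<bar>Re w - Re c\<bar>" by (subst abs_mult) simp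
    ultimately have e: "cmod (?f w) = 2 * r * \<bar>Re w - Re c\<bar> * cmod (G w)"
      by (simp only: norm_mult mult_ac)
    show "norm (?f w) \<le> 2 * r * r * B1 + 2 * r * B2"
    proof (cases "Re w \<le> Re c")
      case True
      have "\<bar>Re w - Re c\<bar> \<le> r" using abs_Re_le_cmod[of "w - c"] w by simp
      then have "2 * r * \<bar>Re w - Re c\<bar> * cmod (G w) \<le> 2 * r * r * B1"
        using r B left[OF w True] by (intro mult_mono) auto
      moreover have "2 * r * B2 \<ge> 0" using r B by simp
      ultimately show ?thesis unfolding e by linarith
    next
      case False
      then have "2 * r * \<bar>Re w - Re c\<bar> * cmod (G w) \<le> 2 * r * (Re w - Re c) * (B2 / (Re w - Re c))"
        using r B right[OF w] by (intro mult_mono) auto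
      also have "\<dots> = 2 * r * B2" using False by simp
      moreover have "2 * r * r * B1 \<ge> 0" using r B by simp
      ultimately show ?thesis unfolding e by linarith
    qed
  qed simp
  \<comment> \<open>At the point of evaluation the weight equals \<open>x^2 + r^2\<close>, which is
    at least \<open>r^2\<close>.\<close>
  moreover have "cmod (?f (c + of_real x)) \<ge> r\<^sup>2 * cmod (G (c + of_real x))"
  proof -
    have "(of_real x)\<^sup>2 + (of_real r)\<^sup>2 = (of_real (x\<^sup>2 + r\<^sup>2) :: complex)" by simp
    then have "cmod ((of_real x)\<^sup>2 + (of_real r)\<^sup>2) = x\<^sup>2 + r\<^sup>2"
      by (simp only: norm_of_real) simp
    then show ?thesis by (simp add: norm_mult mult_right_mono)
  qed
  ultimately have "r\<^sup>2 * cmod (G (c + of_real x)) \<le> r\<^sup>2 * (2 * B1 + 2 * B2 / r)"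
    using r by (simp add: power2_eq_square algebra_simps)
  then show ?thesis using r by simp
qed

text \<open>The growth bound stops at \<open>Re z = \<omega>\<close> and the resolvent bound
  degenerates there. For \<open>z\<close> slightly to the right, the disc of radius \<open>r\<close>
  around the point of the line at the same height still lies to the right of the graph, and
  \<open>disc_half_bound\<close> combines the two bounds on its boundary.\<close>

lemma strip_decay:
  fixes G :: "complex \<Rightarrow> complex" and g :: "real \<Rightarrow> real"
  assumes n: "n \<ge> (1::nat)" and r: "r > 0" and gr: "\<And>s. g s < \<omega> - r"
    and hol: "G holomorphic_on {z. g (Im z) < Re z \<and> \<bar>Im z\<bar> > T1}"
    and left: "\<And>\<eta>. \<eta> > 0 \<Longrightarrow> \<exists>T. \<forall>z. \<bar>Im z\<bar> \<ge> T \<longrightarrow> g (Im z) < Re z \<longrightarrow> Re z \<le> \<omega> \<longrightarrow> cmod (G z) \<le> \<eta> * cmod z ^ (2 * n - 1)"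
    and right: "\<And>z. Re z > \<omega> \<Longrightarrow> cmod (z * G z) \<le> B / (Re z - \<omega>)" and B: "B \<ge> 0" and \<omega>: "\<omega> > 0"
    and \<eta>: "\<eta> > 0"
  shows "\<exists>T. \<forall>z. \<bar>Im z\<bar> \<ge> T \<longrightarrow> g (Im z) < Re z \<longrightarrow> Re z \<le> \<omega> + r / 2 \<longrightarrow> cmod (G z) \<le> \<eta> * cmod z ^ (2 * n - 1)"
proof -
  \<comment> \<open>The factor \<open>2 ^ (2 * n - 1)\<close> absorbs
    \<open>cmod w \<le> 2 * cmod z\<close> on the circle. Of the factor 4, one 2 comes from
    \<open>disc_half_bound\<close> and the other leaves half of \<open>\<eta>\<close> for the term
    with \<open>B\<close>.\<close>
  define \<eta>' where "\<eta>' = \<eta> / (4 * 2 ^ (2 * n - 1))"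
  have \<eta>': "\<eta>' > 0" "\<eta>' \<le> \<eta>"
  proof -
    have "1 \<le> 4 * (2::real) ^ (2 * n - 1)" using one_le_power[of "2::real" "2 * n - 1"] by linarith
    then show "\<eta>' > 0" "\<eta>' \<le> \<eta>" using \<eta> by (auto simp: \<eta>'_def divide_le_eq mult_le_cancel_left1)
  qed
  obtain T0 where T0: "\<And>z. \<bar>Im z\<bar> \<ge> T0 \<Longrightarrow> g (Im z) < Re z \<Longrightarrow> Re z \<le> \<omega> \<Longrightarrow> cmod (G z) \<le> \<eta>' * cmod z ^ (2 * n - 1)"
    using left[OF \<eta>'(1)] by blast
  \<comment> \<open>In order: the left bound applies on the circle, the disc lies where
    \<open>G\<close> is holomorphic, \<open>\<bar>Im w\<bar> \<ge> 1\<close> on the circle,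
    \<open>cmod w \<le> 2 * cmod z\<close>, and \<open>2 * B / r\<close> is at most half of the
    target.\<close>
  define T where "T = Max {T0 + r, T1 + r + 1, 1 + r, 2 * r, 4 * B / (r * \<eta>)}"
  have T: "T \<ge> T0 + r" "T \<ge> T1 + r + 1" "T \<ge> 1 + r" "T \<ge> 2 * r" "T \<ge> 4 * B / (r * \<eta>)"
    unfolding T_def by simp_all
  have "cmod (G z) \<le> \<eta> * cmod z ^ (2 * n - 1)"
    if z: "\<bar>Im z\<bar> \<ge> T" "g (Im z) < Re z" "Re z \<le> \<omega> + r / 2" for z
  proof (cases "Re z \<le> \<omega>")
    case True
    have "cmod (G z) \<le> \<eta>' * cmod z ^ (2 * n - 1)" using z T r True by (intro T0) auto
    also have "\<dots> \<le> \<eta> * cmod z ^ (2 * n - 1)" using \<eta>' by (intro mult_right_mono) auto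
    finally show ?thesis .
  next
    case False
    define c where "c = Complex \<omega> (Im z)"
    have zT: "cmod z \<ge> T" using abs_Im_le_cmod[of z] z by linarith
    have z1: "cmod z \<ge> 1" using zT T r by linarith
    have cz: "z = c + of_real (Re z - \<omega>)" by (simp add: c_def complex_eq_iff)
    have near: "\<bar>Re w - \<omega>\<bar> \<le> r" "\<bar>Im w - Im z\<bar> \<le> r" if "cmod (w - c) \<le> r" for w
      using abs_Re_le_cmod[of "w - c"] abs_Im_le_cmod[of "w - c"] that by (auto simp: c_def)
    have "cmod (G (c + of_real (Re z - \<omega>))) \<le> 2 * (\<eta>' * (2 * cmod z) ^ (2 * n - 1)) + 2 * B / r"
    proof (rule disc_half_bound[OF hol _ r])
      show "cball c r \<subseteq> {z. g (Im z) < Re z \<and> \<bar>Im z\<bar> > T1}"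
      proof
        fix w assume "w \<in> cball c r"
        then have w: "cmod (w - c) \<le> r" by (simp add: dist_norm norm_minus_commute)
        show "w \<in> {z. g (Im z) < Re z \<and> \<bar>Im z\<bar> > T1}"
          using near[OF w] gr[of "Im w"] z T r by auto
      qed
      show "0 \<le> Re z - \<omega>" "Re z - \<omega> < r" using False z r by auto
      show "0 \<le> \<eta>' * (2 * cmod z) ^ (2 * n - 1)" using \<eta>' by simp
      show "0 \<le> B" by fact
      fix w assume w: "cmod (w - c) = r"
      note nw = near[OF w[THEN eq_refl]]
      {
        assume "Re w \<le> Re c"
        then have "cmod (G w) \<le> \<eta>' * cmod w ^ (2 * n - 1)"
          using nw gr[of "Im w"] z T r by (intro T0) (auto simp: c_def)
        also have "\<dots> \<le> \<eta>' * (2 * cmod z) ^ (2 * n - 1)"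
        proof (intro mult_left_mono power_mono)
          have "cmod (w - z) \<le> cmod (w - c) + cmod (c - z)" using norm_triangle_ineq[of "w - c" "c - z"] by simp
          also have "cmod (c - z) = \<bar>Re z - \<omega>\<bar>" by (subst cz) (simp flip: of_real_diff)
          finally have "cmod (w - z) \<le> 2 * r" using w False z r by simp
          then show "cmod w \<le> 2 * cmod z" using norm_triangle_sub[of w z] T zT by linarith
        qed (use \<eta>' in auto)
        finally show "cmod (G w) \<le> \<eta>' * (2 * cmod z) ^ (2 * n - 1)" .
      }
      {
        assume "Re c < Re w"
        then have wr: "Re w > \<omega>" by (simp add: c_def)
        have "1 \<le> \<bar>Im w\<bar>" using nw z T r by linarith
        then have "1 \<le> cmod w" using abs_Im_le_cmod[of w] by linarith
        then have "cmod (G w) \<le> cmod (w * G w)" by (simp add: norm_mult mult_le_cancel_right1)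
        also have "\<dots> \<le> B / (Re w - \<omega>)" by (rule right[OF wr])
        finally show "cmod (G w) \<le> B / (Re w - Re c)" by (simp add: c_def)
      }
    qed
    then have "cmod (G z) \<le> 2 * (\<eta>' * (2 * cmod z) ^ (2 * n - 1)) + 2 * B / r" using cz by simp
    also have "2 * (\<eta>' * (2 * cmod z) ^ (2 * n - 1)) = \<eta> / 2 * cmod z ^ (2 * n - 1)"
      by (simp add: \<eta>'_def power_mult_distrib)
    also have "2 * B / r \<le> \<eta> / 2 * cmod z ^ (2 * n - 1)"
    proof -
      have "2 * B / r = \<eta> / 2 * (4 * B / (r * \<eta>))" using r \<eta> by (simp add: field_simps)
      also have "\<dots> \<le> \<eta> / 2 * cmod z" using T zT \<eta> by (intro mult_left_mono) auto
      also have "\<dots> \<le> \<eta> / 2 * cmod z ^ (2 * n - 1)"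
        using z1 n \<eta> power_increasing[of 1 "2 * n - 1" "cmod z"] by (intro mult_left_mono) auto
      finally show ?thesis .
    qed
    finally show ?thesis by simp
  qed
  then show ?thesis by blast
qed

section \<open>Integrable weights along the graph\<close>

lemma indefinite_integral_deriv:
  fixes k :: "real \<Rightarrow> real"
  assumes k: "k integrable_on {a..b}" and K: "finite K" "continuous_on ({a..b} - K) k"
    and x: "x \<in> {a<..<b} - K"
  shows "((\<lambda>u. integral {a..u} k) has_real_derivative k x) (at x)"
proof -
  have o: "open ({a<..<b} - K)" using K(1) by (intro open_Diff finite_imp_closed) auto
  have "continuous_on ({a<..<b} - K) k" by (rule continuous_on_subset[OF K(2)]) auto
  then have "isCont k x" using o x by (simp add: continuous_on_eq_continuous_at)
  then have "((\<lambda>u. integral {a..u} k) has_vector_derivative k x) (at x within {a..b} - {})"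
    using x by (intro integral_has_vector_derivative_continuous_at k)
      (auto intro: continuous_at_imp_continuous_within)
  moreover have "at x within {a..b} = at x" using x by (intro at_within_interior) auto
  ultimately show ?thesis by (simp add: has_real_derivative_iff_has_vector_derivative)
qed

text \<open>Since \<open>s \<mapsto> \<bar>h s + i s\<bar>\<close> has derivative at least \<open>1/2\<close> for large \<open>s\<close>, an integrable
  weight of the modulus stays integrable along the graph of \<open>h\<close>.\<close>

lemma graph_weight_integral:
  fixes h k :: "real \<Rightarrow> real"
  assumes h: "h piecewise_C1_differentiable_on {S0..T}"
    and H: "\<And>s. \<bar>h s\<bar> \<le> H" and hd: "\<And>s d. (h has_real_derivative d) (at s) \<Longrightarrow> \<bar>d\<bar> \<le> K"
    and K: "K \<ge> 0" and S0: "S0 \<ge> 1 + H + 2 * H * K" and T: "S0 \<le> T"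
    and k: "k integrable_on {1..}" and knn: "\<And>s. s \<ge> 1 \<Longrightarrow> k s \<ge> 0"
    and kc: "\<And>b. \<exists>N. finite N \<and> continuous_on ({1..b} - N) k"
  obtains B J N where "finite N" "(B has_integral J) {S0..T}" "J \<le> 2 * integral {1..} k"
    "\<And>s. s \<in> {S0..T} - N \<Longrightarrow> k (cmod (Complex (h s) s)) \<le> B s"
proof -
  have H0: "H \<ge> 0" using H[of 0] by linarith
  have HK: "H * K \<ge> 0" using H0 K by simp
  define r where "r s = cmod (Complex (h s) s)" for s
  have rs: "r s \<ge> s" for s using abs_Im_le_cmod[of "Complex (h s) s"] by (simp add: r_def)
  have r_le: "r s \<le> s + H" if "s \<ge> 0" for s
    using cmod_le[of "Complex (h s) s"] H[of s] that by (simp add: r_def)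
  obtain S h' where S: "finite S" and hc: "continuous_on {S0..T} h"
    and hder: "\<And>s. s \<in> {S0..T} - S \<Longrightarrow> (h has_real_derivative h' s) (at s)"
    using h unfolding piecewise_C1_differentiable_on_def C1_differentiable_on_def
      has_real_derivative_iff_has_vector_derivative by blast
  define r' where "r' s = (h s * h' s + s) / r s" for s
  have rpos: "r s > 0" if "s \<in> {S0..T}" for s using rs[of s] that S0 H0 HK by auto
  have rc: "continuous_on {S0..T} r"
    unfolding r_def Complex_eq by (intro continuous_intros hc)
  have rder: "(r has_real_derivative r' s) (at s)" if s: "s \<in> {S0..T} - S" for s
  proof -
    have req: "r = (\<lambda>s. sqrt ((h s)\<^sup>2 + s\<^sup>2))" by (simp add: r_def fun_eq_iff cmod_def)
    have pos: "(h s)\<^sup>2 + s\<^sup>2 > 0" using rpos[of s] s by (simp add: req)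
    have "((\<lambda>s. sqrt ((h s)\<^sup>2 + s\<^sup>2)) has_real_derivative
        inverse (sqrt ((h s)\<^sup>2 + s\<^sup>2)) / 2 * (2 * h s * h' s + 2 * s)) (at s)"
      using pos by (auto intro!: derivative_eq_intros hder s simp: algebra_simps)
    moreover have "inverse (sqrt ((h s)\<^sup>2 + s\<^sup>2)) / 2 * (2 * h s * h' s + 2 * s) = r' s"
    proof -
      have "inverse q / 2 * (2 * a * b + 2 * c) = (a * b + c) / q" for a b c q :: real
        by (cases "q = 0") (auto simp: field_simps)
      from this[of "sqrt ((h s)\<^sup>2 + s\<^sup>2)" "h s" "h' s" s] show ?thesis
        unfolding r'_def req .
    qed
    ultimately show ?thesis unfolding req by simp
  qed
  have r'_ge: "r' s \<ge> 1 / 2" if s: "s \<in> {S0..T} - S" for s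
  proof -
    have "\<bar>h s * h' s\<bar> \<le> H * K"
      unfolding abs_mult using H hd[OF hder[OF s]] H0 by (intro mult_mono) auto
    moreover have "r s \<le> s + H" using s S0 H0 HK by (intro r_le) auto
    \<comment> \<open>The size of \<open>S0\<close> enters here: \<open>s \<ge> H + 2 H K\<close>
      amounts to \<open>s + H \<le> 2 (s - H K)\<close>.\<close>
    ultimately have "r s \<le> 2 * (h s * h' s + s)" using s S0 by (auto simp: abs_le_iff)
    then show ?thesis unfolding r'_def using rpos[of s] s by (simp add: field_simps)
  qed
  have rmono: "r u < r v" if uv: "u \<in> {S0..T}" "v \<in> {S0..T}" "u < v" for u v
  proof -
    have i: "(r' has_integral r v - r u) {u..v}"
      by (rule fundamental_theorem_of_calculus_interior_strong[OF S])
        (use uv in \<open>auto intro!: rder continuous_on_subset[OF rc]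
           simp flip: has_real_derivative_iff_has_vector_derivative\<close>)
    define q where "q s = (if s \<in> S then 1 / 2 else r' s)" for s
    have qi: "(q has_integral r v - r u) {u..v}"
      by (rule has_integral_spike_finite[OF S _ i]) (simp add: q_def)
    have ci: "((\<lambda>_. 1 / 2 :: real) has_integral (v - u) * (1 / 2)) {u..v}"
      using has_integral_const_real[of "1/2 :: real" u v] uv by simp
    have le: "1 / 2 \<le> q s" if "s \<in> {u..v}" for s
      using r'_ge[of s] uv that by (cases "s \<in> S") (auto simp: q_def)
    have "(v - u) * (1 / 2) \<le> r v - r u" by (rule has_integral_le[OF ci qi le])
    then show ?thesis using uv by simp
  qed
  have rinj: "inj_on r {S0..T}"
  proof (rule inj_onI)
    fix u v assume "u \<in> {S0..T}" "v \<in> {S0..T}" "r u = r v"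
    then show "u = v" using rmono[of u v] rmono[of v u] by (cases u v rule: linorder_cases) auto
  qed
  define b where "b = r T + 1"
  obtain N where N: "finite N" "continuous_on ({1..b} - N) k" using kc by blast
  \<comment> \<open>Heights at which the modulus meets a discontinuity of \<open>k\<close>; they are
    finitely many because \<open>r\<close> is injective.\<close>
  define P where "P = {s \<in> {S0..T}. r s \<in> N}"
  have "P = r -` N \<inter> {S0..T}" by (auto simp: P_def)
  then have "finite P" using finite_vimage_IntI[OF N(1) rinj] by simp
  then have SP: "finite (S \<union> P)" using S by simp
  have kb: "k integrable_on {1..u}" for u
    by (rule integrable_on_subinterval[OF k]) auto
  define \<Phi> where "\<Phi> u = integral {1..u} k" for u
  have \<Phi>: "0 \<le> \<Phi> u" "\<Phi> u \<le> integral {1..} k" for u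
    unfolding \<Phi>_def using knn k kb by (auto intro!: integral_nonneg integral_subset_le)
  have rb: "r s \<in> {1<..<b}" if "s \<in> {S0<..<T}" for s
    using rmono[of s T] rs[of s] that T S0 H0 HK by (auto simp: b_def)
  have rb': "r s \<in> {1..b}" if "s \<in> {S0..T}" for s
    using rmono[of s T] rs[of s] that T S0 H0 HK by (cases "s = T") (auto simp: b_def)
  let ?B = "\<lambda>s. k (r s) * r' s"
  \<comment> \<open>Substitution of the modulus for the height, as the chain rule for
    \<open>\<Phi>\<close>. The result is a difference of partial integrals of \<open>k\<close>,
    hence at most the full one.\<close>
  have int: "(?B has_integral \<Phi> (r T) - \<Phi> (r S0)) {S0..T}"
  proof (rule fundamental_theorem_of_calculus_interior_strong[OF SP T])
    have "continuous_on {1..b} \<Phi>" unfolding \<Phi>_def by (rule indefinite_integral_continuous_1[OF kb])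
    then show "continuous_on {S0..T} (\<lambda>s. \<Phi> (r s))"
      by (rule continuous_on_compose2[OF _ rc]) (use rb' in auto)
    fix s assume s: "s \<in> {S0<..<T} - (S \<union> P)"
    have "(\<Phi> has_real_derivative k (r s)) (at (r s))"
      unfolding \<Phi>_def by (rule indefinite_integral_deriv[OF kb N]) (use s rb[of s] in \<open>auto simp: P_def\<close>)
    from DERIV_chain2[OF this rder[of s]]
    have "((\<lambda>s. \<Phi> (r s)) has_real_derivative k (r s) * r' s) (at s)" using s by simp
    then show "((\<lambda>s. \<Phi> (r s)) has_vector_derivative k (r s) * r' s) (at s)"
      by (simp add: has_real_derivative_iff_has_vector_derivative)
  qed
  show ?thesis
  proof (rule that[OF S has_integral_mult_right[OF int, of 2]])
    show "2 * (\<Phi> (r T) - \<Phi> (r S0)) \<le> 2 * integral {1..} k" using \<Phi>(1)[of "r S0"] \<Phi>(2)[of "r T"] by simp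
    fix s assume s: "s \<in> {S0..T} - S"
    have "k (r s) * 1 \<le> k (r s) * (2 * r' s)"
      using r'_ge[OF s] rb'[of s] s by (intro mult_left_mono knn) auto
    then show "k (cmod (Complex (h s) s)) \<le> 2 * (k (r s) * r' s)" by (simp add: r_def)
  qed
qed

section \<open>Uniform bounds for holomorphic operator families\<close>

text \<open>The error in the definition of the derivative is measured against \<open>norm x\<close>,
  so near \<open>z\<close> the family is a perturbation of \<open>R z\<close> controlled by one
  constant for all \<open>x\<close>.\<close>

lemma cf_clhol_locally_bounded:
  assumes Q: "\<And>n. cf_clin (Q n)" and R: "cf_clhol \<iota> Q S R" and z: "z \<in> S"
  obtains d K where "d > 0" "\<And>w x. cmod (w - z) < d \<Longrightarrow> x \<in> cf_Xinf \<iota> Q \<Longrightarrow> norm (Q i (R w x)) \<le> K * norm x"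
proof -
  obtain F where RC: "cf_CL \<iota> Q (R z)" and FC: "cf_CL \<iota> Q F" and F: "\<forall>n. \<forall>e>0. \<exists>d>0. \<forall>w. 0 < cmod (w - z) \<and> cmod (w - z) < d \<longrightarrow>
        (\<forall>x\<in>cf_Xinf \<iota> Q. norm (Q n (R w x - R z x - cscale (w - z) (F x))) \<le> e * cmod (w - z) * norm x)"
    using bspec[OF R[unfolded cf_clhol_def] z] by (elim conjE exE)
  obtain K1 where K1: "\<And>x. x \<in> cf_Xinf \<iota> Q \<Longrightarrow> norm (Q i (R z x)) \<le> K1 * norm x"
    using RC unfolding cf_CL_def by blast
  obtain K2 where K2: "\<And>x. x \<in> cf_Xinf \<iota> Q \<Longrightarrow> norm (Q i (F x)) \<le> K2 * norm x"
    using FC unfolding cf_CL_def by blast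
  obtain d where d: "d > 0" "\<And>w x. 0 < cmod (w - z) \<Longrightarrow> cmod (w - z) < d \<Longrightarrow> x \<in> cf_Xinf \<iota> Q \<Longrightarrow>
        norm (Q i (R w x - R z x - cscale (w - z) (F x))) \<le> 1 * cmod (w - z) * norm x"
    using F[rule_format, of 1 i] by auto
  have "norm (Q i (R w x)) \<le> (\<bar>K1\<bar> + \<bar>K2\<bar> * d + d) * norm x"
    if w: "cmod (w - z) < d" and x: "x \<in> cf_Xinf \<iota> Q" for w x
  proof (cases "w = z")
    case True
    have "norm (Q i (R w x)) \<le> K1 * norm x" using K1[OF x] True by simp
    also have "\<dots> \<le> (\<bar>K1\<bar> + \<bar>K2\<bar> * d + d) * norm x"
    proof (intro mult_right_mono)
      have "0 \<le> \<bar>K2\<bar> * d" using d(1) by simp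
      then show "K1 \<le> \<bar>K1\<bar> + \<bar>K2\<bar> * d + d" using d(1) by linarith
    qed simp
    finally show ?thesis .
  next
    case False
    have "R w x = (R w x - R z x - cscale (w - z) (F x)) + (R z x + cscale (w - z) (F x))" by simp
    then have "Q i (R w x) = Q i (R w x - R z x - cscale (w - z) (F x)) + (Q i (R z x) + cscale (w - z) (Q i (F x)))"
      using Q[of i] unfolding cf_clin_def by metis
    then have "norm (Q i (R w x)) \<le> norm (Q i (R w x - R z x - cscale (w - z) (F x)))
        + (norm (Q i (R z x)) + norm (cscale (w - z) (Q i (F x))))"
      by (metis norm_triangle_ineq norm_triangle_mono order_refl)
    also have "\<dots> \<le> d * norm x + (\<bar>K1\<bar> * norm x + d * (\<bar>K2\<bar> * norm x))"
    proof (intro add_mono)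
      show "norm (Q i (R w x - R z x - cscale (w - z) (F x))) \<le> d * norm x"
        using d(2)[OF _ w x] w False by (simp add: order_trans[OF _ mult_right_mono])
      show "norm (Q i (R z x)) \<le> \<bar>K1\<bar> * norm x"
        using K1[OF x] by (rule order_trans) (simp add: mult_right_mono)
      have "norm (Q i (F x)) \<le> \<bar>K2\<bar> * norm x"
        using K2[OF x] by (rule order_trans) (simp add: mult_right_mono)
      then show "norm (cscale (w - z) (Q i (F x))) \<le> d * (\<bar>K2\<bar> * norm x)"
        unfolding norm_cscale using w d(1) by (intro mult_mono) auto
    qed
    finally show ?thesis by (simp add: algebra_simps)
  qed
  then show ?thesis using d(1) that by blast
qed

text \<open>Serves the part of the graph at heights up to those of the poles, where the growth
  hypotheses are silent; the constant has to be independent of \<open>x\<close>.\<close>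

lemma cf_clhol_bounded_on_compact:
  assumes Q: "\<And>n. cf_clin (Q n)" and R: "cf_clhol \<iota> Q S R" and C: "compact C" "C \<subseteq> S"
  obtains K where "K \<ge> 0" "\<And>w x. w \<in> C \<Longrightarrow> x \<in> cf_Xinf \<iota> Q \<Longrightarrow> norm (Q i (R w x)) \<le> K * norm x"
proof -
  have "\<forall>z\<in>C. \<exists>d K. d > 0 \<and> (\<forall>w x. cmod (w - z) < d \<longrightarrow> x \<in> cf_Xinf \<iota> Q \<longrightarrow> norm (Q i (R w x)) \<le> K * norm x)"
  proof
    fix z assume "z \<in> C"
    then have "z \<in> S" using C(2) by blast
    from cf_clhol_locally_bounded[OF Q R this, of i]
    obtain d K where "d > 0"
      "\<And>w x. cmod (w - z) < d \<Longrightarrow> x \<in> cf_Xinf \<iota> Q \<Longrightarrow> norm (Q i (R w x)) \<le> K * norm x"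
      by blast
    then show "\<exists>d K. d > 0 \<and> (\<forall>w x. cmod (w - z) < d \<longrightarrow> x \<in> cf_Xinf \<iota> Q \<longrightarrow> norm (Q i (R w x)) \<le> K * norm x)"
      by (intro exI[of _ d] exI[of _ K] conjI allI impI)
  qed
  then obtain d K where dK: "\<And>z. z \<in> C \<Longrightarrow> d z > (0::real)"
    "\<And>z w x. z \<in> C \<Longrightarrow> cmod (w - z) < d z \<Longrightarrow> x \<in> cf_Xinf \<iota> Q \<Longrightarrow> norm (Q i (R w x)) \<le> K z * norm x"
    by metis
  have "C \<subseteq> (\<Union>z\<in>C. ball z (d z))"
  proof
    fix z assume "z \<in> C"
    then show "z \<in> (\<Union>z\<in>C. ball z (d z))" using dK(1)[of z] by (intro UN_I[of z]) auto
  qed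
  then obtain F where F: "F \<subseteq> C" "finite F" "C \<subseteq> (\<Union>z\<in>F. ball z (d z))"
    by (rule compactE_image[OF C(1) open_ball])
  have "norm (Q i (R w x)) \<le> (\<Sum>z\<in>F. \<bar>K z\<bar>) * norm x" if w: "w \<in> C" and x: "x \<in> cf_Xinf \<iota> Q" for w x
  proof -
    obtain z where z: "z \<in> F" "w \<in> ball z (d z)" using F(3) w by blast
    then have "norm (Q i (R w x)) \<le> K z * norm x"
      using F(1) by (intro dK(2) x) (auto simp: dist_norm norm_minus_commute)
    also have "\<dots> \<le> (\<Sum>z\<in>F. \<bar>K z\<bar>) * norm x"
      using member_le_sum[of z F "\<lambda>z. \<bar>K z\<bar>"] z F(2) by (intro mult_right_mono) auto
    finally show ?thesis .
  qed
  then show ?thesis by (intro that[of "\<Sum>z\<in>F. \<bar>K z\<bar>"]) (auto intro: sum_nonneg)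
qed

text \<open>The residue identity at height \<open>T\<close>, with \<open>T\<close> tending to
  infinity. The horizontal sides have length at most \<open>a - b\<close> and the integrand on them
  falls below any \<open>\<eta>\<close>, so only the bound \<open>J\<close> for the graph
  survives.\<close>

lemma contour_shift_bound:
  fixes f :: "complex \<Rightarrow> complex" and g h :: "real \<Rightarrow> real"
  assumes g: "continuous_on UNIV g" and h: "pw_C1 h" and gh: "\<And>s. g s < h s" and ha: "\<And>s. h s < a"
    and hb: "\<And>s. b \<le> h s" and S: "finite S" and f: "f holomorphic_on {z. g (Im z) < Re z} - S"
    and SI: "\<And>p. p \<in> S \<Longrightarrow> h (Im p) < Re p \<and> Re p < a"
    and vert: "((\<lambda>T. contour_integral (linepath (Complex a (- T)) (Complex a T)) f) \<longlongrightarrow> 2 * pi * \<i> * v) at_top"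
    and decay: "\<And>\<eta>. \<eta> > 0 \<Longrightarrow> \<exists>T. \<forall>z. \<bar>Im z\<bar> \<ge> T \<longrightarrow> g (Im z) < Re z \<longrightarrow> Re z \<le> a \<longrightarrow> cmod (f z) \<le> \<eta>"
    and graph: "\<And>T. T > S0 \<Longrightarrow> f contour_integrable_on graph_path h T \<Longrightarrow> cmod (contour_integral (graph_path h T) f) \<le> J"
  shows "cmod (v - (\<Sum>p\<in>S. residue f p)) \<le> J / (2 * pi)"
proof -
  let ?R = "2 * pi * \<i> * (\<Sum>p\<in>S. residue f p)"
  let ?line = "\<lambda>T. linepath (Complex a (- T)) (Complex a T)"
  have ab: "a - b > 0" using ha[of 0] hb[of 0] by linarith
  have main: "cmod (2 * pi * \<i> * v - ?R) \<le> J + 2 * (\<eta> * (a - b))" if \<eta>: "\<eta> > 0" for \<eta>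
  proof (rule tendsto_upperbound)
    show "((\<lambda>T. cmod (contour_integral (?line T) f - ?R)) \<longlongrightarrow> cmod (2 * pi * \<i> * v - ?R)) at_top"
      by (intro tendsto_intros vert)
    obtain T0 where T0: "\<And>z. \<bar>Im z\<bar> \<ge> T0 \<Longrightarrow> g (Im z) < Re z \<Longrightarrow> Re z \<le> a \<Longrightarrow> cmod (f z) \<le> \<eta>"
      using decay[OF \<eta>] by blast
    have bnd: "cmod (contour_integral (?line T) f - ?R) \<le> J + 2 * (\<eta> * (a - b))"
      if T: "T > T0" "T > 0" "T > S0" "T > Max (insert 0 ((\<lambda>p. \<bar>Im p\<bar>) ` S))" for T
    proof -
      have TS: "\<bar>Im p\<bar> < T" if "p \<in> S" for p
        using T(4) S that by (meson Max_ge finite_imageI finite_insert imageI insertI2 order_le_less_trans)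
      have side: "cmod (contour_integral (linepath u w) f) \<le> \<eta> * (a - b)"
        if "closed_segment u w \<subseteq> {z. \<bar>Im z\<bar> = T \<and> h (Im z) \<le> Re z \<and> Re z \<le> a}" "cmod (w - u) \<le> a - b" for u w
      proof -
        have sub: "closed_segment u w \<subseteq> {z. g (Im z) < Re z} - S"
          using that(1) gh TS by (fastforce intro: order_less_le_trans)
        have "f contour_integrable_on linepath u w"
          by (intro contour_integrable_continuous_linepath holomorphic_on_imp_continuous_on holomorphic_on_subset[OF f] sub)
        then have "cmod (contour_integral (linepath u w) f) \<le> \<eta> * cmod (w - u)"
        proof (rule contour_integral_bound_linepath)
          fix z assume "z \<in> closed_segment u w"
          then have "\<bar>Im z\<bar> = T" "h (Im z) \<le> Re z" "Re z \<le> a" using that(1) by auto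
          then show "cmod (f z) \<le> \<eta>" using gh[of "Im z"] T by (intro T0) auto
        qed (use \<eta> in simp)
        also have "\<dots> \<le> \<eta> * (a - b)" using that(2) \<eta> by (intro mult_left_mono) auto
        finally show ?thesis .
      qed
      have hT: "h piecewise_C1_differentiable_on {-T..T}" using h by (simp add: pw_C1_def)
      note gr = graph_rectangle_residues[OF g T(2) hT gh ha S f]
      have eq: "contour_integral (linepath (Complex (h (- T)) (- T)) (Complex a (- T))) f
         + contour_integral (?line T) f
         + contour_integral (linepath (Complex a T) (Complex (h T) T)) f
         - contour_integral (graph_path h T) f = ?R"
        and int: "f contour_integrable_on graph_path h T"
        by (rule gr; use SI TS in blast)+
      have s1: "cmod (contour_integral (linepath (Complex (h (- T)) (- T)) (Complex a (- T))) f) \<le> \<eta> * (a - b)"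
        using ha[of "-T"] hb[of "-T"] T
        by (intro side) (auto simp: closed_segment_same_Im closed_segment_eq_real_ivl cmod_def)
      have s2: "cmod (contour_integral (linepath (Complex a T) (Complex (h T) T)) f) \<le> \<eta> * (a - b)"
        using ha[of T] hb[of T] T
        by (intro side) (auto simp: closed_segment_same_Im closed_segment_eq_real_ivl cmod_def)
      have s3: "cmod (contour_integral (graph_path h T) f) \<le> J" by (rule graph[OF T(3) int])
      have "cmod (y - R) \<le> J + 2 * e" if "x + y + z - w = R" "cmod x \<le> e" "cmod z \<le> e" "cmod w \<le> J"
        for x y z w R :: complex and e
      proof -
        have "y - R = w - x - z" unfolding that(1)[symmetric] by simp
        then have "cmod (y - R) \<le> cmod (w - x) + cmod z" by (simp only: norm_triangle_ineq4)
        then show ?thesis using norm_triangle_ineq4[of w x] that by linarith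
      qed
      from this[OF eq s1 s2 s3] show ?thesis .
    qed
    show "\<forall>\<^sub>F T in at_top. cmod (contour_integral (?line T) f - ?R) \<le> J + 2 * (\<eta> * (a - b))"
      using eventually_gt_at_top[of T0] eventually_gt_at_top[of 0] eventually_gt_at_top[of S0]
        eventually_gt_at_top[of "Max (insert 0 ((\<lambda>p. \<bar>Im p\<bar>) ` S))"]
      by eventually_elim (rule bnd)
  qed simp
  have "cmod (2 * pi * \<i> * v - ?R) \<le> J"
  proof (rule field_le_epsilon)
    fix e :: real assume "e > 0"
    then have "e / (2 * (a - b)) > 0" using ab by simp
    from main[OF this] have "cmod (2 * pi * \<i> * v - ?R) \<le> J + 2 * (e / (2 * (a - b)) * (a - b))" .
    moreover have "2 * (e / (2 * d) * d) = e" if "d > 0" for d using that by simp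
    from this[OF ab] have "2 * (e / (2 * (a - b)) * (a - b)) = e" .
    ultimately show "cmod (2 * pi * \<i> * v - ?R) \<le> J + e" by (simp only:)
  qed
  moreover have "2 * pi * \<i> * v - ?R = (2 * pi * \<i>) * (v - (\<Sum>p\<in>S. residue f p))"
    by (simp add: right_diff_distrib)
  ultimately have "2 * pi * cmod (v - (\<Sum>p\<in>S. residue f p)) \<le> J"
    by (simp add: norm_mult)
  then show ?thesis by (simp add: field_simps)
qed

text \<open>Above the band \<open>\<bar>s\<bar> \<le> S0\<close> the weight is integrated directly,
  below it after the reflection \<open>s \<mapsto> - s\<close>, which keeps the modulus; on the band
  a constant is used. Each tail contributes \<open>2 * c\<close> times the full integral.\<close>

lemma graph_weight_two_sided:
  fixes h k :: "real \<Rightarrow> real"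
  assumes h: "pw_C1 h"
    and H: "\<And>s. \<bar>h s\<bar> \<le> H" and hd: "\<And>s d. (h has_real_derivative d) (at s) \<Longrightarrow> \<bar>d\<bar> \<le> K"
    and K: "K \<ge> 0" and S0: "S0 \<ge> 1 + H + 2 * H * K" and c: "c \<ge> 0"
    and k: "k integrable_on {1..}" and knn: "\<And>s. s \<ge> 1 \<Longrightarrow> k s \<ge> 0"
    and kc: "\<And>b. \<exists>N. finite N \<and> continuous_on ({1..b} - N) k"
    and T: "T > S0"
  shows "\<exists>B J N. finite N \<and> (B has_integral J) {-T..T} \<and> J \<le> 4 * c * integral {1..} k + 2 * S0 * Kc
    \<and> (\<forall>s\<in>{-T..T} - N. (if \<bar>s\<bar> \<le> S0 then Kc else c * k (cmod (Complex (h s) s))) \<le> B s)"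
proof -
  have H0: "H \<ge> 0" using H[of 0] by linarith
  have S0pos: "S0 \<ge> 1" using S0 H0 mult_nonneg_nonneg[OF H0 K] by linarith
  have hp: "h piecewise_C1_differentiable_on {a..b}" for a b using h by (simp add: pw_C1_def)
  have hm: "(\<lambda>s. h (- s)) piecewise_C1_differentiable_on {S0..T}"
  proof -
    have "(\<lambda>s. - s) piecewise_C1_differentiable_on {S0..T}"
      by (intro C1_differentiable_imp_piecewise) auto
    moreover have "h piecewise_C1_differentiable_on (\<lambda>s. - s) ` {S0..T}" using hp by simp
    moreover have "finite ({S0..T} \<inter> (\<lambda>s. - s) -` {x})" for x
      by (rule finite_subset[of _ "{- x}"]) auto
    ultimately have "(h \<circ> (\<lambda>s. - s)) piecewise_C1_differentiable_on {S0..T}"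
      by (rule piecewise_C1_differentiable_compose)
    then show ?thesis by (simp add: o_def)
  qed
  have hmd: "\<bar>d\<bar> \<le> K" if "((\<lambda>s. h (- s)) has_real_derivative d) (at s)" for s d
  proof -
    have "((\<lambda>s. h (- (- s))) has_real_derivative d * (- 1)) (at (- s))"
      by (rule DERIV_chain2[where f = "\<lambda>s. h (- s)"]) (use that in \<open>auto intro!: derivative_eq_intros\<close>)
    then show ?thesis using hd[of "d * -1" "- s"] by simp
  qed
  have "\<exists>B J N. finite N \<and> (B has_integral J) {S0..T} \<and> J \<le> 2 * integral {1..} k \<and>
      (\<forall>s\<in>{S0..T} - N. k (cmod (Complex (h s) s)) \<le> B s)"
    by (rule graph_weight_integral[of h S0 T H K k])
      (fact hp H hd K S0 less_imp_le[OF T] k knn kc | blast)+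
  then obtain B1 J1 N1 where 1: "finite N1" "(B1 has_integral J1) {S0..T}" "J1 \<le> 2 * integral {1..} k"
    "\<And>s. s \<in> {S0..T} - N1 \<Longrightarrow> k (cmod (Complex (h s) s)) \<le> B1 s"
    by blast
  have "\<exists>B J N. finite N \<and> (B has_integral J) {S0..T} \<and> J \<le> 2 * integral {1..} k \<and>
      (\<forall>s\<in>{S0..T} - N. k (cmod (Complex (h (- s)) s)) \<le> B s)"
    by (rule graph_weight_integral[of "\<lambda>s. h (- s)" S0 T H K k])
      (fact hm H hmd K S0 less_imp_le[OF T] k knn kc | blast)+
  then obtain B2 J2 N2 where 2: "finite N2" "(B2 has_integral J2) {S0..T}" "J2 \<le> 2 * integral {1..} k"
    "\<And>s. s \<in> {S0..T} - N2 \<Longrightarrow> k (cmod (Complex (h (- s)) s)) \<le> B2 s"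
    by blast
  define B where "B s = (if \<bar>s\<bar> \<le> S0 then Kc else if s > 0 then c * B1 s else c * B2 (- s))" for s
  have i1: "(B has_integral c * J1) {S0..T}"
    by (rule has_integral_spike_finite[of "{S0}" _ _ "\<lambda>s. c * B1 s"])
      (use S0pos in \<open>auto simp: B_def intro: has_integral_mult_right[OF 1(2)]\<close>)
  have i2: "(B has_integral c * J2) {-T..-S0}"
  proof (rule has_integral_spike_finite[of "{-S0}" _ _ "\<lambda>s. c * B2 (- s)"])
    have "((\<lambda>s. B2 (- s)) has_integral J2) {-T..-S0}"
      using 2(2) by (simp add: has_integral_reflect_real)
    then show "((\<lambda>s. c * B2 (- s)) has_integral c * J2) {-T..-S0}" by (rule has_integral_mult_right)
  qed (use S0pos in \<open>auto simp: B_def\<close>)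
  have i3: "(B has_integral 2 * S0 * Kc) {-S0..S0}"
  proof (rule has_integral_spike_finite[of "{}" _ _ "\<lambda>_. Kc"])
    show "((\<lambda>_. Kc) has_integral 2 * S0 * Kc) {-S0..S0}"
      using has_integral_const_real[of Kc "-S0" S0] S0pos by simp
  qed (auto simp: B_def)
  have "(B has_integral c * J2 + 2 * S0 * Kc) {-T..S0}"
    by (rule has_integral_combine[OF _ _ i2 i3]) (use T S0pos in auto)
  then have i: "(B has_integral c * J2 + 2 * S0 * Kc + c * J1) {-T..T}"
    by (rule has_integral_combine[OF _ _ _ i1, rotated 2]) (use T S0pos in auto)
  show ?thesis
  proof (intro exI[of _ B] exI[of _ "c * J2 + 2 * S0 * Kc + c * J1"] exI[of _ "N1 \<union> uminus ` N2"] conjI ballI i)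
    show "finite (N1 \<union> uminus ` N2)" using 1(1) 2(1) by simp
    have "c * J1 \<le> c * (2 * integral {1..} k)" "c * J2 \<le> c * (2 * integral {1..} k)"
      using c 1(3) 2(3) by (auto intro: mult_left_mono)
    then show "c * J2 + 2 * S0 * Kc + c * J1 \<le> 4 * c * integral {1..} k + 2 * S0 * Kc" by simp
    fix s assume s: "s \<in> {-T..T} - (N1 \<union> uminus ` N2)"
    show "(if \<bar>s\<bar> \<le> S0 then Kc else c * k (cmod (Complex (h s) s))) \<le> B s"
    proof (cases "\<bar>s\<bar> \<le> S0")
      case False
      show ?thesis
      proof (cases "s > 0")
        case True
        then show ?thesis using False s 1(4)[of s] c by (auto simp: B_def intro!: mult_left_mono)
      next
        case neg: False
        have "- s \<notin> N2" using s by (metis Diff_iff UnI2 image_eqI minus_minus)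
        then have "k (cmod (Complex (h (- (- s))) (- s))) \<le> B2 (- s)"
          using False s neg by (intro 2(4)) auto
        moreover have "cmod (Complex (h (- (- s))) (- s)) = cmod (Complex (h s) s)" by (simp add: cmod_def)
        ultimately show ?thesis using False neg c by (auto simp: B_def intro!: mult_left_mono)
      qed
    qed (simp add: B_def)
  qed
qed

text \<open>The integrands differ by the exponential times a polynomial in odd powers of
  \<open>1 / z\<close>. This difference is holomorphic off 0, and its residue at 0 is the Taylor
  polynomial.\<close>

lemma residue_power_shift:
  fixes I J :: "complex \<Rightarrow> complex" and t :: complex
  assumes \<Omega>: "open \<Omega>" and P: "finite P" and p: "p \<in> \<Omega>" and J: "J holomorphic_on \<Omega> - P"
    and I: "\<And>z. z \<in> \<Omega> - P \<Longrightarrow> z \<noteq> 0 \<Longrightarrow>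
      J z = I z + exp (z * t) * (\<Sum>\<alpha><n. c \<alpha> * inverse (z ^ Suc (2 * \<alpha>)))"
  shows "residue I p = residue J p - (if p = 0 then \<Sum>\<alpha><n. c \<alpha> * t ^ (2 * \<alpha>) / fact (2 * \<alpha>) else 0)"
proof -
  \<comment> \<open>A neighbourhood of \<open>p\<close> from which 0 and the other poles are
    removed; \<open>p\<close> itself stays, as it may be 0, a pole, or both.\<close>
  define U where "U = \<Omega> - (insert 0 P - {p})"
  let ?e = "\<lambda>z. \<Sum>\<alpha><n. exp (z * t) * (c \<alpha> * inverse (z ^ Suc (2 * \<alpha>)))"
  have U: "open U" "p \<in> U" using \<Omega> P p by (auto simp: U_def intro: open_Diff finite_imp_closed)
  have Ih: "J z - ?e z = I z" if "z \<in> U - {p}" for z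
    using I[of z] that by (auto simp: U_def sum_distrib_left)
  have Jh: "J holomorphic_on U - {p}" using J by (rule holomorphic_on_subset) (auto simp: U_def)
  have eh: "(\<lambda>z. exp (z * t) * (c \<alpha> * inverse (z ^ Suc (2 * \<alpha>)))) holomorphic_on U - {p}" for \<alpha>
    by (intro holomorphic_intros) (auto simp: U_def)
  have "residue I p = residue (\<lambda>z. J z - ?e z) p"
  proof (rule residue_cong)
    have "\<forall>\<^sub>F z in at p. z \<in> U - {p}" using eventually_at_in_open[OF U] by simp
    then show "\<forall>\<^sub>F z in at p. I z = J z - ?e z" by eventually_elim (simp only: Ih)
  qed simp
  also have "\<dots> = residue J p - residue ?e p"
    by (intro residue_diff[OF U Jh] holomorphic_on_sum eh)
  also have "residue ?e p = (if p = 0 then \<Sum>\<alpha><n. c \<alpha> * t ^ (2 * \<alpha>) / fact (2 * \<alpha>) else 0)"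
  proof (cases "p = 0")
    case True
    have "residue ?e 0 = (\<Sum>\<alpha><n. residue (\<lambda>z. exp (z * t) * (c \<alpha> * inverse (z ^ Suc (2 * \<alpha>)))) 0)"
      using U eh True by (intro residue_sum[of U]) auto
    then show ?thesis unfolding residue_exp_over_power using True by simp
  next
    case False
    have "?e holomorphic_on U" using False by (intro holomorphic_intros) (auto simp: U_def)
    then show ?thesis using False residue_holo[OF U] by simp
  qed
  finally show ?thesis .
qed

section \<open>The remainder estimate\<close>

lemma pw_C1_continuous:
  assumes "pw_C1 g"
  shows "continuous_on UNIV g"
proof -
  have "continuous_on (\<Union>k\<in>UNIV. {- real k<..<real k}) g"
  proof (rule continuous_on_open_UN)
    fix k :: nat
    have "continuous_on {- real k..real k} g"
      using assms by (simp add: pw_C1_def piecewise_C1_differentiable_on_def)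
    then show "continuous_on {- real k<..<real k} g" by (rule continuous_on_subset) auto
  qed auto
  moreover have "(\<Union>k\<in>UNIV. {- real k<..<real k}) = UNIV"
  proof -
    have "\<exists>k. x \<in> {- real k<..<real k}" for x :: real
    proof -
      obtain k :: nat where "\<bar>x\<bar> < real k" using reals_Archimedean2 by blast
      then show ?thesis by (intro exI[of _ k]) auto
    qed
    then show ?thesis by blast
  qed
  ultimately show ?thesis by simp
qed

theorem theorem4p31:
  fixes C :: "real \<Rightarrow> 'x::cf_cbanach \<Rightarrow> 'x" and D :: "'x set" and A :: "'x \<Rightarrow> 'x"
    and M \<omega> :: real
    and R0 :: "complex \<Rightarrow> 'x \<Rightarrow> 'x"
    and g0 :: "real \<Rightarrow> real" and \<mu> :: "nat \<Rightarrow> complex" and m :: nat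
    and h1 h2 :: "real \<Rightarrow> real" and n0 :: nat
    and \<iota> :: "'x \<Rightarrow> 'y::cf_cvec" and Q :: "nat \<Rightarrow> 'y \<Rightarrow> 'x"
    and \<delta>0 :: real and gs :: "real \<Rightarrow> real"
    and Rinf :: "complex \<Rightarrow> 'x \<Rightarrow> 'y" and \<nu> :: "nat \<Rightarrow> complex" and p :: nat
    and ht1 ht2 :: "nat \<Rightarrow> nat \<Rightarrow> real \<Rightarrow> real" and ns :: nat
    and n :: nat and \<epsilon> :: real
    and E :: "real \<Rightarrow> 'x \<Rightarrow> 'y"
  defines "\<Omega>0 \<equiv> {z. Re z > g0 (Im z)}"
    and "\<Omega>s \<equiv> {z. Re z > gs (Im z)}"
    and "E \<equiv> (\<lambda>t x. \<iota> (C t x)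
          - (\<Sum>k<m. \<iota> (cf_xres (\<lambda>z. cscale (z * exp (z * complex_of_real t)) (R0 z x)) (\<mu> k)))
          - (\<Sum>l<p. cf_yres Q (\<lambda>z. cscale (z * exp (z * complex_of_real t)) (Rinf z x)) (\<nu> l))
          - (if gs 0 \<ge> 0
             then (\<Sum>\<alpha><n. cscale (complex_of_real (t ^ (2 * \<alpha>) / fact (2 * \<alpha>))) (\<iota> ((A ^^ \<alpha>) x)))
             else 0))"
  \<comment> \<open>cosine family and its generator\<close>
  assumes cos: "cosine_family C" and gen: "cos_generator C D A"
    and M_ge: "M \<ge> 1" and \<omega>_pos: "\<omega> > 0"
    and C_bound: "\<forall>t x. norm (C t x) \<le> M * exp (\<omega> * \<bar>t\<bar>) * norm x"
  \<comment> \<open>Hypothesis (H)\<close>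
    and g0_pw: "pw_C1 g0" and g0_bdd: "bdd_above (range g0)" and g0_sup: "Sup (range g0) < \<omega>"
    and R0_res: "\<forall>z. Re z > \<omega> \<longrightarrow> cf_res_inv D A (z\<^sup>2) (R0 z)"
    and R0_hol: "cf_ophol (\<Omega>0 - \<mu> ` {..<m}) R0"
    and \<mu>_inj: "inj_on \<mu> {..<m}"
    and \<mu>_sing: "\<forall>k<m. \<mu> k \<in> \<Omega>0 \<and> Re (\<mu> k) \<le> \<omega> \<and> cf_op_fin_merom_at R0 (\<mu> k) \<and> cf_op_singular_at R0 (\<mu> k)"
    and R0_bound: "\<forall>z\<in>\<Omega>0. Re z \<le> \<omega> \<and> (\<forall>k<m. \<bar>Im z\<bar> > \<bar>Im (\<mu> k)\<bar>) \<longrightarrow>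
                    (\<forall>x. norm (R0 z x) \<le> h1 (cmod z) * h2 (Re z) * norm x)"
    and n0_pos: "n0 \<ge> 1"
    and h1_lim: "((\<lambda>s. h1 s / s powr (2 * real n0 - 1)) \<longlongrightarrow> 0) at_top"
    and h2_bdd: "\<forall>K. compact K \<longrightarrow> bounded (h2 ` K)"
  \<comment> \<open>Hypothesis (Q)\<close>
    and \<iota>_lin: "cf_clin \<iota>" and \<iota>_inj: "inj \<iota>"
    and Q_lin: "\<forall>k. cf_clin (Q k)" and Y_frechet: "cf_frechet Q"
    and Q1: "\<forall>k. \<exists>K. \<forall>x. norm (Q k (\<iota> x)) \<le> K * norm x"
    and Q2: "\<forall>x. (\<lambda>k. Q k (\<iota> x)) \<longlonglongrightarrow> x"
    and Q3: "\<forall>i k y. k \<ge> i + 1 \<longrightarrow> Q i (\<iota> (Q k y)) = Q i y \<and> Q k (\<iota> (Q i y)) = Q i y"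
    and Q4a: "\<forall>k x. x \<in> D \<longrightarrow> Q k (\<iota> x) \<in> D"
    and Q4b: "\<forall>k f. f \<in> cf_dom_adj D A \<longrightarrow> (\<lambda>x. f (Q k (\<iota> x))) \<in> cf_dom_adj D A"
    and Q5: "\<forall>k x. x \<in> D \<and> Q k (\<iota> x) = x \<longrightarrow> Q k (\<iota> (A x)) = A x"
    and Q6: "\<forall>i k x. k \<ge> i + 1 \<and> x \<in> D \<longrightarrow> Q i (\<iota> (A (Q k (\<iota> x)))) = Q i (\<iota> (A x))"
    and Q7: "\<forall>k. cf_Q7 \<iota> Q D A k"
  \<comment> \<open>Hypothesis (H-ext)\<close>
    and \<delta>0_pos: "\<delta>0 > 0" and gs_pw: "pw_C1 gs" and gs_le: "\<forall>s. gs s + \<delta>0 \<le> g0 s"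
    and Rinf_hol: "cf_clhol \<iota> Q (\<Omega>s - (\<mu> ` {..<m} \<union> \<nu> ` {..<p})) Rinf"
    and Rinf_ext: "\<forall>z\<in>\<Omega>0 - \<mu> ` {..<m}. \<forall>x\<in>cf_Xinf \<iota> Q. Rinf z x = \<iota> (R0 z x)"
    and \<nu>_inj: "inj_on \<nu> {..<p}"
    and \<nu>_sing: "\<forall>l<p. \<nu> l \<in> \<Omega>s - \<Omega>0 \<and> cf_cl_fin_merom_at \<iota> Q Rinf (\<nu> l) \<and> cf_cl_singular_at \<iota> Q Rinf (\<nu> l)"
    and Rinf_bound: "\<forall>i j. \<forall>z\<in>\<Omega>s - \<Omega>0. (\<forall>l<p. \<bar>Im z\<bar> > \<bar>Im (\<nu> l)\<bar>) \<longrightarrow>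
                    (\<forall>x. norm (Q i (Rinf z (Q j (\<iota> x)))) \<le> ht1 i j (cmod z) * ht2 i j (Re z) * norm x)"
    and ht_nonneg: "\<forall>i j s. ht1 i j s \<ge> 0 \<and> ht2 i j s \<ge> 0"
    and ht_pw: "\<forall>i j. pw_cont (ht1 i j) \<and> pw_cont (ht2 i j)"
    and ns_pos: "ns \<ge> 1"
    and ht1_lim: "\<forall>i j. ((\<lambda>s. ht1 i j s / s powr (2 * real ns - 1)) \<longlongrightarrow> 0) at_top"
    and ht2_exp: "\<forall>i j. \<exists>\<beta>>0. bdd_above ((\<lambda>s. exp (\<beta> * s) * ht2 i j s) ` {..\<omega>})"
  \<comment> \<open>additional assumptions of the theorem\<close>
    and g0_below: "bdd_below (range g0)" and gs_below: "bdd_below (range gs)"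
    and gs_deriv: "\<exists>K. \<forall>s. gs differentiable (at s) \<longrightarrow> \<bar>deriv gs s\<bar> \<le> K"
    and ht1_int: "\<forall>i j. (\<lambda>s. ht1 i j s / s powr (2 * real ns - 1)) integrable_on {1..}"
    and n_ge: "n \<ge> max n0 ns"
    and \<epsilon>_pos: "0 < \<epsilon>" and \<epsilon>_lt: "\<epsilon> < cf_epst0 (cf_eps0 g0 \<omega> \<mu> m) \<delta>0 gs \<nu> p"
  shows "\<forall>i j. \<exists>L>0. \<forall>t\<ge>0. \<forall>x. x \<in> cf_dom_pow D A n \<and> Q j (\<iota> x) = x \<longrightarrow>
           norm (Q i (E t x)) \<le> L * exp ((Sup (range gs) + \<epsilon>) * t)
                                   * (norm ((A ^^ (n - 1)) x) + norm ((A ^^ n) x))"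
proof -

  \<comment> \<open>Position of the contour relative to the poles\<close>
  interpret cosine_resolvent C D A M \<omega> R0
    using cos gen M_ge \<omega>_pos C_bound R0_res by unfold_locales auto
  \<comment> \<open>Moving up by at most half of \<open>- gs 0\<close> keeps \<open>h 0\<close>
    negative when \<open>gs 0\<close> is; otherwise \<open>h 0\<close> is positive. In either case
    \<open>h 0 \<noteq> 0\<close>, so the graph of \<open>h\<close> avoids the pole that the
    negative power of \<open>z\<close> creates at 0.\<close>
  define \<epsilon>' where "\<epsilon>' = (if gs 0 < 0 then min \<epsilon> (- gs 0 / 2) else \<epsilon>)"
  define h where "h s = gs s + \<epsilon>'" for s
  define \<sigma> where "\<sigma> = Sup (range gs)"
  define P where "P = \<mu> ` {..<m} \<union> \<nu> ` {..<p}"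
  define S where "S = (if gs 0 < 0 then insert 0 P else P)"
  \<comment> \<open>\<open>r\<close> is half of the gap between \<open>Sup (range g0)\<close> and
    \<open>\<omega>\<close>, so discs of radius \<open>r\<close> centred on
    \<open>Re z = \<omega>\<close> stay to the right of both graphs; \<open>a\<close> marks the
    range covered by \<open>strip_decay\<close>.\<close>
  define r where "r = (\<omega> - Sup (range g0)) / 2"
  define a where "a = \<omega> + r / 2"
  obtain b where b: "\<And>s. b \<le> gs s" using gs_below by (auto simp: bdd_below_def)
  obtain b0 where b0: "\<And>s. b0 \<le> g0 s" using g0_below by (auto simp: bdd_below_def)
  have g0_le: "g0 s \<le> Sup (range g0)" for s by (rule cSUP_upper[OF _ g0_bdd]) simp
  have gs_g0: "gs s < g0 s" for s using gs_le \<delta>0_pos by (smt (verit))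
  have gs_le_\<sigma>: "gs s \<le> \<sigma>" for s
  proof -
    have "bdd_above (range gs)"
      using gs_g0 g0_le by (intro bdd_aboveI2[of _ _ "Sup (range g0)"]) (meson less_le_trans less_imp_le)
    then show ?thesis unfolding \<sigma>_def by (rule cSUP_upper[rotated]) simp
  qed
  have r_pos: "r > 0" using g0_sup by (simp add: r_def)
  have g0_r: "g0 s < \<omega> - r" for s using g0_le[of s] g0_sup by (simp add: r_def field_simps)
  have a_gt: "a > \<omega>" using r_pos by (simp add: a_def)
  have a_pos: "a > 0" using a_gt \<omega>_pos by simp
  have n0n: "n0 \<le> n" "ns \<le> n" and n1: "n \<ge> 1" using n_ge n0_pos by auto

  \<comment> \<open>Together with \<open>gs s + \<delta>0 \<le> g0 s\<close> these keep the graph of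
    \<open>h\<close> outside \<open>\<Omega>0\<close> and to the left of every
    \<open>\<nu> l\<close>.\<close>
  have \<epsilon>_small: "\<epsilon> < \<delta>0" "\<And>l. l < p \<Longrightarrow> \<epsilon> < Re (\<nu> l) - gs (Im (\<nu> l))"
  proof -
    let ?X = "{cf_eps0 g0 \<omega> \<mu> m, \<delta>0} \<union> {Re (\<nu> l) - gs (Im (\<nu> l)) | l. l < p}"
    have fin: "finite ?X" by simp
    have "\<epsilon> < x" if "x \<in> ?X" for x
    proof -
      have "Min ?X \<le> x" using fin that by (rule Min_le)
      then show ?thesis using \<epsilon>_lt \<epsilon>_pos unfolding cf_epst0_def by linarith
    qed
    then show "\<epsilon> < \<delta>0" "\<And>l. l < p \<Longrightarrow> \<epsilon> < Re (\<nu> l) - gs (Im (\<nu> l))" by blast+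
  qed
  have \<epsilon>': "0 < \<epsilon>'" "\<epsilon>' \<le> \<epsilon>" using \<epsilon>_pos by (auto simp: \<epsilon>'_def)
  have h_gs: "gs s < h s" for s using \<epsilon>' by (simp add: h_def)
  have h_g0: "h s < g0 s" for s using \<epsilon>' \<epsilon>_small(1) gs_le[rule_format, of s] by (simp add: h_def)
  have h_a: "h s < a" for s using h_g0[of s] g0_r[of s] r_pos a_gt by linarith
  have h_b: "b \<le> h s" for s using b[of s] h_gs[of s] by linarith
  have h0: "h 0 < 0 \<longleftrightarrow> gs 0 < 0" "h 0 \<noteq> 0" using \<epsilon>' \<epsilon>_pos by (auto simp: h_def \<epsilon>'_def min_def)

  have gs_cont: "continuous_on UNIV gs" by (rule pw_C1_continuous[OF gs_pw])
  have h_pw: "pw_C1 h"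
    unfolding pw_C1_def h_def
    using gs_pw by (intro allI piecewise_C1_differentiable_add const_piecewise_C1) (simp add: pw_C1_def)
  obtain Kd where Kd: "\<And>s d. (h has_real_derivative d) (at s) \<Longrightarrow> \<bar>d\<bar> \<le> Kd" "Kd \<ge> 0"
  proof -
    obtain K where K: "\<And>s. gs differentiable (at s) \<Longrightarrow> \<bar>deriv gs s\<bar> \<le> K" using gs_deriv by blast
    have "\<bar>d\<bar> \<le> \<bar>K\<bar>" if "(h has_real_derivative d) (at s)" for s d
    proof -
      have "((\<lambda>s. h s - \<epsilon>') has_real_derivative d - 0) (at s)" by (intro derivative_intros that)
      then have "(gs has_real_derivative d) (at s)" by (simp add: h_def)
      then have "gs differentiable (at s)" "deriv gs s = d"
        by (auto intro: DERIV_imp_deriv simp: real_differentiable_def)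
      then show ?thesis using K[of s] by auto
    qed
    then show ?thesis by (intro that[of "\<bar>K\<bar>"]) auto
  qed
  define H where "H = \<bar>b\<bar> + \<bar>a\<bar>"
  have H: "\<bar>h s\<bar> \<le> H" for s using h_b[of s] h_a[of s] by (auto simp: H_def)

  have \<Omega>0_sub: "\<Omega>0 \<subseteq> \<Omega>s" using gs_g0 unfolding \<Omega>0_def \<Omega>s_def by (force intro: less_trans)
  have \<Omega>s_eq: "\<Omega>s = {z. gs (Im z) < Re z}" by (simp add: \<Omega>s_def)
  have \<Omega>s_open: "open \<Omega>s" unfolding \<Omega>s_eq by (rule open_right_of_graph[OF gs_cont])
  have \<Omega>s_conn: "connected \<Omega>s" unfolding \<Omega>s_eq
    by (rule simply_connected_imp_connected[OF simply_connected_right_of_graph[OF gs_cont]])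
  have P_fin: "finite P" by (simp add: P_def)
  have S_fin: "finite S" using P_fin by (simp add: S_def)
  have PS: "P \<subseteq> S" by (auto simp: S_def)
  have P_loc: "h (Im q) < Re q \<and> Re q < a" if q: "q \<in> P" for q
  proof -
    consider k where "k < m" "q = \<mu> k" | l where "l < p" "q = \<nu> l" using q by (auto simp: P_def)
    then show ?thesis
    proof cases
      case 1
      then have "g0 (Im q) < Re q" "Re q \<le> \<omega>" using \<mu>_sing by (auto simp: \<Omega>0_def)
      then show ?thesis using h_g0[of "Im q"] a_gt by linarith
    next
      case 2
      then have "\<not> g0 (Im q) < Re q" "\<epsilon> < Re q - gs (Im q)" using \<nu>_sing \<epsilon>_small(2) by (auto simp: \<Omega>0_def)
      then show ?thesis using g0_r[of "Im q"] r_pos a_gt \<epsilon>' by (simp add: h_def)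
    qed
  qed
  have S_loc: "h (Im q) < Re q \<and> Re q < a" if "q \<in> S" for q
    using that P_loc[of q] h0 a_pos by (auto simp: S_def split: if_splits)
  have S_\<Omega>: "S \<subseteq> \<Omega>s" using S_loc h_gs unfolding \<Omega>s_def by (force intro: less_trans)
  have zero_S: "0 \<in> S" if "0 \<in> \<Omega>s" using that by (simp add: S_def \<Omega>s_def)
  have half_\<Omega>0: "z \<in> \<Omega>0 - \<mu> ` {..<m}" "z \<in> \<Omega>s - P" if z: "Re z > \<omega>" for z
  proof -
    have "g0 (Im z) < Re z" using g0_r[of "Im z"] z r_pos by linarith
    then have z0: "z \<in> \<Omega>0" by (simp add: \<Omega>0_def)
    then show "z \<in> \<Omega>0 - \<mu> ` {..<m}" using \<mu>_sing z by force
    then show "z \<in> \<Omega>s - P" using z0 \<Omega>0_sub \<nu>_sing by (auto simp: P_def)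
  qed

  have Ql: "cf_clin (Q k)" for k using Q_lin by blast
  have haus: "y = 0" if "\<And>k. Q k y = 0" for y using Y_frechet that unfolding cf_frechet_def by blast
  have R0_lin: "cf_clin (R0 z)" if "z \<in> \<Omega>0 - \<mu> ` {..<m}" for z
    using bspec[OF R0_hol[unfolded cf_ophol_def] that] by (simp add: cf_bclin_def)

  show ?thesis
  proof (intro allI)

    \<comment> \<open>Constants for a fixed pair of indices\<close>
    fix i j :: nat
    have inXinf: "x \<in> cf_Xinf \<iota> Q" if "Q j (\<iota> x) = x" for x using that by (auto simp: cf_Xinf_def)
    obtain Ki where Ki: "\<And>x. norm (Q i (\<iota> x)) \<le> Ki * norm x" "Ki \<ge> 0"
    proof -
      obtain K where K: "\<And>x. norm (Q i (\<iota> x)) \<le> K * norm x" using Q1 by blast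
      have "norm (Q i (\<iota> x)) \<le> \<bar>K\<bar> * norm x" for x
        using K[of x] by (rule order_trans) (simp add: mult_right_mono)
      then show ?thesis using that[of "\<bar>K\<bar>"] by simp
    qed

    \<comment> \<open>Normalised with the exponent of \<open>ns\<close>, as in the integrability
      hypothesis; for \<open>\<rho> \<ge> 1\<close> and \<open>n \<ge> ns\<close> it dominates
      \<open>ht1 i j \<rho> / \<rho>^(2n-1)\<close>.\<close>
    define k where "k \<rho> = ht1 i j \<rho> / \<rho> powr (2 * real ns - 1)" for \<rho>
    have k_int: "k integrable_on {1..}" using ht1_int by (simp add: k_def[abs_def])
    have k_nonneg: "k \<rho> \<ge> 0" for \<rho> using ht_nonneg by (simp add: k_def)
    have k_cont: "\<exists>N. finite N \<and> continuous_on ({1..b} - N) k" for b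
    proof -
      have "pw_cont (ht1 i j)" using ht_pw by blast
      then have "\<exists>N. finite N \<and> continuous_on ({1..b} - N) (ht1 i j)" unfolding pw_cont_def by fast
      then obtain N where N: "finite N" "continuous_on ({1..b} - N) (ht1 i j)" by blast
      have "continuous_on ({1..b} - N) k" unfolding k_def
        by (intro continuous_intros N(2)) auto
      then show ?thesis using N(1) by blast
    qed
    have powr_ns: "\<rho> powr (2 * real ns - 1) = \<rho> ^ (2 * ns - 1)" if "\<rho> > 0" for \<rho> :: real
    proof -
      have e: "2 * real ns - 1 = real (2 * ns - 1)" using ns_pos by (simp add: of_nat_diff)
      show ?thesis unfolding e using that by (rule powr_realpow)
    qed
    have powr_n0: "\<rho> powr (2 * real n0 - 1) = \<rho> ^ (2 * n0 - 1)" if "\<rho> > 0" for \<rho> :: real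
    proof -
      have e: "2 * real n0 - 1 = real (2 * n0 - 1)" using n0_pos by (simp add: of_nat_diff)
      show ?thesis unfolding e using that by (rule powr_realpow)
    qed
    \<comment> \<open>Dividing by the exponential weight costs at most
      \<open>exp (- \<beta> b)\<close> on \<open>[b, \<omega>]\<close>, where \<open>b\<close> is
      the lower bound of \<open>gs\<close>.\<close>
    obtain B2 where B2: "\<And>s. b \<le> s \<Longrightarrow> s \<le> \<omega> \<Longrightarrow> ht2 i j s \<le> B2" "B2 \<ge> 0"
    proof -
      from spec[OF spec[OF ht2_exp, of i], of j]
      obtain \<beta> where \<beta>: "\<beta> > 0" "bdd_above ((\<lambda>s. exp (\<beta> * s) * ht2 i j s) ` {..\<omega>})"
        by (elim exE conjE)
      from \<beta>(2) obtain B where B': "\<forall>u\<in>(\<lambda>s. exp (\<beta> * s) * ht2 i j s) ` {..\<omega>}. u \<le> B"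
        unfolding bdd_above_def by (elim exE)
      have B: "exp (\<beta> * s) * ht2 i j s \<le> B" if "s \<le> \<omega>" for s
        using B' that by simp
      have "ht2 i j s \<le> \<bar>B\<bar> * exp (- (\<beta> * b))" if "b \<le> s" "s \<le> \<omega>" for s
      proof -
        have "ht2 i j s = exp (- (\<beta> * s)) * (exp (\<beta> * s) * ht2 i j s)"
          by (simp add: exp_minus)
        also have "\<dots> \<le> exp (- (\<beta> * s)) * \<bar>B\<bar>"
          using B[OF that(2)] by (intro mult_left_mono) auto
        also have "\<dots> \<le> exp (- (\<beta> * b)) * \<bar>B\<bar>"
          using \<beta>(1) that by (intro mult_right_mono) auto
        finally show ?thesis by (simp add: mult.commute)
      qed
      then show ?thesis by (intro that[of "\<bar>B\<bar> * exp (- (\<beta> * b))"]) auto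
    qed
    have Rinf_tail: "norm (Q i (Rinf z x)) \<le> ht1 i j (cmod z) * B2 * norm x"
      if z: "z \<in> \<Omega>s - \<Omega>0" "\<forall>l<p. \<bar>Im (\<nu> l)\<bar> < \<bar>Im z\<bar>" and x: "Q j (\<iota> x) = x" for z x
    proof -
      have "norm (Q i (Rinf z (Q j (\<iota> x)))) \<le> ht1 i j (cmod z) * ht2 i j (Re z) * norm x"
        using Rinf_bound z by blast
      also have "\<dots> \<le> ht1 i j (cmod z) * B2 * norm x"
      proof (intro mult_right_mono mult_left_mono B2)
        show "b \<le> Re z" using z(1) b[of "Im z"] by (simp add: \<Omega>s_def)
        show "Re z \<le> \<omega>" using z(1) g0_r[of "Im z"] r_pos by (simp add: \<Omega>0_def)
      qed (use ht_nonneg in auto)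
      finally show ?thesis using x by simp
    qed

    \<comment> \<open>Beyond this height there are no poles, so the growth hypotheses apply, and the
      modulus grows at a rate of at least \<open>1 / 2\<close> along the graph.\<close>
    define S0 where "S0 = Max (insert (1 + H + 2 * H * Kd) ((\<lambda>q. \<bar>Im q\<bar>) ` P))"
    have S0: "S0 \<ge> 1 + H + 2 * H * Kd" "\<And>q. q \<in> P \<Longrightarrow> \<bar>Im q\<bar> \<le> S0"
      using P_fin by (auto simp: S0_def)
    have S01: "S0 \<ge> 1"
    proof -
      have "0 \<le> H" using H[of 0] by linarith
      then have "0 \<le> 2 * H * Kd" using Kd(2) by simp
      then show ?thesis using S0(1) \<open>0 \<le> H\<close> by linarith
    qed
    have graph_\<Omega>: "Complex (h s) s \<in> \<Omega>s - \<Omega>0" "Complex (h s) s \<notin> S" "Complex (h s) s \<noteq> 0" for s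
    proof -
      show "Complex (h s) s \<in> \<Omega>s - \<Omega>0" using h_gs[of s] h_g0[of s] by (simp add: \<Omega>s_def \<Omega>0_def)
      show "Complex (h s) s \<notin> S" using S_loc[of "Complex (h s) s"] by auto
      show "Complex (h s) s \<noteq> 0" using h0(2) by (auto simp: complex_eq_iff)
    qed
    obtain Kc where Kc: "Kc \<ge> 0" "\<And>s x. \<bar>s\<bar> \<le> S0 \<Longrightarrow> Q j (\<iota> x) = x \<Longrightarrow>
      cmod (Complex (h s) s) * inverse (cmod (Complex (h s) s) ^ (2 * n)) * norm (Q i (Rinf (Complex (h s) s) x)) \<le> Kc * norm x"
    proof -
      let ?\<gamma> = "\<lambda>s. Complex (h s) s"
      have hc: "continuous_on {-S0..S0} h"
        using h_pw by (simp add: pw_C1_def piecewise_C1_differentiable_on_def)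
      have \<gamma>c: "continuous_on {-S0..S0} ?\<gamma>" unfolding Complex_eq by (intro continuous_intros hc)
      then have cpt: "compact (?\<gamma> ` {-S0..S0})" by (rule compact_continuous_image) simp
      obtain K1 where K1: "K1 \<ge> 0" "\<And>w x. w \<in> ?\<gamma> ` {-S0..S0} \<Longrightarrow> x \<in> cf_Xinf \<iota> Q \<Longrightarrow> norm (Q i (Rinf w x)) \<le> K1 * norm x"
      proof (rule cf_clhol_bounded_on_compact[OF Ql Rinf_hol cpt, of i])
        show "?\<gamma> ` {-S0..S0} \<subseteq> \<Omega>s - (\<mu> ` {..<m} \<union> \<nu> ` {..<p})"
          using graph_\<Omega>(1,2) PS unfolding P_def[symmetric] by blast
      qed blast
      have "compact ((\<lambda>s. cmod (?\<gamma> s) * inverse (cmod (?\<gamma> s) ^ (2 * n))) ` {-S0..S0})"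
        by (rule compact_continuous_image) (auto intro!: continuous_intros \<gamma>c simp: graph_\<Omega>(3))
      from compact_imp_bounded[OF this]
      obtain K2 where K2': "\<forall>u\<in>(\<lambda>s. cmod (?\<gamma> s) * inverse (cmod (?\<gamma> s) ^ (2 * n))) ` {-S0..S0}. norm u \<le> K2"
        unfolding bounded_iff by (elim exE)
      have K2: "norm (cmod (?\<gamma> s) * inverse (cmod (?\<gamma> s) ^ (2 * n))) \<le> K2" if "s \<in> {-S0..S0}" for s
        by (rule bspec[OF K2' imageI[OF that]])
      have "0 \<in> {-S0..S0}" using S01 by simp
      from order_trans[OF norm_ge_zero K2[OF this]] have K2_nonneg: "K2 \<ge> 0" .
      show ?thesis
      proof (rule that[of "K2 * K1"])
        show "K2 * K1 \<ge> 0" using K2_nonneg K1 by simp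
        fix s x assume "\<bar>s\<bar> \<le> S0" and x: "Q j (\<iota> x) = x"
        then have s: "s \<in> {-S0..S0}" by auto
        have "cmod (?\<gamma> s) * inverse (cmod (?\<gamma> s) ^ (2 * n)) * norm (Q i (Rinf (?\<gamma> s) x)) \<le> K2 * (K1 * norm x)"
          using K2[OF s] K1(2)[OF imageI[OF s] inXinf[OF x]] K2_nonneg by (intro mult_mono) auto
        then show "cmod (?\<gamma> s) * inverse (cmod (?\<gamma> s) ^ (2 * n)) * norm (Q i (Rinf (?\<gamma> s) x)) \<le> K2 * K1 * norm x"
          by (simp add: mult.assoc)
      qed
    qed
    \<comment> \<open>The two tails and the middle arc of the graph integral; \<open>Kd + 1\<close>
      bounds the modulus of the path derivative \<open>h' + \<i>\<close>. Nothing here depends on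
      \<open>t\<close> or \<open>x\<close>.\<close>
    define J where "J = 4 * ((Kd + 1) * B2) * integral {1..} k + 2 * S0 * ((Kd + 1) * Kc)"
    have J_nonneg: "J \<ge> 0"
      unfolding J_def using Kd(2) B2(2) Kc(1) S01 k_nonneg
      by (intro add_nonneg_nonneg mult_nonneg_nonneg integral_nonneg k_int) auto

    have main: "norm (Q i (E t x)) \<le> (J / (2 * pi)) * exp ((\<sigma> + \<epsilon>) * t) * norm ((A ^^ n) x)"
      if t: "t \<ge> 0" and x: "x \<in> cf_dom_pow D A n" and xj: "Q j (\<iota> x) = x" for t x
    proof -

      \<comment> \<open>Passage to scalar functions\<close>
      obtain \<phi> where \<phi>: "cf_bfunc \<phi>" "\<And>u. cmod (\<phi> u) \<le> norm u" "\<phi> (Q i (E t x)) = of_real (norm (Q i (E t x)))"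
        using norming_functional by blast
      define \<psi> where "\<psi> u = \<phi> (Q i (\<iota> u))" for u
      have \<psi>_bound: "cmod (\<psi> u) \<le> Ki * norm u" for u
        using \<phi>(2)[of "Q i (\<iota> u)"] Ki(1)[of u] unfolding \<psi>_def by linarith
      have \<psi>: "cf_bfunc \<psi>"
        unfolding cf_bfunc_def
      proof (intro conjI allI exI[of _ Ki])
        show "\<psi> (u + v) = \<psi> u + \<psi> v" for u v
          using \<phi>(1) Ql[of i] \<iota>_lin by (simp add: \<psi>_def cf_bfunc_def cf_clin_def)
        show "\<psi> (cscale c u) = c * \<psi> u" for c u
          using \<phi>(1) Ql[of i] \<iota>_lin by (simp add: \<psi>_def cf_bfunc_def cf_clin_def)
      qed (rule \<psi>_bound)
      define G where "G y z = \<phi> (Q i (Rinf z y))" for y z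
      have xk: "(A ^^ k) x \<in> D" if "k < n" for k using x that by (simp add: cf_dom_pow_def)
      \<comment> \<open>By (Q5) the kernel of \<open>Q j - I\<close> is invariant under
        \<open>A\<close>, so \<open>Rinf\<close> may be applied to each \<open>A^k x\<close>, and
        the bounds for this \<open>j\<close> hold for \<open>y\<close>.\<close>
      have Qxk: "Q j (\<iota> ((A ^^ k) x)) = (A ^^ k) x" if "k \<le> n" for k
        using that by (induction k) (use xj Q5 xk in auto)
      define y where "y = (A ^^ n) x"
      have yj: "Q j (\<iota> y) = y" unfolding y_def by (rule Qxk) simp
      have Ghol: "G u holomorphic_on \<Omega>s - P" if "Q j (\<iota> u) = u" for u
        unfolding G_def
        by (rule cf_yhol_functional_holomorphic[OF Ql cf_clhol_imp_yhol[OF Ql Rinf_hol[folded P_def] inXinf[OF that]] \<phi>(1)])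
          (use \<Omega>s_open P_fin in \<open>auto intro: open_Diff finite_imp_closed\<close>)
      have G_\<Omega>0: "G u z = \<psi> (R0 z u)" if "Q j (\<iota> u) = u" "z \<in> \<Omega>0 - \<mu> ` {..<m}" for u z
        using Rinf_ext inXinf[OF that(1)] that(2) by (simp add: G_def \<psi>_def)
      \<comment> \<open>For \<open>Re z > \<omega>\<close> this is the resolvent identity under the
        functional. It extends to \<open>\<Omega>s - P\<close>, which stays connected when finitely
        many points are removed.\<close>
      have Gstep: "z\<^sup>2 * G u z = \<psi> u + G (A u) z"
        if u: "u \<in> D" "Q j (\<iota> u) = u" and z: "z \<in> \<Omega>s - P" for u z
      proof (rule analytic_continuation_open[of "{z. \<omega> < Re z}" "\<Omega>s - P" "\<lambda>z. z\<^sup>2 * G u z" "\<lambda>z. \<psi> u + G (A u) z"])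
        have Au: "Q j (\<iota> (A u)) = A u" using Q5 u by blast
        show "open {z. \<omega> < Re z}" by (rule open_halfspace_Re_gt)
        show "open (\<Omega>s - P)" using \<Omega>s_open P_fin by (auto intro: open_Diff finite_imp_closed)
        have "Complex (\<omega> + 1) 0 \<in> {z. \<omega> < Re z}" by simp
        then show "{z. \<omega> < Re z} \<noteq> {}" by blast
        show "connected (\<Omega>s - P)"
          using \<Omega>s_conn \<Omega>s_open P_fin by (intro connected_open_delete_finite) auto
        show "{z. \<omega> < Re z} \<subseteq> \<Omega>s - P" using half_\<Omega>0 by blast
        show "(\<lambda>z. z\<^sup>2 * G u z) holomorphic_on \<Omega>s - P" by (intro holomorphic_intros Ghol u)
        show "(\<lambda>z. \<psi> u + G (A u) z) holomorphic_on \<Omega>s - P" by (intro holomorphic_intros Ghol Au)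
        show "z \<in> \<Omega>s - P" by fact
        fix w assume "w \<in> {z. \<omega> < Re z}"
        then have w: "\<omega> < Re w" by simp
        note w0 = half_\<Omega>0(1)[OF w]
        have "u = R0 w (cscale (w\<^sup>2) u - A u)" using res_eq'[OF w u(1)] by simp
        also have "\<dots> = cscale (w\<^sup>2) (R0 w u) - R0 w (A u)"
          by (simp only: cf_clin_diff[OF R0_lin[OF w0]] cf_clin_cscale[OF R0_lin[OF w0]])
        finally have "\<psi> u = \<psi> (cscale (w\<^sup>2) (R0 w u) - R0 w (A u))" by (rule arg_cong)
        then have "\<psi> u = w\<^sup>2 * \<psi> (R0 w u) - \<psi> (R0 w (A u))"
          by (simp only: cf_bfunc_cscale[OF \<psi>] cf_bfunc_diff[OF \<psi>])
        then show "w\<^sup>2 * G u w = \<psi> u + G (A u) w" by (simp add: G_\<Omega>0[OF u(2) w0] G_\<Omega>0[OF Au w0])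
      qed
      \<comment> \<open>\<open>F\<close> has the residues that occur in \<open>E\<close>, while
        \<open>I\<close> is the integrand small enough for the shift of the contour.\<close>
      define I where "I z = exp (z * of_real t) * inverse (z ^ (2 * n)) * (z * G y z)" for z
      define F where "F z = z * exp (z * of_real t) * G x z" for z
      have FI: "F z = I z + exp (z * of_real t) * (\<Sum>\<alpha><n. \<psi> ((A ^^ \<alpha>) x) * inverse (z ^ Suc (2 * \<alpha>)))"
        if z: "z \<in> \<Omega>s - P" "z \<noteq> 0" for z
      proof -
        have "G x z * z = inverse (z ^ (2 * k)) * (z * G ((A ^^ k) x) z) + (\<Sum>\<alpha><k. \<psi> ((A ^^ \<alpha>) x) * inverse (z ^ Suc (2 * \<alpha>)))"
          if "k \<le> n" for k
          using that
        proof (induction k)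
          case (Suc k)
          have "z\<^sup>2 * G ((A ^^ k) x) z = \<psi> ((A ^^ k) x) + G ((A ^^ Suc k) x) z"
            using Gstep[OF xk[of k] Qxk[of k] z(1)] Suc.prems by simp
          then have e1: "inverse (z ^ Suc (2 * k)) * (z\<^sup>2 * G ((A ^^ k) x) z)
              = \<psi> ((A ^^ k) x) * inverse (z ^ Suc (2 * k)) + inverse (z ^ Suc (2 * k)) * G ((A ^^ Suc k) x) z"
            by (simp only: distrib_left mult.commute)
          have e2: "inverse (z ^ Suc (2 * k)) * (z\<^sup>2 * G ((A ^^ k) x) z) = inverse (z ^ (2 * k)) * (z * G ((A ^^ k) x) z)"
            using z(2) by (simp add: power2_eq_square)
          have e3: "inverse (z ^ Suc (2 * k)) * G ((A ^^ Suc k) x) z = inverse (z ^ (2 * Suc k)) * (z * G ((A ^^ Suc k) x) z)"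
            using z(2) by (simp add: power2_eq_square)
          have Xk: "inverse (z ^ (2 * k)) * (z * G ((A ^^ k) x) z)
              = \<psi> ((A ^^ k) x) * inverse (z ^ Suc (2 * k)) + inverse (z ^ (2 * Suc k)) * (z * G ((A ^^ Suc k) x) z)"
            using e1 unfolding e2 e3 .
          show ?case unfolding Suc.IH[OF Suc_leD[OF Suc.prems]] Xk
            by (simp only: sum.lessThan_Suc ac_simps)
        qed simp
        from this[OF order_refl] have key: "G x z * z
            = inverse (z ^ (2 * n)) * (z * G y z) + (\<Sum>\<alpha><n. \<psi> ((A ^^ \<alpha>) x) * inverse (z ^ Suc (2 * \<alpha>)))"
          by (simp only: y_def)
        have "F z = exp (z * of_real t) * (G x z * z)" by (simp add: F_def)
        then show ?thesis unfolding key I_def by (simp only: distrib_left mult.assoc)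
      qed
      have Fhol: "F holomorphic_on \<Omega>s - P" unfolding F_def by (intro holomorphic_intros Ghol xj)
      have Ihol: "I holomorphic_on \<Omega>s - S"
      proof -
        have "G y holomorphic_on \<Omega>s - S" using Ghol[OF yj] by (rule holomorphic_on_subset) (use PS in blast)
        then show ?thesis unfolding I_def using zero_S by (intro holomorphic_intros) auto
      qed

      \<comment> \<open>Residues of the two integrands\<close>
      define pol where "pol = (\<Sum>\<alpha><n. complex_of_real (t ^ (2 * \<alpha>) / fact (2 * \<alpha>)) * \<psi> ((A ^^ \<alpha>) x))"
      have resI: "residue I q = residue F q - (if q = 0 then pol else 0)" if "q \<in> \<Omega>s" for q
      proof -
        have "residue I q = residue F q - (if q = 0 then \<Sum>\<alpha><n. \<psi> ((A ^^ \<alpha>) x) * of_real t ^ (2 * \<alpha>) / fact (2 * \<alpha>) else 0)"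
          by (rule residue_power_shift[OF \<Omega>s_open P_fin that Fhol FI])
        also have "(\<Sum>\<alpha><n. \<psi> ((A ^^ \<alpha>) x) * of_real t ^ (2 * \<alpha>) / fact (2 * \<alpha>)) = pol"
          by (simp add: pol_def mult.commute)
        finally show ?thesis .
      qed
      \<comment> \<open>If 0 is in \<open>S\<close> but not in \<open>P\<close>, then
        \<open>F\<close> is holomorphic there, so its residues over \<open>S\<close> reduce to those
        over \<open>P\<close>.\<close>
      have sumI: "(\<Sum>q\<in>S. residue I q) = (\<Sum>q\<in>P. residue F q) - (if gs 0 < 0 then pol else 0)"
      proof (cases "gs 0 < 0")
        case True
        then have zS: "0 \<in> S" by (simp add: S_def)
        have "(\<Sum>q\<in>S. residue I q) = (\<Sum>q\<in>S. residue F q) - (\<Sum>q\<in>S. if q = 0 then pol else 0)"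
          using S_\<Omega> by (subst sum_subtractf[symmetric]) (intro sum.cong refl resI, blast)
        also have "(\<Sum>q\<in>S. if q = 0 then pol else 0) = pol" using S_fin zS by simp
        also have "(\<Sum>q\<in>S. residue F q) = (\<Sum>q\<in>P. residue F q)"
        proof (rule sum.mono_neutral_right[OF S_fin PS], rule ballI)
          fix q assume q: "q \<in> S - P"
          show "residue F q = 0"
          proof (rule residue_holo[OF _ _ Fhol])
            show "open (\<Omega>s - P)" using \<Omega>s_open P_fin by (auto intro: open_Diff finite_imp_closed)
            show "q \<in> \<Omega>s - P" using q S_\<Omega> by blast
          qed
        qed
        finally show ?thesis using True by simp
      next
        case False
        then have "S = P" "0 \<notin> \<Omega>s" by (simp_all add: S_def \<Omega>s_def)
        then have "residue I q = residue F q" if "q \<in> S" for q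
          using resI[of q] that S_\<Omega> by (cases "q = 0") auto
        then show ?thesis using False \<open>S = P\<close> by simp
      qed
      let ?q = "\<lambda>z. z * exp (z * complex_of_real t)"
      have qhol: "?q holomorphic_on UNIV" by (intro holomorphic_intros)
      have res\<mu>: "\<psi> (cf_xres (\<lambda>z. cscale (?q z) (R0 z x)) (\<mu> k)) = residue F (\<mu> k)" if k: "k < m" for k
      proof -
        have "\<psi> (cf_xres (\<lambda>z. cscale (?q z) (R0 z x)) (\<mu> k)) = residue (\<lambda>z. ?q z * \<psi> (R0 z x)) (\<mu> k)"
          using \<mu>_sing k by (intro functional_xres qhol \<psi>) blast
        also have "\<dots> = residue F (\<mu> k)"
        proof (rule residue_cong)
          have op: "open \<Omega>0"
            unfolding \<Omega>0_def by (rule open_right_of_graph[OF pw_C1_continuous[OF g0_pw]])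
          have "open (\<Omega>0 - (\<mu> ` {..<m} - {\<mu> k}))" using op by (auto intro: open_Diff finite_imp_closed)
          moreover have "\<mu> k \<in> \<Omega>0 - (\<mu> ` {..<m} - {\<mu> k})" using \<mu>_sing k by blast
          ultimately have "\<forall>\<^sub>F z in at (\<mu> k). z \<in> \<Omega>0 - (\<mu> ` {..<m} - {\<mu> k}) - {\<mu> k}"
            by (rule eventually_at_in_open)
          then show "\<forall>\<^sub>F z in at (\<mu> k). ?q z * \<psi> (R0 z x) = F z"
            by eventually_elim (auto simp: F_def G_\<Omega>0[OF xj])
        qed simp
        finally show ?thesis .
      qed
      have res\<nu>: "\<phi> (Q i (cf_yres Q (\<lambda>z. cscale (?q z) (Rinf z x)) (\<nu> l))) = residue F (\<nu> l)" if l: "l < p" for l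
      proof -
        have "cf_cl_fin_merom_at \<iota> Q Rinf (\<nu> l)" using \<nu>_sing l by blast
        from functional_yres[OF Ql haus this inXinf[OF xj] qhol \<phi>(1)]
        show ?thesis by (simp add: F_def[abs_def] G_def)
      qed
      have sumF: "(\<Sum>q\<in>P. residue F q) = (\<Sum>k<m. residue F (\<mu> k)) + (\<Sum>l<p. residue F (\<nu> l))"
      proof -
        have "\<mu> ` {..<m} \<inter> \<nu> ` {..<p} = {}" using \<mu>_sing \<nu>_sing by fastforce
        then have "(\<Sum>q\<in>P. residue F q) = (\<Sum>q\<in>\<mu> ` {..<m}. residue F q) + (\<Sum>q\<in>\<nu> ` {..<p}. residue F q)"
          unfolding P_def by (intro sum.union_disjoint) auto
        then show ?thesis by (simp add: sum.reindex[OF \<mu>_inj] sum.reindex[OF \<nu>_inj])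
      qed
      \<comment> \<open>For \<open>gs 0 \<ge> 0\<close> the polynomial is part of \<open>E\<close>;
        for \<open>gs 0 < 0\<close> it is absent from \<open>E\<close> and cancels against the
        residue of \<open>I\<close> at 0. One formula covers both cases.\<close>
      have \<phi>E: "\<phi> (Q i (E t x)) = (\<psi> (C t x) - pol) - (\<Sum>q\<in>S. residue I q)"
      proof -
        have poly: "\<phi> (Q i (\<Sum>\<alpha><n. cscale (complex_of_real (t ^ (2 * \<alpha>) / fact (2 * \<alpha>))) (\<iota> ((A ^^ \<alpha>) x)))) = pol"
          unfolding pol_def \<psi>_def
          by (simp only: cf_clin_sum[OF Ql] cf_bfunc_sum[OF \<phi>(1)] cf_clin_cscale[OF Ql] cf_bfunc_cscale[OF \<phi>(1)])
        have "\<phi> (Q i (E t x)) = \<psi> (C t x) - (\<Sum>k<m. residue F (\<mu> k)) - (\<Sum>l<p. residue F (\<nu> l))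
            - (if gs 0 \<ge> 0 then pol else 0)"
          unfolding E_def cf_clin_diff[OF Ql] cf_bfunc_diff[OF \<phi>(1)] cf_clin_sum[OF Ql] cf_bfunc_sum[OF \<phi>(1)]
            \<psi>_def[symmetric]
          using poly by (auto simp: res\<mu> res\<nu> cf_clin_zero[OF Ql] cf_bfunc_zero[OF \<phi>(1)]
              cf_clin_sum[OF Ql] cf_bfunc_sum[OF \<phi>(1)])
        then show ?thesis unfolding sumI sumF by auto
      qed

      \<comment> \<open>Up to \<open>\<omega>\<close> the decay comes from the growth hypotheses,
        and \<open>strip_decay\<close> carries it on to \<open>a\<close>; the factor
        \<open>exp (z t)\<close> is bounded by \<open>exp (a t)\<close>.\<close>
      have decay: "\<exists>T. \<forall>z. \<bar>Im z\<bar> \<ge> T \<longrightarrow> gs (Im z) < Re z \<longrightarrow> Re z \<le> a \<longrightarrow> cmod (I z) \<le> \<eta>" if \<eta>: "\<eta> > 0" for \<eta>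
      proof -
        have left: "\<exists>T. \<forall>z. \<bar>Im z\<bar> \<ge> T \<longrightarrow> gs (Im z) < Re z \<longrightarrow> Re z \<le> \<omega> \<longrightarrow> cmod (G y z) \<le> \<eta> * cmod z ^ (2 * n - 1)"
          if \<eta>: "\<eta> > 0" for \<eta>
        proof -
          obtain H2 where H2: "\<And>s. b0 \<le> s \<Longrightarrow> s \<le> \<omega> \<Longrightarrow> \<bar>h2 s\<bar> \<le> H2" "H2 \<ge> 0"
          proof -
            have "bounded (h2 ` {b0..\<omega>})" using h2_bdd by blast
            then obtain B where B: "\<forall>u\<in>h2 ` {b0..\<omega>}. norm u \<le> B" unfolding bounded_iff by (elim exE)
            have "\<bar>h2 s\<bar> \<le> max B 0" if "b0 \<le> s" "s \<le> \<omega>" for s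
            proof -
              have "norm (h2 s) \<le> B" using B that by simp
              then show ?thesis by simp
            qed
            then show ?thesis using that[of "max B 0"] by auto
          qed
          \<comment> \<open>One \<open>e\<close> serves both regions: the denominator exceeds each
            constant that multiplies it, and the summand 1 keeps it positive.\<close>
          define e where "e = \<eta> / (1 + B2 * norm y + H2 * Ki * norm y)"
          have den: "1 + B2 * norm y + H2 * Ki * norm y > 0"
            using B2(2) H2(2) Ki(2) by (intro add_pos_nonneg) auto
          have e: "e > 0" "e * (B2 * norm y) \<le> \<eta>" "e * (H2 * Ki * norm y) \<le> \<eta>"
          proof -
            have "e * (1 + B2 * norm y + H2 * Ki * norm y) = \<eta>" using den by (simp add: e_def)
            moreover show "e > 0" using den \<eta> by (simp add: e_def)
            moreover have "0 \<le> e * (B2 * norm y)" "0 \<le> e * (H2 * Ki * norm y)"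
              using \<open>e > 0\<close> B2(2) H2(2) Ki(2) by auto
            ultimately show "e * (B2 * norm y) \<le> \<eta>" "e * (H2 * Ki * norm y) \<le> \<eta>"
              by (auto simp: algebra_simps)
          qed
          have "\<forall>\<^sub>F \<rho> in at_top. norm (ht1 i j \<rho> / \<rho> powr (2 * real ns - 1)) < e"
            using ht1_lim[rule_format, of i j] e(1) by (auto dest: tendstoD simp: tendsto_iff)
          then obtain T1 where T1: "\<And>\<rho>. \<rho> \<ge> T1 \<Longrightarrow> \<bar>ht1 i j \<rho> / \<rho> powr (2 * real ns - 1)\<bar> < e"
            by (auto simp: eventually_at_top_linorder)
          have "\<forall>\<^sub>F \<rho> in at_top. norm (h1 \<rho> / \<rho> powr (2 * real n0 - 1)) < e"
            using h1_lim e(1) by (auto simp: tendsto_iff)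
          then obtain T2 where T2: "\<And>\<rho>. \<rho> \<ge> T2 \<Longrightarrow> \<bar>h1 \<rho> / \<rho> powr (2 * real n0 - 1)\<bar> < e"
            by (auto simp: eventually_at_top_linorder)
          \<comment> \<open>Raises the exponent from \<open>2 ns - 1\<close> or
            \<open>2 n0 - 1\<close> to \<open>2 n - 1\<close>.\<close>
          have quot: "\<bar>u\<bar> \<le> e * \<rho> ^ N'" if "\<bar>u / \<rho> ^ N\<bar> < e" "N \<le> N'" "\<rho> \<ge> 1" for u \<rho> :: real and N N'
          proof -
            have "\<bar>u\<bar> / \<rho> ^ N < e" using that by (simp add: abs_divide)
            then have "\<bar>u\<bar> \<le> e * \<rho> ^ N" using that(3) by (simp add: divide_less_eq)
            also have "\<dots> \<le> e * \<rho> ^ N'" using that e(1) by (intro mult_left_mono power_increasing) auto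
            finally show ?thesis .
          qed
          have "cmod (G y z) \<le> \<eta> * cmod z ^ (2 * n - 1)"
            if z: "\<bar>Im z\<bar> \<ge> Max {T1, T2, S0 + 1}" "gs (Im z) < Re z" "Re z \<le> \<omega>" for z
          proof -
            have zT: "\<bar>Im z\<bar> \<ge> T1" "\<bar>Im z\<bar> \<ge> T2" "\<bar>Im z\<bar> > S0" using z(1) by auto
            have cz: "cmod z \<ge> \<bar>Im z\<bar>" by (rule abs_Im_le_cmod)
            have cz1: "cmod z \<ge> 1" using cz zT S01 by linarith
            then have czpos: "cmod z > 0" by linarith
            have zP: "\<bar>Im q\<bar> < \<bar>Im z\<bar>" if "q \<in> P" for q using S0(2)[OF that] zT by linarith
            show ?thesis
            proof (cases "z \<in> \<Omega>0")
              case False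
              have "cmod (G y z) \<le> norm (Q i (Rinf z y))" unfolding G_def by (rule \<phi>(2))
              also have "\<dots> \<le> ht1 i j (cmod z) * B2 * norm y"
                using z False zP by (intro Rinf_tail yj) (auto simp: \<Omega>s_def P_def)
              also have "\<dots> \<le> e * cmod z ^ (2 * n - 1) * B2 * norm y"
              proof (intro mult_right_mono B2(2) norm_ge_zero)
                have "T1 \<le> cmod z" using zT cz by linarith
                from T1[OF this] have "\<bar>ht1 i j (cmod z) / cmod z ^ (2 * ns - 1)\<bar> < e"
                  unfolding powr_ns[OF czpos] .
                from quot[OF this _ cz1, of "2 * n - 1"] show "ht1 i j (cmod z) \<le> e * cmod z ^ (2 * n - 1)"
                  using n0n by linarith
              qed
              also have "\<dots> = e * (B2 * norm y) * cmod z ^ (2 * n - 1)" by simp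
              also have "\<dots> \<le> \<eta> * cmod z ^ (2 * n - 1)" by (intro mult_right_mono e) simp
              finally show ?thesis .
            next
              case True
              then have z0: "z \<in> \<Omega>0 - \<mu> ` {..<m}" using zP by (force simp: P_def)
              have "cmod (G y z) = cmod (\<psi> (R0 z y))" by (simp add: G_\<Omega>0[OF yj z0])
              also have "\<dots> \<le> Ki * norm (R0 z y)" by (rule \<psi>_bound)
              also have "\<dots> \<le> Ki * (e * cmod z ^ (2 * n - 1) * H2 * norm y)"
              proof (intro mult_left_mono Ki(2))
                have "norm (R0 z y) \<le> h1 (cmod z) * h2 (Re z) * norm y"
                  using R0_bound True z(3) zP by (auto simp: P_def)
                also have "\<dots> \<le> (\<bar>h1 (cmod z)\<bar> * \<bar>h2 (Re z)\<bar>) * norm y"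
                  by (intro mult_right_mono) (auto simp flip: abs_mult)
                also have "\<dots> \<le> (e * cmod z ^ (2 * n - 1) * H2) * norm y"
                proof (intro mult_right_mono mult_mono H2)
                  have "T2 \<le> cmod z" using zT cz by linarith
                  from T2[OF this] have "\<bar>h1 (cmod z) / cmod z ^ (2 * n0 - 1)\<bar> < e"
                    unfolding powr_n0[OF czpos] .
                  from quot[OF this _ cz1, of "2 * n - 1"] show "\<bar>h1 (cmod z)\<bar> \<le> e * cmod z ^ (2 * n - 1)"
                    using n0n by linarith
                  show "b0 \<le> Re z" using b0[of "Im z"] True by (simp add: \<Omega>0_def)
                qed (use z e in auto)
                finally show "norm (R0 z y) \<le> e * cmod z ^ (2 * n - 1) * H2 * norm y" .
              qed
              also have "\<dots> = e * (H2 * Ki * norm y) * cmod z ^ (2 * n - 1)" by simp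
              also have "\<dots> \<le> \<eta> * cmod z ^ (2 * n - 1)" by (intro mult_right_mono e) simp
              finally show ?thesis .
            qed
          qed
          then show ?thesis by blast
        qed
        have right: "cmod (z * G y z) \<le> Ki * M * norm y / (Re z - \<omega>)" if z: "\<omega> < Re z" for z
          using resolvent_functional_bound[OF \<psi> \<psi>_bound Ki(2) z, of y] by (simp add: G_\<Omega>0[OF yj half_\<Omega>0(1)[OF z]])
        have hol: "G y holomorphic_on {z. gs (Im z) < Re z \<and> \<bar>Im z\<bar> > S0}"
          using Ghol[OF yj] by (rule holomorphic_on_subset) (use S0(2) in \<open>force simp: \<Omega>s_def\<close>)
        have gsr: "gs s < \<omega> - r" for s using gs_g0[of s] g0_r[of s] by linarith
        define \<eta>' where "\<eta>' = \<eta> * exp (- (a * t))"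
        have \<eta>': "\<eta>' > 0" using \<eta> by (simp add: \<eta>'_def)
        have KM: "Ki * M * norm y \<ge> 0" using Ki(2) M_ge by simp
        obtain T where T: "\<And>z. \<bar>Im z\<bar> \<ge> T \<Longrightarrow> gs (Im z) < Re z \<Longrightarrow> Re z \<le> a \<Longrightarrow> cmod (G y z) \<le> \<eta>' * cmod z ^ (2 * n - 1)"
          using strip_decay[OF n1 r_pos gsr hol left right KM \<omega>_pos \<eta>'] unfolding a_def by blast
        have "cmod (I z) \<le> \<eta>" if z: "\<bar>Im z\<bar> \<ge> max T 1" "gs (Im z) < Re z" "Re z \<le> a" for z
        proof -
          have cz: "cmod z > 0" using abs_Im_le_cmod[of z] z by linarith
          have pw: "cmod z ^ (2 * n) = cmod z * cmod z ^ (2 * n - 1)"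
            using n1 by (simp flip: power_Suc)
          have "cmod (I z) = exp (Re z * t) * (inverse (cmod z ^ (2 * n)) * (cmod z * cmod (G y z)))"
            by (simp add: I_def norm_mult norm_inverse norm_power)
          also have "\<dots> \<le> exp (a * t) * (inverse (cmod z ^ (2 * n)) * (cmod z * (\<eta>' * cmod z ^ (2 * n - 1))))"
            using z t T[of z] by (intro mult_mono) (auto intro: mult_right_mono)
          also have "inverse (cmod z ^ (2 * n)) * (cmod z * (\<eta>' * cmod z ^ (2 * n - 1))) = \<eta>'"
            using cz unfolding pw by (simp add: field_simps)
          also have "exp (a * t) * \<eta>' = \<eta>" by (simp add: \<eta>'_def exp_minus)
          finally show ?thesis .
        qed
        then show ?thesis by blast
      qed

      \<comment> \<open>The vertical line\<close>
      have vert: "((\<lambda>T. contour_integral (linepath (Complex a (- T)) (Complex a T)) I) \<longlongrightarrow> 2 * pi * \<i> * (\<psi> (C t x) - pol)) at_top"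
      proof -
        have "(\<lambda>z. \<psi> (R0 z y)) holomorphic_on {z. \<omega> < Re z}"
        proof (rule holomorphic_transform)
          show "G y holomorphic_on {z. \<omega> < Re z}"
            using Ghol[OF yj] by (rule holomorphic_on_subset) (use half_\<Omega>0 in blast)
        qed (auto intro!: G_\<Omega>0[OF yj] half_\<Omega>0(1))
        from vertical_integral_tendsto[OF \<psi> \<psi>_bound Ki(2) x n1 t a_gt this[unfolded y_def]]
        have "((\<lambda>T. contour_integral (linepath (Complex a (- T)) (Complex a T))
            (\<lambda>z. exp (z * of_real t) * inverse (z ^ (2 * n)) * (z * \<psi> (R0 z y)))) \<longlongrightarrow> 2 * pi * \<i> * (\<psi> (C t x) - pol)) at_top"
          by (simp add: y_def pol_def)
        moreover have "contour_integral (linepath (Complex a (- T)) (Complex a T))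
            (\<lambda>z. exp (z * of_real t) * inverse (z ^ (2 * n)) * (z * \<psi> (R0 z y)))
            = contour_integral (linepath (Complex a (- T)) (Complex a T)) I" for T
        proof (rule contour_integral_cong)
          fix z assume "z \<in> path_image (linepath (Complex a (- T)) (Complex a T))"
          then have "Re z = a" by (auto simp: closed_segment_same_Re)
          then have "z \<in> \<Omega>0 - \<mu> ` {..<m}" using a_gt by (intro half_\<Omega>0(1)) simp
          then show "exp (z * of_real t) * inverse (z ^ (2 * n)) * (z * \<psi> (R0 z y)) = I z"
            by (simp add: I_def G_\<Omega>0[OF yj])
        qed simp
        ultimately show ?thesis by simp
      qed

      \<comment> \<open>The integral over the graph\<close>
      let ?X = "exp ((\<sigma> + \<epsilon>) * t) * norm y"
      have graph: "cmod (contour_integral (graph_path h T) I) \<le> J * ?X"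
        if T: "T > S0" and int: "I contour_integrable_on graph_path h T" for T
      proof -
        let ?\<gamma> = "\<lambda>s. Complex (h s) s"
        have KB: "0 \<le> (Kd + 1) * B2" using Kd(2) B2(2) by simp
        have T0: "T > 0" using T S01 by linarith
        have k_nonneg1: "\<And>s. s \<ge> 1 \<Longrightarrow> k s \<ge> 0" by (rule k_nonneg)
        have "\<exists>B J' N. finite N \<and> (B has_integral J') {-T..T}
          \<and> J' \<le> 4 * ((Kd + 1) * B2) * integral {1..} k + 2 * S0 * ((Kd + 1) * Kc)
          \<and> (\<forall>s\<in>{-T..T} - N. (if \<bar>s\<bar> \<le> S0 then (Kd + 1) * Kc else ((Kd + 1) * B2) * k (cmod (?\<gamma> s))) \<le> B s)"
          by (rule graph_weight_two_sided[of h H Kd S0 "(Kd + 1) * B2" k T "(Kd + 1) * Kc"])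
            (fact h_pw H Kd S0(1) KB k_int k_nonneg1 k_cont T)+
        then obtain B J' N where B: "finite N" "(B has_integral J') {-T..T}"
          "J' \<le> 4 * ((Kd + 1) * B2) * integral {1..} k + 2 * S0 * ((Kd + 1) * Kc)"
          "\<forall>s\<in>{-T..T} - N. (if \<bar>s\<bar> \<le> S0 then (Kd + 1) * Kc else ((Kd + 1) * B2) * k (cmod (?\<gamma> s))) \<le> B s"
          by (elim exE conjE)
        have "cmod (contour_integral (graph_path h T) I) \<le> J' * ?X"
        proof (rule graph_path_integral_bound[OF _ T0 int has_integral_mult_left[OF B(2)] B(1)])
          show "h piecewise_C1_differentiable_on {-T..T}" using h_pw by (simp add: pw_C1_def)
          fix s d assume s: "s \<in> {-T..T} - N" and d: "(h has_real_derivative d) (at s)"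
          have dK: "cmod (Complex d 1) \<le> Kd + 1"
            using cmod_le[of "Complex d 1"] Kd(1)[OF d] by simp
          have ex: "exp (h s * t) \<le> exp ((\<sigma> + \<epsilon>) * t)"
            using gs_le_\<sigma>[of s] \<epsilon>'(2) t by (auto simp: h_def intro!: mult_right_mono)
          let ?w = "cmod (?\<gamma> s) * inverse (cmod (?\<gamma> s) ^ (2 * n)) * norm (Q i (Rinf (?\<gamma> s) y))"
          \<comment> \<open>On the tails one factor of the modulus cancels against
            \<open>z^(-2n)\<close>, and the remaining exponent \<open>2 n - 1\<close> is lowered to
            \<open>2 ns - 1\<close> because the modulus is at least 1; on the middle arc
            \<open>Kc\<close> already contains the power.\<close>
          have w: "?w \<le> (if \<bar>s\<bar> \<le> S0 then Kc else B2 * k (cmod (?\<gamma> s))) * norm y"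
          proof (cases "\<bar>s\<bar> \<le> S0")
            case True
            then show ?thesis using Kc(2)[OF True yj] by simp
          next
            case False
            let ?\<rho> = "cmod (?\<gamma> s)"
            have \<rho>1: "?\<rho> \<ge> 1" using abs_Im_le_cmod[of "?\<gamma> s"] False S01 by simp
            have pw: "?\<rho> * inverse (?\<rho> ^ (2 * n)) \<le> inverse (?\<rho> ^ (2 * ns - 1))"
            proof -
              have "?\<rho> ^ (2 * n) = ?\<rho> * ?\<rho> ^ (2 * n - 1)" using n1 by (simp flip: power_Suc)
              then have "?\<rho> * inverse (?\<rho> ^ (2 * n)) = (?\<rho> * inverse ?\<rho>) * inverse (?\<rho> ^ (2 * n - 1))"
                by (simp only: inverse_mult_distrib mult.assoc)
              also have "?\<rho> * inverse ?\<rho> = 1" using \<rho>1 by (intro right_inverse) linarith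
              also have "1 * inverse (?\<rho> ^ (2 * n - 1)) = inverse (?\<rho> ^ (2 * n - 1))" by simp
              also have "\<dots> \<le> inverse (?\<rho> ^ (2 * ns - 1))"
              proof (intro le_imp_inverse_le power_increasing \<rho>1)
                show "0 < ?\<rho> ^ (2 * ns - 1)" using \<rho>1 by (intro zero_less_power) linarith
              qed (use n0n in auto)
              finally show ?thesis .
            qed
            have "norm (Q i (Rinf (?\<gamma> s) y)) \<le> ht1 i j ?\<rho> * B2 * norm y"
              using False S0(2) by (intro Rinf_tail graph_\<Omega>(1) yj) (force simp: P_def)
            then have "?w \<le> inverse (?\<rho> ^ (2 * ns - 1)) * (ht1 i j ?\<rho> * B2 * norm y)"
              using pw \<rho>1 by (intro mult_mono) auto
            also have "\<dots> = B2 * k ?\<rho> * norm y"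
              unfolding k_def powr_ns[OF less_le_trans[OF zero_less_one \<rho>1]] by (simp add: divide_inverse)
            finally show ?thesis using False by simp
          qed
          have "cmod (I (?\<gamma> s)) * cmod (Complex d 1)
              = exp (h s * t) * (cmod (?\<gamma> s) * inverse (cmod (?\<gamma> s) ^ (2 * n)) * cmod (G y (?\<gamma> s))) * cmod (Complex d 1)"
            by (simp add: I_def norm_mult norm_inverse norm_power)
          also have "\<dots> \<le> exp ((\<sigma> + \<epsilon>) * t) * ?w * (Kd + 1)"
            using ex dK \<phi>(2)[of "Q i (Rinf (?\<gamma> s) y)"]
            by (intro mult_mono) (auto simp: G_def)
          also have "\<dots> \<le> exp ((\<sigma> + \<epsilon>) * t) * ((if \<bar>s\<bar> \<le> S0 then Kc else B2 * k (cmod (?\<gamma> s))) * norm y) * (Kd + 1)"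
            using w Kd(2) by (intro mult_right_mono mult_left_mono) auto
          also have "\<dots> = (if \<bar>s\<bar> \<le> S0 then (Kd + 1) * Kc else ((Kd + 1) * B2) * k (cmod (?\<gamma> s))) * ?X"
            by simp
          also have "\<dots> \<le> B s * ?X" using bspec[OF B(4) s] by (intro mult_right_mono) auto
          finally show "cmod (I (?\<gamma> s)) * cmod (Complex d 1) \<le> B s * ?X" .
        qed
        also have "\<dots> \<le> J * ?X" using B(3) unfolding J_def by (intro mult_right_mono) auto
        finally show ?thesis .
      qed
      have "cmod ((\<psi> (C t x) - pol) - (\<Sum>q\<in>S. residue I q)) \<le> J * ?X / (2 * pi)"
        by (rule contour_shift_bound[OF gs_cont h_pw h_gs h_a h_b S_fin Ihol[unfolded \<Omega>s_eq] S_loc vert decay graph])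
      then show ?thesis unfolding \<phi>E[symmetric] \<phi>(3) by (simp add: y_def)
    qed

    show "\<exists>L>0. \<forall>t\<ge>0. \<forall>x. x \<in> cf_dom_pow D A n \<and> Q j (\<iota> x) = x \<longrightarrow>
           norm (Q i (E t x)) \<le> L * exp ((Sup (range gs) + \<epsilon>) * t)
                                   * (norm ((A ^^ (n - 1)) x) + norm ((A ^^ n) x))"
    \<comment> \<open>The summand 1 makes the constant positive even if \<open>J = 0\<close>. The
      contour estimate is in terms of the norm of \<open>A^n x\<close>; the other norm is
      nonnegative and is added at the end.\<close>
    proof (intro exI[of _ "J / (2 * pi) + 1"] conjI allI impI)
      show "J / (2 * pi) + 1 > 0" using J_nonneg by (simp add: add_nonneg_pos)
      fix t x assume t: "t \<ge> (0::real)" and x: "x \<in> cf_dom_pow D A n \<and> Q j (\<iota> x) = x"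
      have "norm (Q i (E t x)) \<le> (J / (2 * pi)) * exp ((\<sigma> + \<epsilon>) * t) * norm ((A ^^ n) x)"
        using main t x by blast
      also have "\<dots> \<le> (J / (2 * pi) + 1) * exp ((\<sigma> + \<epsilon>) * t) * (norm ((A ^^ (n - 1)) x) + norm ((A ^^ n) x))"
        using J_nonneg by (intro mult_mono) auto
      finally show "norm (Q i (E t x)) \<le> (J / (2 * pi) + 1) * exp ((Sup (range gs) + \<epsilon>) * t)
          * (norm ((A ^^ (n - 1)) x) + norm ((A ^^ n) x))" unfolding \<sigma>_def .
    qed
  qed
qed

end
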